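(* Let $\Omega\subset\mathbb{R}^d$ be a bounded open set and let $\Psi:[0,+\infty]\to[0,+\infty]$ be a strictly decreasing function with $\Psi^{-1}$ convex. Let $$\mathcal{V}=\left\{V:\Omega\to[0,+\infty]\ :\ V\text{ Lebesgue measurable},\ \int_\Omega\Psi(V)\,dx\le1\right\}.$$ Then, for any functional $F:\mathcal{M}^+_{\mathrm{cap}}(\Omega)\to\mathbb{R}$ which is increasing and lower semicontinuous with respect to the $\gamma$-convergence, the problem $$\min\{F(V)\ :\ V\in\mathcal{V}\}$$ has a solution, where $F(V)$ means $F(V\,dx)$.
   Context: Capacity: for $E\subset\mathbb{R}^d$, $\mathrm{cap}(E)=\inf\{\int_{\mathbb{R}^d}|\nabla u|^2dx+\int_{\mathbb{R}^d}u^2dx : u\in H^1(\mathbb{R}^d),\ u\ge1\text{ in a neighborhood of }E\}$; "quasi-everywhere" (q.e.) means up to a set of zero capacity. Every $u\in H^1(\mathbb{R}^d)$ is identified with its quasi-continuous representative. $H^1_0(\Omega)=\{u\in H^1(\mathbb{R}^d): u=0\text{ q.e. on }\mathbb{R}^d\setminus\Omega\}$. A capacitary measure is a positive Borel measure $\mu$ on $\mathbb{R}^d$ (values in $[0,+\infty]$, not necessarily finite or Radon) with $\mu(E)=0$ whenever $\mathrm{cap}(E)=0$. $\mathcal{M}^+_{\mathrm{cap}}(\Omega)$ is the set of capacitary measures $\mu$ such that $\mu(E)=+\infty$ whenever $\mathrm{cap}(E\setminus\Omega)>0$. For a measurable $V:\Omega\to[0,+\infty]$, $V\,dx$ denotes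 the element of $\mathcal{M}^+_{\mathrm{cap}}(\Omega)$ given by $E\mapsto\int_{E\cap\Omega}V\,dx+I_\Omega(E)$, where $I_\Omega(E)=0$ if $\mathrm{cap}(E\setminus\Omega)=0$ and $I_\Omega(E)=+\infty$ otherwise. $\gamma$-convergence: for $\mu\in\mathcal{M}^+_{\mathrm{cap}}(\Omega)$ and $u\in L^2(\Omega)$ set $Q_\mu(u)=\int_{\mathbb{R}^d}|\nabla u|^2dx+\int_{\mathbb{R}^d}u^2d\mu$ if (the extension by zero of) $u$ lies in $H^1(\mathbb{R}^d)$ and $\int u^2d\mu<\infty$, and $Q_\mu(u)=+\infty$ otherwise. A sequence $\mu_n\in\mathcal{M}^+_{\mathrm{cap}}(\Omega)$ $\gamma$-converges to $\mu\in\mathcal{M}^+_{\mathrm{cap}}(\Omega)$ if (i) $Q_\mu(u)\le\liminf_n Q_{\mu_n}(u_n)$ whenever $u_n\to u$ in $L^2(\Omega)$, and (ii) for every $u\in L^2(\Omega)$ there is $u_n\to u$ in $L^2(\Omega)$ with $Q_\mu(u)=\lim_n Q_{\mu_n}(u_n)$. $F$ is increasing if $F(\mu)\le F(\nu)$ whenever $\mu\le\nu$ (i.e. $\mu(E)\le\nu(E)$ for every Borel set $E$). $F$ is lower semicontinuous with respect to the $\gamma$-convergence if $F(\mu)\le\liminf_nF(\mu_n)$ whenever $\mu_n$ $\gamma$-converges to $\mu$. $\Psi^{-1}$ denotes the inverse function of $\Psi$.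
   Formalization: The class 𝒱 is assumed nonempty (for Ψ(t)=2+1/(1+t) and |Ω|≥1 it is empty and no minimizer exists), and "Ψ^{-1} convex" is read as convex on the range of Ψ, which is required to be an interval. *)

theory Defs
  imports "HOL-Analysis.Analysis"
begin

text \<open>Functions on \<open>\<real>\<^sup>d\<close> are functions on an arbitrary Euclidean space \<open>'a\<close> with \<open>d = DIM('a)\<close>.
  Classes of functions modulo equality almost everywhere are handled through representatives.\<close>

definition L2_on :: "'a::euclidean_space set \<Rightarrow> ('a \<Rightarrow> 'b::euclidean_space) \<Rightarrow> bool" where
  "L2_on S f \<longleftrightarrow> f \<in> borel_measurable (lebesgue_on S) \<and>
     (\<integral>\<^sup>+x\<in>S. ennreal ((norm (f x))\<^sup>2) \<partial>lebesgue) < \<infinity>"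

definition L2_lim_on :: "'a::euclidean_space set \<Rightarrow> (nat \<Rightarrow> 'a \<Rightarrow> real) \<Rightarrow> ('a \<Rightarrow> real) \<Rightarrow> bool" where
  "L2_lim_on S us u \<longleftrightarrow> (\<forall>n. L2_on S (us n)) \<and> L2_on S u \<and>
     (\<lambda>n. \<integral>\<^sup>+x\<in>S. ennreal ((us n x - u x)\<^sup>2) \<partial>lebesgue) \<longlonglongrightarrow> 0"

primrec C_k :: "nat \<Rightarrow> ('a::euclidean_space \<Rightarrow> real) \<Rightarrow> bool" where
  "C_k 0 f \<longleftrightarrow> continuous_on UNIV f"
| "C_k (Suc k) f \<longleftrightarrow> f differentiable_on UNIV \<and>
     (\<forall>i\<in>Basis. C_k k (\<lambda>x. frechet_derivative f (at x) i))"

definition test_function :: "('a::euclidean_space \<Rightarrow> real) \<Rightarrow> bool" where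
  "test_function \<phi> \<longleftrightarrow> (\<forall>k. C_k k \<phi>) \<and> compact (closure {x. \<phi> x \<noteq> 0})"

definition has_H1_gradient :: "('a::euclidean_space \<Rightarrow> real) \<Rightarrow> ('a \<Rightarrow> 'a) \<Rightarrow> bool" where
  "has_H1_gradient u g \<longleftrightarrow> L2_on UNIV u \<and> L2_on UNIV g \<and>
     (\<forall>\<phi>. test_function \<phi> \<longrightarrow> (\<forall>i\<in>Basis.
        (\<integral>x. u x * frechet_derivative \<phi> (at x) i \<partial>lebesgue) = - (\<integral>x. (g x \<bullet> i) * \<phi> x \<partial>lebesgue)))"

definition H1 :: "('a::euclidean_space \<Rightarrow> real) set" where
  "H1 = {u. \<exists>g. has_H1_gradient u g}"

text \<open>The weak gradient is unique up to null sets, so the choice does not affect integrals.\<close>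

definition grad :: "('a::euclidean_space \<Rightarrow> real) \<Rightarrow> 'a \<Rightarrow> 'a" where
  "grad u = (SOME g. has_H1_gradient u g)"

definition cap :: "'a::euclidean_space set \<Rightarrow> ennreal" where
  "cap E = (INF u \<in> {u \<in> H1. \<exists>U. open U \<and> E \<subseteq> U \<and> (AE x in lebesgue. x \<in> U \<longrightarrow> 1 \<le> u x)}.
     (\<integral>\<^sup>+x. ennreal ((norm (grad u x))\<^sup>2) \<partial>lebesgue) + (\<integral>\<^sup>+x. ennreal ((u x)\<^sup>2) \<partial>lebesgue))"

definition quasi_continuous :: "('a::euclidean_space \<Rightarrow> real) \<Rightarrow> bool" where
  "quasi_continuous v \<longleftrightarrow> (\<forall>\<epsilon>>0. \<exists>A. open A \<and> cap A < \<epsilon> \<and> continuous_on (- A) v)"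

text \<open>Quasi-continuous representatives are unique up to sets of zero capacity, which capacitary
  measures do not charge.  Among them there are Borel functions; choosing one of these makes its
  square measurable for every Borel measure.\<close>

definition qc_rep :: "('a::euclidean_space \<Rightarrow> real) \<Rightarrow> 'a \<Rightarrow> real" where
  "qc_rep u = (SOME v. quasi_continuous v \<and> v \<in> borel_measurable borel \<and>
     (AE x in lebesgue. v x = u x))"

definition capacitary_measure :: "'a::euclidean_space measure \<Rightarrow> bool" where
  "capacitary_measure \<mu> \<longleftrightarrow> sets \<mu> = sets borel \<and>
     (\<forall>E\<in>sets borel. cap E = 0 \<longrightarrow> emeasure \<mu> E = 0)"

definition Mcap :: "'a::euclidean_space set \<Rightarrow> 'a measure set" where
  "Mcap \<Omega> = {\<mu>. capacitary_measure \<mu> \<and>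
     (\<forall>E\<in>sets borel. cap (E - \<Omega>) > 0 \<longrightarrow> emeasure \<mu> E = \<infinity>)}"

definition I_dom :: "'a::euclidean_space set \<Rightarrow> 'a set \<Rightarrow> ennreal" where
  "I_dom \<Omega> E = (if cap (E - \<Omega>) = 0 then 0 else \<infinity>)"

text \<open>The measure \<open>V dx\<close>; only the values of \<open>V\<close> on \<open>\<Omega>\<close> matter.\<close>

definition potential_measure :: "'a::euclidean_space set \<Rightarrow> ('a \<Rightarrow> ennreal) \<Rightarrow> 'a measure" where
  "potential_measure \<Omega> V = measure_of UNIV (sets borel)
     (\<lambda>E. (\<integral>\<^sup>+x\<in>E \<inter> \<Omega>. V x \<partial>lebesgue) + I_dom \<Omega> E)"

definition zero_ext :: "'a set \<Rightarrow> ('a \<Rightarrow> real) \<Rightarrow> 'a \<Rightarrow> real" where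
  "zero_ext \<Omega> u = (\<lambda>x. if x \<in> \<Omega> then u x else 0)"

definition Q_energy :: "'a::euclidean_space set \<Rightarrow> 'a measure \<Rightarrow> ('a \<Rightarrow> real) \<Rightarrow> ennreal" where
  "Q_energy \<Omega> \<mu> u =
     (if zero_ext \<Omega> u \<in> H1 \<and> (\<integral>\<^sup>+x. ennreal ((qc_rep (zero_ext \<Omega> u) x)\<^sup>2) \<partial>\<mu>) < \<infinity>
      then (\<integral>\<^sup>+x. ennreal ((norm (grad (zero_ext \<Omega> u) x))\<^sup>2) \<partial>lebesgue)
         + (\<integral>\<^sup>+x. ennreal ((qc_rep (zero_ext \<Omega> u) x)\<^sup>2) \<partial>\<mu>)
      else \<infinity>)"

definition gamma_converges ::
    "'a::euclidean_space set \<Rightarrow> (nat \<Rightarrow> 'a measure) \<Rightarrow> 'a measure \<Rightarrow> bool" where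
  "gamma_converges \<Omega> \<mu>s \<mu> \<longleftrightarrow>
     (\<forall>us u. L2_lim_on \<Omega> us u \<longrightarrow> Q_energy \<Omega> \<mu> u \<le> liminf (\<lambda>n. Q_energy \<Omega> (\<mu>s n) (us n))) \<and>
     (\<forall>u. L2_on \<Omega> u \<longrightarrow>
        (\<exists>us. L2_lim_on \<Omega> us u \<and> (\<lambda>n. Q_energy \<Omega> (\<mu>s n) (us n)) \<longlonglongrightarrow> Q_energy \<Omega> \<mu> u))"

definition increasing_on_Mcap :: "'a::euclidean_space set \<Rightarrow> ('a measure \<Rightarrow> real) \<Rightarrow> bool" where
  "increasing_on_Mcap \<Omega> F \<longleftrightarrow> (\<forall>\<mu>\<in>Mcap \<Omega>. \<forall>\<nu>\<in>Mcap \<Omega>.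
     (\<forall>E\<in>sets borel. emeasure \<mu> E \<le> emeasure \<nu> E) \<longrightarrow> F \<mu> \<le> F \<nu>)"

definition gamma_lsc :: "'a::euclidean_space set \<Rightarrow> ('a measure \<Rightarrow> real) \<Rightarrow> bool" where
  "gamma_lsc \<Omega> F \<longleftrightarrow> (\<forall>\<mu>s \<mu>. (\<forall>n. \<mu>s n \<in> Mcap \<Omega>) \<and> \<mu> \<in> Mcap \<Omega> \<and> gamma_converges \<Omega> \<mu>s \<mu>
     \<longrightarrow> ereal (F \<mu>) \<le> liminf (\<lambda>n. ereal (F (\<mu>s n))))"

text \<open>Convex functions on convex subsets of \<open>[0,\<infinity>]\<close>.  A convex subset is an interval; closure under
  convex combinations would not express this, because \<open>c * s + (1 - c) * \<infinity> = \<infinity>\<close> for \<open>c < 1\<close>.\<close>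

definition ennreal_convex_on :: "ennreal set \<Rightarrow> (ennreal \<Rightarrow> ennreal) \<Rightarrow> bool" where
  "ennreal_convex_on D f \<longleftrightarrow> (\<forall>s\<in>D. \<forall>t\<in>D. {s..t} \<subseteq> D) \<and>
     (\<forall>s\<in>D. \<forall>t\<in>D. \<forall>c\<in>{0..1}. f (c * s + (1 - c) * t) \<le> c * f s + (1 - c) * f t)"

definition admissible :: "'a::euclidean_space set \<Rightarrow> (ennreal \<Rightarrow> ennreal) \<Rightarrow> ('a \<Rightarrow> ennreal) set" where
  "admissible \<Omega> \<Psi> = {V. V \<in> borel_measurable (lebesgue_on \<Omega>) \<and>
     (\<integral>\<^sup>+x\<in>\<Omega>. \<Psi> (V x) \<partial>lebesgue) \<le> 1}"

end

theory Submission
  imports Defs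
begin

text \<open>
  Take a minimizing sequence of potentials \<open>V\<^sub>n\<close>. One would like to extract a \<open>\<gamma>\<close>-convergent
  subsequence of the measures \<open>V\<^sub>n dx\<close> and to compare its limit with a potential. Because \<open>F\<close> is
  increasing, it may be evaluated on truncated potentials instead, whose limits are easier
  to identify. For fixed \<open>k\<close> the functions \<open>min V\<^sub>n k\<close> are bounded, hence a subsequence converges
  weakly to some \<open>U\<^sub>k\<close>. For bounded potentials weak convergence implies
  \<open>\<gamma>\<close>-convergence (\<open>gamma_converges_weak\<close>): if \<open>u\<^sub>n \<longlonglongrightarrow> u\<close> in \<open>L\<^sup>2\<close>, then the integrals of
  \<open>u\<^sub>n\<^sup>2\<close> against the potentials converge, and the Dirichlet integral is lower semicontinuous.
  Therefore \<open>F(U\<^sub>k) \<le> liminf F(min V\<^sub>n k) \<le> lim F(V\<^sub>n) = inf F\<close>. The limits \<open>U\<^sub>k\<close> increase with \<open>k\<close>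
  and \<open>\<gamma>\<close>-converge to their supremum \<open>Y\<close> (\<open>gamma_converges_increasing\<close>), whence \<open>F(Y) \<le> inf F\<close>.

  It remains to see that \<open>Y\<close> is admissible. A strictly decreasing \<open>\<Psi>\<close> whose range is an interval and
  whose inverse is convex is itself convex and lower semicontinuous, so that bounds on the integral
  of \<open>\<Psi>\<close> survive weak limits (\<open>weak_limit_of_potentials\<close>). Truncation at height \<open>k\<close> raises \<open>\<Psi>\<close> by
  at most \<open>\<Psi>(k) - \<Psi>(\<infinity>)\<close>, which tends to \<open>0\<close>; as \<open>\<Omega>\<close> has finite measure, the bound \<open>1\<close> is
  recovered in the limit.

  The limits are produced by one device (\<open>midpoint_minimization\<close>): in a
  decreasing sequence of midpoint-convex sets, almost-minimizers of a quadratic functional form a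
  Cauchy sequence, by the parallelogram law. If the \<open>n\<close>-th set consists of all functions that are no
  worse than the tail \<open>{f\<^sub>k | k \<ge> n}\<close> of a bounded sequence, then the strong limit of the
  almost-minimizers has every closed convex property of the tails, and its norm is no larger than the
  bound. The lower semicontinuity of the Dirichlet integral, the existence of weak derivatives, the
  density of test functions and the weak limits of potentials are all obtained in this way.

  The energy of \<open>u\<close> with respect to the measure of a potential is an explicit integral when the
  quasi-continuous representative of \<open>u\<close> vanishes quasi-everywhere outside \<open>\<Omega>\<close>, and infinite
  otherwise (\<open>Q_energy_potential\<close>). This requires the theory of capacity: quasi-continuous
  representatives exist and are unique (\<open>qc_rep_exists\<close>, \<open>quasi_continuous_AE_eq\<close>), and vanishing
  outside \<open>\<Omega>\<close> is preserved by limits with bounded energy (\<open>H10_lower_semicontinuity\<close>). The theory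
  rests on the characterization of weak gradients by difference quotients
  (\<open>gradient_bounds_difference\<close>, \<open>gradient_of_bounded_quotients\<close>): difference quotients are easily
  controlled for countable suprema, which makes capacity countably subadditive (\<open>H1_supremum\<close>), and
  for averages of translates, which makes continuous functions dense (\<open>continuous_approximation\<close>).
\<close>

section \<open>Square-integrable functions\<close>

abbreviation L2 :: "('a::euclidean_space \<Rightarrow> 'b::euclidean_space) \<Rightarrow> bool" where
  "L2 \<equiv> L2_on UNIV"

text \<open>A real-valued square norm keeps the parallelogram law and the quadratic expansions in
  ordered-field arithmetic. It is \<open>0\<close> by default where the integral does not exist, so \<open>L2\<close> has to
  accompany it.\<close>

definition sqnorm :: "('a::euclidean_space \<Rightarrow> 'b::euclidean_space) \<Rightarrow> real" where
  "sqnorm f = (\<integral>x. (norm (f x))\<^sup>2 \<partial>lebesgue)"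

abbreviation pairing :: "('a::euclidean_space \<Rightarrow> real) \<Rightarrow> ('a \<Rightarrow> real) \<Rightarrow> real" where
  "pairing f g \<equiv> \<integral>x. f x * g x \<partial>lebesgue"

abbreviation L2_tendsto ::
    "(nat \<Rightarrow> 'a::euclidean_space \<Rightarrow> 'b::euclidean_space) \<Rightarrow> ('a \<Rightarrow> 'b) \<Rightarrow> bool" where
  "L2_tendsto f w \<equiv> (\<lambda>n. sqnorm (\<lambda>x. f n x - w x)) \<longlonglongrightarrow> 0"

lemma L2_iff:
  "L2 f \<longleftrightarrow> f \<in> borel_measurable lebesgue \<and> integrable lebesgue (\<lambda>x. (norm (f x))\<^sup>2)"
  unfolding L2_on_def by (auto simp: integrable_iff_bounded lebesgue_on_UNIV_eq)

lemma L2_measurable: "L2 f \<Longrightarrow> f \<in> borel_measurable lebesgue"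
  by (simp add: L2_iff)

lemma L2_integrable: "L2 f \<Longrightarrow> integrable lebesgue (\<lambda>x. (norm (f x))\<^sup>2)"
  by (simp add: L2_iff)

lemma sqnorm_nonneg [simp]: "0 \<le> sqnorm f"
  by (simp add: sqnorm_def)

lemma nn_sqnorm: "L2 f \<Longrightarrow> (\<integral>\<^sup>+x. ennreal ((norm (f x))\<^sup>2) \<partial>lebesgue) = ennreal (sqnorm f)"
  unfolding sqnorm_def by (intro nn_integral_eq_integral) (auto simp: L2_iff)

lemma L2_I_nn:
  assumes "f \<in> borel_measurable lebesgue"
    and "(\<integral>\<^sup>+x. ennreal ((norm (f x))\<^sup>2) \<partial>lebesgue) \<le> ennreal c" "0 \<le> c"
  shows "L2 f" "sqnorm f \<le> c"
proof -
  show *: "L2 f" using assms unfolding L2_on_def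
    by (auto simp: lebesgue_on_UNIV_eq intro: le_less_trans)
  show "sqnorm f \<le> c" using assms nn_sqnorm[OF *] by simp
qed

lemma L2_bound:
  assumes "f \<in> borel_measurable lebesgue" "integrable lebesgue h" "AE x in lebesgue. (norm (f x))\<^sup>2 \<le> h x"
  shows "L2 f" "sqnorm f \<le> (\<integral>x. h x \<partial>lebesgue)"
proof -
  show *: "L2 f"
    unfolding L2_iff
  proof (intro conjI assms(1))
    show "integrable lebesgue (\<lambda>x. (norm (f x))\<^sup>2)"
      by (rule Bochner_Integration.integrable_bound[OF assms(2)]) (use assms in auto)
  qed
  show "sqnorm f \<le> (\<integral>x. h x \<partial>lebesgue)"
    unfolding sqnorm_def
    by (rule integral_mono_AE) (use assms * in \<open>auto simp: L2_iff\<close>)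
qed

lemma norm_add_sq_le: "(norm (a + b))\<^sup>2 \<le> 2 * (norm a)\<^sup>2 + 2 * (norm (b::'b::real_inner))\<^sup>2"
proof -
  have "(norm (a + b))\<^sup>2 + (norm (a - b))\<^sup>2 = 2 * (norm a)\<^sup>2 + 2 * (norm b)\<^sup>2"
    by (simp add: power2_norm_eq_inner algebra_simps inner_add_left inner_add_right inner_diff_left inner_diff_right inner_commute)
  then show ?thesis by (smt (verit) zero_le_power2)
qed

lemma L2_scale: "L2 f \<Longrightarrow> L2 (\<lambda>x. c *\<^sub>R f x)"
  by (auto simp: L2_iff power_mult_distrib)

lemma L2_cmult: "L2 f \<Longrightarrow> L2 (\<lambda>x. c * (f x :: real))"
  using L2_scale[of f c] by simp

lemma L2_add: "L2 f \<Longrightarrow> L2 g \<Longrightarrow> L2 (\<lambda>x. f x + g x)"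
  by (rule L2_bound(1)[of _ "\<lambda>x. 2 * (norm (f x))\<^sup>2 + 2 * (norm (g x))\<^sup>2"])
     (auto simp: L2_iff norm_add_sq_le)

lemma L2_uminus: "L2 f \<Longrightarrow> L2 (\<lambda>x. - f x)"
  by (auto simp: L2_iff)

lemma L2_diff: "L2 f \<Longrightarrow> L2 g \<Longrightarrow> L2 (\<lambda>x. f x - g x)"
  using L2_add[OF _ L2_uminus] by (metis (no_types, lifting) ext diff_conv_add_uminus)

lemma L2_zero [simp]: "L2 (\<lambda>x. 0)"
  by (simp add: L2_iff)

lemma L2_component: "L2 f \<Longrightarrow> L2 (\<lambda>x. f x \<bullet> (e::'b::euclidean_space))"
proof -
  assume f: "L2 f"
  show ?thesis
  proof (rule L2_bound(1)[where h = "\<lambda>x. (norm e)\<^sup>2 * (norm (f x))\<^sup>2"])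
    show "AE x in lebesgue. (norm (f x \<bullet> e))\<^sup>2 \<le> (norm e)\<^sup>2 * (norm (f x))\<^sup>2"
    proof (rule AE_I2)
      fix x
      have "norm (f x \<bullet> e) \<le> norm e * norm (f x)"
        using Cauchy_Schwarz_ineq2[of "f x" e] by (simp add: mult.commute)
      then show "(norm (f x \<bullet> e))\<^sup>2 \<le> (norm e)\<^sup>2 * (norm (f x))\<^sup>2"
        unfolding power_mult_distrib[symmetric] by (intro power_mono) auto
    qed
  qed (use f in \<open>auto simp: L2_iff\<close>)
qed

lemma L2_mult_integrable: "L2 f \<Longrightarrow> L2 g \<Longrightarrow> integrable lebesgue (\<lambda>x. f x * (g x :: real))"
proof (rule Bochner_Integration.integrable_bound[of _ "\<lambda>x. (norm (f x))\<^sup>2 + (norm (g x))\<^sup>2"])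
  assume "L2 f" "L2 g"
  have "\<bar>f x * g x\<bar> \<le> (f x)\<^sup>2 + (g x)\<^sup>2" for x
  proof -
    have "0 \<le> (\<bar>f x\<bar> - \<bar>g x\<bar>)\<^sup>2" by simp
    then have "2 * \<bar>f x * g x\<bar> \<le> (f x)\<^sup>2 + (g x)\<^sup>2"
      by (simp add: power2_diff abs_mult)
    then show ?thesis by simp
  qed
  then show "AE x in lebesgue. norm (f x * g x) \<le> norm ((norm (f x))\<^sup>2 + (norm (g x))\<^sup>2)" by simp
qed (auto simp: L2_iff)

lemma sqnorm_cmult: "sqnorm (\<lambda>x. c *\<^sub>R f x) = c\<^sup>2 * sqnorm f"
  by (simp add: sqnorm_def power_mult_distrib)

lemma sqnorm_rmult: "sqnorm (\<lambda>x. c * (f x::real)) = c\<^sup>2 * sqnorm f"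
  by (simp add: sqnorm_def power_mult_distrib)

lemma sqnorm_minus_commute: "sqnorm (\<lambda>x. f x - g x) = sqnorm (\<lambda>x. g x - f x)"
  by (simp add: sqnorm_def norm_minus_commute)

lemma sqnorm_real: "sqnorm f = (\<integral>x. (f x)\<^sup>2 \<partial>lebesgue)" for f :: "'a::euclidean_space \<Rightarrow> real"
  by (simp add: sqnorm_def)

lemma sqnorm_diff_expand:
  fixes f g :: "'a::euclidean_space \<Rightarrow> real"
  assumes "L2 f" "L2 g"
  shows "sqnorm (\<lambda>x. f x - t * g x) = sqnorm f - 2 * t * pairing f g + t\<^sup>2 * sqnorm g"
proof -
  note i = L2_mult_integrable[OF assms] L2_mult_integrable[OF assms(1) assms(1)] L2_mult_integrable[OF assms(2) assms(2)]
  have "sqnorm (\<lambda>x. f x - t * g x) = (\<integral>x. f x * f x - 2 * t * (f x * g x) + t\<^sup>2 * (g x * g x) \<partial>lebesgue)"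
    unfolding sqnorm_real by (intro Bochner_Integration.integral_cong) (auto simp: power2_eq_square algebra_simps)
  also have "\<dots> = pairing f f - 2 * t * pairing f g + t\<^sup>2 * pairing g g"
    using i by simp
  finally show ?thesis by (simp add: sqnorm_real power2_eq_square)
qed

text \<open>The quadratic polynomial \<open>t \<mapsto> sqnorm (f - t g)\<close> is nonnegative; evaluate it at its minimum.\<close>

lemma L2_Cauchy_Schwarz:
  fixes f g :: "'a::euclidean_space \<Rightarrow> real"
  assumes "L2 f" "L2 g"
  shows "\<bar>pairing f g\<bar> \<le> sqrt (sqnorm f) * sqrt (sqnorm g)"
proof -
  define I where "I = pairing f g"
  have *: "0 \<le> sqnorm f - 2 * t * I + t\<^sup>2 * sqnorm g" for t
    using sqnorm_diff_expand[OF assms, of t] sqnorm_nonneg[of "\<lambda>x. f x - t * g x"] unfolding I_def by linarith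
  have "I\<^sup>2 \<le> sqnorm f * sqnorm g"
  proof (cases "sqnorm g = 0")
    case True
    have "I = 0"
    proof (rule ccontr)
      assume "I \<noteq> 0"
      with *[of "(sqnorm f + 1) / (2 * I)"] True show False by (simp add: field_simps)
    qed
    then show ?thesis by (simp add: True)
  next
    case False
    then have g: "sqnorm g > 0" using sqnorm_nonneg[of g] by linarith
    have "0 \<le> sqnorm f - 2 * (I / sqnorm g) * I + (I / sqnorm g)\<^sup>2 * sqnorm g" by (rule *)
    also have "\<dots> = sqnorm f - I\<^sup>2 / sqnorm g"
      using g by (simp add: field_simps power2_eq_square)
    finally show ?thesis using g by (simp add: field_simps)
  qed
  then have "\<bar>I\<bar> \<le> sqrt (sqnorm f * sqnorm g)"
    by (simp add: real_le_rsqrt)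
  then show ?thesis by (simp add: I_def real_sqrt_mult)
qed

lemma sqnorm_parallelogram:
  assumes "L2 f" "L2 g"
  shows "sqnorm (\<lambda>x. (1/2) *\<^sub>R (f x + g x)) + sqnorm (\<lambda>x. f x - g x) / 4 = (sqnorm f + sqnorm g) / 2"
proof -
  have "sqnorm (\<lambda>x. f x + g x) + sqnorm (\<lambda>x. f x - g x) =
     (\<integral>x. (norm (f x + g x))\<^sup>2 + (norm (f x - g x))\<^sup>2 \<partial>lebesgue)"
    unfolding sqnorm_def using L2_add[OF assms] L2_diff[OF assms] by (simp add: L2_iff)
  also have "\<dots> = (\<integral>x. 2 * (norm (f x))\<^sup>2 + 2 * (norm (g x))\<^sup>2 \<partial>lebesgue)"
    by (intro Bochner_Integration.integral_cong)
       (auto simp: power2_norm_eq_inner algebra_simps inner_add_left inner_add_right inner_diff_left inner_diff_right inner_commute)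
  also have "\<dots> = 2 * sqnorm f + 2 * sqnorm g"
    unfolding sqnorm_def using assms by (simp add: L2_iff)
  finally show ?thesis unfolding sqnorm_cmult by (simp add: power2_eq_square)
qed

lemma sqnorm_add_le:
  assumes "L2 f" "L2 g" shows "sqnorm (\<lambda>x. f x + g x) \<le> 2 * sqnorm f + 2 * sqnorm g"
proof -
  have "sqnorm (\<lambda>x. f x + g x) \<le> (\<integral>x. 2 * (norm (f x))\<^sup>2 + 2 * (norm (g x))\<^sup>2 \<partial>lebesgue)"
    by (rule L2_bound(2)) (use assms in \<open>auto simp: L2_iff norm_add_sq_le\<close>)
  also have "\<dots> = 2 * sqnorm f + 2 * sqnorm g"
    unfolding sqnorm_def using assms by (simp add: L2_iff)
  finally show ?thesis .
qed

lemma sqnorm_diff_triangle: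
  assumes "L2 f" "L2 g" "L2 h"
  shows "sqnorm (\<lambda>x. f x - h x) \<le> 2 * sqnorm (\<lambda>x. f x - g x) + 2 * sqnorm (\<lambda>x. g x - h x)"
  using sqnorm_add_le[OF L2_diff[OF assms(1,2)] L2_diff[OF assms(2,3)]] by simp

lemma sqnorm_cong_AE:
  assumes "AE x in lebesgue. f x = g x" "f \<in> borel_measurable lebesgue" "g \<in> borel_measurable lebesgue"
  shows "sqnorm f = sqnorm g"
  unfolding sqnorm_def using assms by (intro integral_cong_AE) auto

lemma L2_cong_AE:
  assumes "AE x in lebesgue. f x = g x" "L2 f" "g \<in> borel_measurable lebesgue"
  shows "L2 g"
  by (rule L2_bound(1)[OF assms(3) L2_integrable[OF assms(2)]]) (use assms(1) in auto)

lemma sqnorm_zero_AE: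
  assumes "L2 f" "sqnorm f \<le> 0" shows "AE x in lebesgue. f x = 0"
proof -
  have "sqnorm f = 0" using assms(2) sqnorm_nonneg[of f] by linarith
  then show ?thesis
    unfolding sqnorm_def using integral_nonneg_eq_0_iff_AE[OF L2_integrable[OF assms(1)]] by auto
qed

lemma L2_limit_mult:
  fixes f :: "nat \<Rightarrow> 'a::euclidean_space \<Rightarrow> real"
  assumes "\<And>n. L2 (f n)" "L2 w" "L2 \<phi>" "L2_tendsto f w"
  shows "(\<lambda>n. pairing (f n) \<phi>) \<longlonglongrightarrow> pairing w \<phi>"
proof (rule LIM_zero_cancel, rule Lim_null_comparison)
  show "\<forall>\<^sub>F n in sequentially. norm (pairing (f n) \<phi> - pairing w \<phi>)
     \<le> sqrt (sqnorm (\<lambda>x. f n x - w x)) * sqrt (sqnorm \<phi>)"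
  proof (rule always_eventually, rule allI)
    fix n
    have "pairing (f n) \<phi> - pairing w \<phi> = (\<integral>x. (f n x - w x) * \<phi> x \<partial>lebesgue)"
      using L2_mult_integrable[OF assms(1,3)] L2_mult_integrable[OF assms(2,3)]
      by (simp add: left_diff_distrib)
    then show "norm (pairing (f n) \<phi> - pairing w \<phi>)
     \<le> sqrt (sqnorm (\<lambda>x. f n x - w x)) * sqrt (sqnorm \<phi>)"
      using L2_Cauchy_Schwarz[OF L2_diff[OF assms(1) assms(2)] assms(3)] by simp
  qed
  show "(\<lambda>n. sqrt (sqnorm (\<lambda>x. f n x - w x)) * sqrt (sqnorm \<phi>)) \<longlonglongrightarrow> 0"
    using tendsto_mult_right[OF tendsto_real_sqrt[OF assms(4)], of "sqrt (sqnorm \<phi>)"] by simp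
qed

text \<open>Young's inequality \<open>(a + b)\<^sup>2 \<le> (1 + t) a\<^sup>2 + (1 + 1/t) b\<^sup>2\<close> separates the given bounds from the
  vanishing error; let \<open>n\<close> tend to infinity and then \<open>t\<close> to \<open>0\<close>.\<close>

lemma L2_limit_sqnorm:
  fixes f :: "nat \<Rightarrow> 'a::euclidean_space \<Rightarrow> 'b::euclidean_space"
  assumes "\<And>n. L2 (f n)" "L2 w" "L2_tendsto f w"
    and bd: "\<And>n. sqnorm (f n) \<le> M n" "M \<longlonglongrightarrow> m"
  shows "sqnorm w \<le> m"
proof -
  have s: "sqnorm w \<le> (1 + t) * M n + (1 + 1/t) * sqnorm (\<lambda>x. f n x - w x)" if "t > 0" for t n
  proof -
    have *: "(norm (w x))\<^sup>2 \<le> (1 + t) * (norm (f n x))\<^sup>2 + (1 + 1/t) * (norm (f n x - w x))\<^sup>2" for x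
    proof -
      have "norm (w x) \<le> norm (f n x) + norm (f n x - w x)"
        by (metis norm_triangle_sub norm_minus_commute)
      then have "(norm (w x))\<^sup>2 \<le> (norm (f n x) + norm (f n x - w x))\<^sup>2" by (intro power_mono) auto
      also have "\<dots> \<le> (1 + t) * (norm (f n x))\<^sup>2 + (1 + 1/t) * (norm (f n x - w x))\<^sup>2"
      proof -
        have "0 \<le> (t * norm (f n x) - norm (f n x - w x))\<^sup>2 / t" using that by simp
        also have "\<dots> = t * (norm (f n x))\<^sup>2 - 2 * norm (f n x) * norm (f n x - w x) + (norm (f n x - w x))\<^sup>2 / t"
          using that by (simp add: field_simps power2_eq_square)
        finally show ?thesis by (simp add: power2_sum algebra_simps)
      qed
      finally show ?thesis .
    qed
    have "sqnorm w \<le> (\<integral>x. (1 + t) * (norm (f n x))\<^sup>2 + (1 + 1/t) * (norm (f n x - w x))\<^sup>2 \<partial>lebesgue)"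
      by (rule L2_bound(2)) (use * assms(1,2) L2_integrable[OF L2_diff[OF assms(1)[of n] assms(2)]] in \<open>auto simp: L2_iff\<close>)
    also have "\<dots> = (1 + t) * sqnorm (f n) + (1 + 1/t) * sqnorm (\<lambda>x. f n x - w x)"
      unfolding sqnorm_def using L2_integrable[OF L2_diff[OF assms(1)[of n] assms(2)]] L2_integrable[OF assms(1)]
      by simp
    also have "\<dots> \<le> (1 + t) * M n + (1 + 1/t) * sqnorm (\<lambda>x. f n x - w x)"
      using that bd(1)[of n] by (intro add_right_mono mult_left_mono) auto
    finally show ?thesis .
  qed
  have "sqnorm w \<le> (1 + t) * m" if "t > 0" for t
  proof (rule tendsto_lowerbound[where F = sequentially])
    show "(\<lambda>n. (1 + t) * M n + (1 + 1/t) * sqnorm (\<lambda>x. f n x - w x)) \<longlonglongrightarrow> (1 + t) * m"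
      using tendsto_add[OF tendsto_mult_left[OF bd(2), of "1 + t"] tendsto_mult_left[OF assms(3), of "1 + 1/t"]] by simp
    show "\<forall>\<^sub>F n in sequentially. sqnorm w \<le> (1 + t) * M n + (1 + 1/t) * sqnorm (\<lambda>x. f n x - w x)"
      using s[OF that] by simp
  qed simp
  then have "\<forall>\<^sub>F t in at_right 0. sqnorm w \<le> (1 + t) * m"
    by (simp add: eventually_at_right_less eventually_at_filter)
  moreover have "((\<lambda>t. (1 + t) * m) \<longlongrightarrow> (1 + 0) * m) (at_right 0)"
    by (intro tendsto_intros)
  ultimately show ?thesis
    using tendsto_lowerbound[of "\<lambda>t. (1 + t) * m" "(1+0)*m" "at_right 0" "sqnorm w"] by simp
qed

text \<open>The series of the squared errors has a finite integral, hence converges almost everywhere, and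
  its terms tend to \<open>0\<close>.\<close>

lemma fast_L2_limit_AE:
  fixes f :: "nat \<Rightarrow> 'a::euclidean_space \<Rightarrow> 'b::euclidean_space"
  assumes "\<And>n. L2 (f n)" "L2 w" "\<And>n. sqnorm (\<lambda>x. f n x - w x) \<le> c * (1/4) ^ n"
  shows "AE x in lebesgue. (\<lambda>n. f n x) \<longlonglongrightarrow> w x"
proof -
  have c: "0 \<le> c" using order_trans[OF sqnorm_nonneg assms(3)[of 0]] by simp
  have m: "(\<lambda>x. f n x - w x) \<in> borel_measurable lebesgue" for n
    using L2_diff[OF assms(1,2)] by (rule L2_measurable)
  have "(\<integral>\<^sup>+x. (\<Sum>n. ennreal ((norm (f n x - w x))\<^sup>2)) \<partial>lebesgue)
      = (\<Sum>n. (\<integral>\<^sup>+x. ennreal ((norm (f n x - w x))\<^sup>2) \<partial>lebesgue))"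
    using m by (intro nn_integral_suminf) auto
  also have "\<dots> = (\<Sum>n. ennreal (sqnorm (\<lambda>x. f n x - w x)))"
    by (intro suminf_cong nn_sqnorm L2_diff assms)
  also have "\<dots> \<le> (\<Sum>n. ennreal (c * (1/4) ^ n))"
    by (intro suminf_le) (auto intro!: ennreal_leI assms(3))
  also have "\<dots> < \<infinity>"
    using c by (subst suminf_ennreal2) (auto intro!: summable_mult summable_geometric)
  finally have "(\<integral>\<^sup>+x. (\<Sum>n. ennreal ((norm (f n x - w x))\<^sup>2)) \<partial>lebesgue) \<noteq> \<infinity>" by simp
  then have "AE x in lebesgue. (\<Sum>n. ennreal ((norm (f n x - w x))\<^sup>2)) \<noteq> \<infinity>"
    using m by (intro nn_integral_PInf_AE) auto
  then show ?thesis
  proof eventually_elim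
    case (elim x)
    then have "summable (\<lambda>n. (norm (f n x - w x))\<^sup>2)"
      by (intro summable_suminf_not_top) auto
    then have "(\<lambda>n. sqrt ((norm (f n x - w x))\<^sup>2)) \<longlonglongrightarrow> sqrt 0"
      by (intro tendsto_real_sqrt summable_LIMSEQ_zero)
    then show ?case by (simp add: LIM_zero_iff tendsto_norm_zero_iff)
  qed
qed

text \<open>Riesz-Fischer. With increments of size \<open>4\<^sup>-\<^sup>n\<close> in square norm the weighted series
  \<open>\<Sum>n. 2\<^sup>n d\<^sub>n\<^sup>2\<close> converges almost everywhere; since \<open>2 d\<^sub>n \<le> 2\<^sup>n d\<^sub>n\<^sup>2 + 2\<^sup>-\<^sup>n\<close>, so does the series of the
  increments. Fatou's lemma turns the pointwise limit into a limit in square norm.\<close>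

lemma L2_complete_fast:
  fixes f :: "nat \<Rightarrow> 'a::euclidean_space \<Rightarrow> 'b::euclidean_space"
  assumes L: "\<And>n. L2 (f n)" and fast: "\<And>n m. n \<le> m \<Longrightarrow> sqnorm (\<lambda>x. f m x - f n x) \<le> (1/4) ^ n"
  obtains w where "L2 w" "\<And>n. sqnorm (\<lambda>x. f n x - w x) \<le> (1/4) ^ n"
proof -
  define d where "d n x = norm (f (Suc n) x - f n x)" for n x
  have Ld: "L2 (\<lambda>x. f (Suc n) x - f n x)" for n by (intro L2_diff L)
  have dm: "d n \<in> borel_measurable lebesgue" for n
    unfolding d_def using L2_measurable[OF Ld] by simp
  have "(\<integral>\<^sup>+x. (\<Sum>n. ennreal (2 ^ n * (d n x)\<^sup>2)) \<partial>lebesgue) = (\<Sum>n. \<integral>\<^sup>+x. ennreal (2 ^ n * (d n x)\<^sup>2) \<partial>lebesgue)"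
    using dm by (intro nn_integral_suminf) auto
  also have "\<dots> = (\<Sum>n. ennreal (2 ^ n * sqnorm (\<lambda>x. f (Suc n) x - f n x)))"
  proof (rule suminf_cong)
    fix n show "(\<integral>\<^sup>+x. ennreal (2 ^ n * (d n x)\<^sup>2) \<partial>lebesgue) = ennreal (2 ^ n * sqnorm (\<lambda>x. f (Suc n) x - f n x))"
      using nn_sqnorm[OF Ld, of n] dm[of n] unfolding d_def
      by (simp add: ennreal_mult) (subst nn_integral_cmult, auto)
  qed
  also have "\<dots> \<le> (\<Sum>n. ennreal ((1/2) ^ n))"
  proof (intro suminf_le ennreal_leI)
    fix n show "2 ^ n * sqnorm (\<lambda>x. f (Suc n) x - f n x) \<le> (1/2) ^ n"
      using mult_left_mono[OF fast[of n "Suc n"], of "2^n"] by (simp flip: power_mult_distrib)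
  qed auto
  also have "\<dots> < \<infinity>"
    by (subst suminf_ennreal2) (auto intro!: summable_geometric)
  finally have "(\<integral>\<^sup>+x. (\<Sum>n. ennreal (2 ^ n * (d n x)\<^sup>2)) \<partial>lebesgue) \<noteq> \<infinity>" by simp
  then have "AE x in lebesgue. (\<Sum>n. ennreal (2 ^ n * (d n x)\<^sup>2)) \<noteq> \<infinity>"
    using dm by (intro nn_integral_PInf_AE) auto
  then have conv: "AE x in lebesgue. convergent (\<lambda>n. f n x)"
  proof eventually_elim
    case (elim x)
    have s: "summable (\<lambda>n. 2 ^ n * (d n x)\<^sup>2)"
      using elim by (intro summable_suminf_not_top) auto
    have "summable (\<lambda>n. 2 ^ n * (d n x)\<^sup>2 + (1/2) ^ n)"
      by (intro summable_add s summable_geometric) auto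
    then have "summable (\<lambda>n. f (Suc n) x - f n x)"
    proof (rule summable_comparison_test[rotated], intro exI allI impI)
      fix n
      have "0 \<le> (2 ^ n * d n x - 1)\<^sup>2 / 2 ^ n" by simp
      also have "\<dots> = 2 ^ n * (d n x)\<^sup>2 - 2 * d n x + (1/2)^n"
        by (simp add: field_simps power2_eq_square)
      finally show "norm (f (Suc n) x - f n x) \<le> 2 ^ n * (d n x)\<^sup>2 + (1/2) ^ n"
        unfolding d_def[symmetric] using d_def[of n x] by (smt (verit) norm_ge_zero)
    qed
    then have "convergent (\<lambda>n. (\<Sum>i<n. f (Suc i) x - f i x) + f 0 x)"
      by (intro convergent_add convergent_const) (simp add: summable_iff_convergent)
    then show ?case by (simp add: sum_lessThan_telescope[of "\<lambda>n. f n x"])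
  qed
  define w where "w x = lim (\<lambda>n. f n x)" for x
  have wm: "w \<in> borel_measurable lebesgue"
    unfolding w_def using L2_measurable[OF L] by (intro borel_measurable_lim_metric)
  have lw: "AE x in lebesgue. (\<lambda>n. f n x) \<longlonglongrightarrow> w x"
    using conv unfolding w_def by eventually_elim (simp add: convergent_LIMSEQ_iff)
  have b: "(\<integral>\<^sup>+x. ennreal ((norm (f n x - w x))\<^sup>2) \<partial>lebesgue) \<le> ennreal ((1/4)^n)" for n
  proof -
    have "(\<integral>\<^sup>+x. ennreal ((norm (f n x - w x))\<^sup>2) \<partial>lebesgue)
      = (\<integral>\<^sup>+x. liminf (\<lambda>m. ennreal ((norm (f n x - f m x))\<^sup>2)) \<partial>lebesgue)"
    proof (rule nn_integral_cong_AE)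
      show "AE x in lebesgue. ennreal ((norm (f n x - w x))\<^sup>2) = liminf (\<lambda>m. ennreal ((norm (f n x - f m x))\<^sup>2))"
        using lw
      proof eventually_elim
        case (elim x)
        then have "(\<lambda>m. ennreal ((norm (f n x - f m x))\<^sup>2)) \<longlonglongrightarrow> ennreal ((norm (f n x - w x))\<^sup>2)"
          by (intro tendsto_ennrealI tendsto_intros)
        then show ?case by (rule lim_imp_Liminf[OF sequentially_bot, symmetric])
      qed
    qed
    also have "\<dots> \<le> liminf (\<lambda>m. (\<integral>\<^sup>+x. ennreal ((norm (f n x - f m x))\<^sup>2) \<partial>lebesgue))"
      using L2_measurable[OF L2_diff[OF L L]] by (intro nn_integral_liminf) auto
    also have "\<dots> = liminf (\<lambda>m. ennreal (sqnorm (\<lambda>x. f n x - f m x)))"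
      by (simp add: nn_sqnorm[OF L2_diff[OF L L]])
    also have "\<dots> \<le> ennreal ((1/4)^n)"
    proof (rule Liminf_le)
      show "\<forall>\<^sub>F m in sequentially. ennreal (sqnorm (\<lambda>x. f n x - f m x)) \<le> ennreal ((1/4)^n)"
        unfolding eventually_sequentially
        using fast by (intro exI[of _ n]) (auto intro!: ennreal_leI simp: sqnorm_minus_commute[of "f n"])
    qed simp
    finally show ?thesis .
  qed
  have Lnw: "L2 (\<lambda>x. f n x - w x)" "sqnorm (\<lambda>x. f n x - w x) \<le> (1/4)^n" for n
    using L2_I_nn[OF _ b] wm L2_measurable[OF L] by auto
  show thesis
  proof (rule that)
    show "L2 w" using L2_diff[OF L[of 0] Lnw(1)[of 0]] by simp
  qed (rule Lnw(2))
qed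

text \<open>Thinning out a Cauchy sequence. Only the uniform smallness of \<open>D\<close> along the tails matters, so
  that \<open>D\<close> can also measure the distance of its first argument from a fixed limit.\<close>

lemma fast_subseq:
  fixes D :: "nat \<Rightarrow> nat \<Rightarrow> real"
  assumes "\<And>e. e > 0 \<Longrightarrow> \<exists>N. \<forall>m\<ge>N. \<forall>n\<ge>N. D m n < e" and "\<And>n. e n > (0::real)"
  obtains r :: "nat \<Rightarrow> nat" where "strict_mono r" "\<And>n m. n \<le> m \<Longrightarrow> D (r m) (r n) \<le> e n"
proof -
  have "\<forall>k. \<exists>N. \<forall>m\<ge>N. \<forall>n\<ge>N. D m n < e k" using assms by blast
  then obtain N where N: "\<And>k m n. m \<ge> N k \<Longrightarrow> n \<ge> N k \<Longrightarrow> D m n < e k" by metis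
  define r where "r = rec_nat (N 0) (\<lambda>k a. max (Suc a) (N (Suc k)))"
  have rS: "r (Suc k) = max (Suc (r k)) (N (Suc k))" for k by (simp add: r_def)
  have sm: "strict_mono r" by (rule strict_monoI_Suc) (simp add: rS less_Suc_eq_le)
  have "r k \<ge> N k" for k by (cases k) (auto simp: rS, simp add: r_def)
  then have "r n \<ge> N n" for n .
  moreover have "r m \<ge> r n" if "n \<le> m" for m n using sm that by (simp add: strict_mono_less_eq)
  ultimately have "D (r m) (r n) \<le> e n" if "n \<le> m" for m n
    using N[of n "r m" "r n"] that by (meson less_imp_le order_trans order_refl)
  with sm show thesis by (rule that)
qed

lemma L2_complete:
  fixes f :: "nat \<Rightarrow> 'a::euclidean_space \<Rightarrow> 'b::euclidean_space"
  assumes L: "\<And>n. L2 (f n)"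
    and C: "\<And>e. e > 0 \<Longrightarrow> \<exists>N. \<forall>m\<ge>N. \<forall>n\<ge>N. sqnorm (\<lambda>x. f m x - f n x) < e"
  obtains w where "L2 w" "L2_tendsto f w"
proof -
  obtain r where r: "strict_mono r" "\<And>n m. n \<le> m \<Longrightarrow> sqnorm (\<lambda>x. f (r m) x - f (r n) x) \<le> (1/4)^n"
    by (rule fast_subseq[of "\<lambda>m n. sqnorm (\<lambda>x. f m x - f n x)" "\<lambda>n. (1/4)^n", OF C]) auto
  obtain w where w: "L2 w" "\<And>n. sqnorm (\<lambda>x. f (r n) x - w x) \<le> (1/4) ^ n"
    using L2_complete_fast[of "\<lambda>n. f (r n)", OF L r(2)] by blast
  show thesis
  proof (rule that[OF w(1)], rule LIMSEQ_I)
    fix e :: real assume e: "e > 0"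
    obtain N where N: "\<And>m n. m \<ge> N \<Longrightarrow> n \<ge> N \<Longrightarrow> sqnorm (\<lambda>x. f m x - f n x) < e / 4"
      using C[of "e/4"] e by auto
    obtain k where k: "(1/4)^k < e / 4" using real_arch_pow_inv[of "e/4" "1/4"] e by auto
    define j where "j = max k N"
    have "r j \<ge> N" using seq_suble[OF r(1), of j] by (simp add: j_def)
    have "(1/4::real)^j \<le> (1/4)^k" by (rule power_decreasing) (auto simp: j_def)
    have "norm (sqnorm (\<lambda>x. f n x - w x) - 0) < e" if "n \<ge> N" for n
      using sqnorm_diff_triangle[OF L[of n] L[of "r j"] w(1)] N[OF that \<open>r j \<ge> N\<close>] w(2)[of j] \<open>(1/4::real)^j \<le> (1/4)^k\<close> k
      unfolding real_norm_def diff_zero abs_of_nonneg[OF sqnorm_nonneg] by linarith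
    then show "\<exists>N. \<forall>n\<ge>N. norm (sqnorm (\<lambda>x. f n x - w x) - 0) < e" by blast
  qed
qed

section \<open>Minimizing sequences in convex sets\<close>

text \<open>The projection argument of Hilbert space theory, for a decreasing sequence of sets instead of a
  single one. The infima \<open>d n\<close> of \<open>q\<close> over \<open>C n\<close> increase and are bounded, hence converge. The
  midpoint of two late almost-minimizers has \<open>q\<close> at least \<open>d N\<close>, so the parallelogram inequality
  leaves no room for \<open>D\<close> (a quarter of the squared distance in all applications).\<close>

lemma midpoint_minimization:
  fixes C :: "nat \<Rightarrow> 'c set" and q :: "'c \<Rightarrow> real"
  assumes dec: "\<And>n. C (Suc n) \<subseteq> C n" and ne: "\<And>n. C n \<noteq> {}"
    and mid: "\<And>n a b. a \<in> C n \<Longrightarrow> b \<in> C n \<Longrightarrow> mid a b \<in> C n"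
    and par: "\<And>a b. a \<in> C 0 \<Longrightarrow> b \<in> C 0 \<Longrightarrow> q (mid a b) + D a b \<le> (q a + q b) / 2"
    and q0: "\<And>a. a \<in> C 0 \<Longrightarrow> 0 \<le> q a"
    and bd: "\<And>n. \<exists>a\<in>C n. q a \<le> M"
  obtains w where "\<And>n. w n \<in> C n" "\<And>n a. a \<in> C n \<Longrightarrow> q (w n) \<le> q a + 1 / Suc n"
    "\<And>e. e > 0 \<Longrightarrow> \<exists>N. \<forall>m\<ge>N. \<forall>n\<ge>N. D (w m) (w n) < e"
proof -
  define d where "d n = Inf (q ` C n)" for n
  have mono: "C m \<subseteq> C n" if "n \<le> m" for m n using lift_Suc_antimono_le[of C, OF dec that] .
  have C0: "a \<in> C 0" if "a \<in> C n" for a n using mono[of 0 n] that by auto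
  have bb: "bdd_below (q ` C n)" for n using q0 C0 by (auto intro!: bdd_belowI2[of _ 0])
  have dle: "d n \<le> q a" if "a \<in> C n" for a n
    unfolding d_def using that bb by (intro cInf_lower) auto
  have "\<exists>a\<in>C n. q a < d n + 1 / Suc n" for n
    using cInf_lessD[of "q ` C n" "d n + 1 / Suc n"] ne unfolding d_def by fastforce
  then obtain w where w: "\<And>n. w n \<in> C n" "\<And>n. q (w n) < d n + 1 / Suc n" by metis
  have dmono: "d n \<le> d m" if "n \<le> m" for m n
    unfolding d_def using ne by (intro cInf_superset_mono bb image_mono mono that) auto
  have dM: "d n \<le> M" for n using bd[of n] dle by force
  have "incseq d" using dmono by (simp add: incseq_def)
  then obtain L where L: "d \<longlonglongrightarrow> L" "\<And>n. d n \<le> L" using incseq_convergent[of d M] dM by blast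
  show thesis
  proof (rule that[of w])
    show "w n \<in> C n" for n by (rule w(1))
    show "q (w n) \<le> q a + 1 / Suc n" if "a \<in> C n" for n a using w(2)[of n] dle[OF that] by simp
    fix e :: real assume e: "e > 0"
    obtain N1 where N1: "\<And>n. n \<ge> N1 \<Longrightarrow> L - d n < e / 2"
    proof -
      obtain N where "\<forall>n\<ge>N. norm (d n - L) < e / 2" using LIMSEQ_D[OF L(1), of "e/2"] e by auto
      then have "L - d n < e / 2" if "n \<ge> N" for n
        using that L(2)[of n] by (smt (verit) real_norm_def)
      then show thesis by (rule that)
    qed
    obtain N2 where N2: "inverse (real (Suc N2)) < e / 2" using reals_Archimedean[of "e/2"] e by auto
    define N where "N = max N1 N2"
    have "D (w m) (w n) < e" if "m \<ge> N" "n \<ge> N" for m n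
    proof -
      have "mid (w m) (w n) \<in> C N" by (intro mid subsetD[OF mono w(1)] that)
      then have 1: "d N \<le> q (mid (w m) (w n))" by (rule dle)
      have 2: "q (mid (w m) (w n)) + D (w m) (w n) \<le> (q (w m) + q (w n)) / 2"
        using par C0 w(1) by blast
      have 3: "1 / real (Suc m) \<le> 1 / Suc N2" "1 / real (Suc n) \<le> 1 / Suc N2"
        using that by (auto simp: N_def frac_le)
      have "L - d N < e / 2" by (rule N1) (simp add: N_def)
      have 4: "q (w k) < L + e / 2" if "1 / real (Suc k) \<le> 1 / Suc N2" for k
      proof -
        have "q (w k) < d k + 1 / real (Suc k)" by (rule w(2))
        also have "\<dots> \<le> L + inverse (real (Suc N2))"
          using that L(2)[of k] unfolding inverse_eq_divide by (intro add_mono) auto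
        also have "\<dots> < L + e / 2" using N2 by simp
        finally show ?thesis .
      qed
      show ?thesis
        using 1 2 4[OF 3(1)] 4[OF 3(2)] \<open>L - d N < e / 2\<close> by argo
    qed
    then show "\<exists>N. \<forall>m\<ge>N. \<forall>n\<ge>N. D (w m) (w n) < e" by blast
  qed
qed

section \<open>Test functions\<close>

abbreviation dir_deriv :: "('a::euclidean_space \<Rightarrow> real) \<Rightarrow> 'a \<Rightarrow> 'a \<Rightarrow> real" where
  "dir_deriv \<phi> e x \<equiv> frechet_derivative \<phi> (at x) e"

lemma C_k_differentiable: "C_k (Suc k) f \<Longrightarrow> f differentiable (at x)"
  by (simp add: differentiable_on_def)

lemma C_k_deriv: "C_k (Suc k) f \<Longrightarrow> i \<in> Basis \<Longrightarrow> C_k k (\<lambda>x. dir_deriv f i x)"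
  by simp

lemma C_k_SucI:
  assumes "\<And>x. (f has_derivative f' x) (at x)" "\<And>i. i \<in> Basis \<Longrightarrow> C_k k (\<lambda>x. f' x i)"
  shows "C_k (Suc k) f"
proof -
  have "frechet_derivative f (at x) = f' x" for x
    using frechet_derivative_at[OF assms(1)] by simp
  then show ?thesis
    using assms by (auto simp: differentiable_on_def differentiable_def)
qed

lemma C_k_frechet: "C_k (Suc k) f \<Longrightarrow> (f has_derivative frechet_derivative f (at x)) (at x)"
  using C_k_differentiable frechet_derivative_works by blast

lemma C_k_lower: "C_k (Suc k) f \<Longrightarrow> C_k k f"
proof (induction k arbitrary: f)
  case 0
  then show ?case by (auto intro: differentiable_imp_continuous_on)
next
  case (Suc k)
  then have "\<forall>i\<in>Basis. C_k k (\<lambda>x. dir_deriv f i x)" by auto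
  with Suc.prems show ?case by auto
qed

lemma C_k_const: "C_k k (\<lambda>x. c)"
proof (induction k arbitrary: c)
  case (Suc k)
  show ?case by (rule C_k_SucI[of _ "\<lambda>x h. 0"]) (auto intro: Suc)
qed simp

lemma C_k_add: "C_k k f \<Longrightarrow> C_k k g \<Longrightarrow> C_k k (\<lambda>x. f x + g x)"
proof (induction k arbitrary: f g)
  case 0 then show ?case by (auto intro: continuous_on_add)
next
  case (Suc k)
  show ?case
  proof (rule C_k_SucI)
    show "((\<lambda>x. f x + g x) has_derivative
      (\<lambda>h. dir_deriv f h x + dir_deriv g h x)) (at x)" for x
      by (intro has_derivative_add C_k_frechet[OF Suc.prems(1)] C_k_frechet[OF Suc.prems(2)])
  qed (intro Suc.IH C_k_deriv[OF Suc.prems(1)] C_k_deriv[OF Suc.prems(2)])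
qed

lemma C_k_mult: "C_k k f \<Longrightarrow> C_k k g \<Longrightarrow> C_k k (\<lambda>x. f x * g x)"
proof (induction k arbitrary: f g)
  case 0 then show ?case by (auto intro: continuous_on_mult)
next
  case (Suc k)
  show ?case
  proof (rule C_k_SucI)
    show "((\<lambda>x. f x * g x) has_derivative
      (\<lambda>h. f x * dir_deriv g h x + dir_deriv f h x * g x)) (at x)" for x
      by (intro has_derivative_mult C_k_frechet[OF Suc.prems(1)] C_k_frechet[OF Suc.prems(2)])
  qed (intro C_k_add Suc.IH C_k_deriv[OF Suc.prems(1)] C_k_deriv[OF Suc.prems(2)]
      C_k_lower[OF Suc.prems(1)] C_k_lower[OF Suc.prems(2)])
qed

lemma C_k_prod: "finite I \<Longrightarrow> (\<And>i. i \<in> I \<Longrightarrow> C_k k (f i)) \<Longrightarrow> C_k k (\<lambda>x. \<Prod>i\<in>I. f i x)"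
  by (induction I rule: finite_induct) (auto intro: C_k_mult C_k_const)

lemma has_derivative_shift:
  assumes "(f has_derivative f') (at (x + a))" shows "((\<lambda>x. f (x + a)) has_derivative f') (at x)"
proof -
  have "((\<lambda>x. x + a) has_derivative (\<lambda>h. h)) (at x)"
    by (auto intro!: derivative_eq_intros)
  from has_derivative_compose[OF this, of f f'] assms show ?thesis by simp
qed

lemma C_k_shift: "C_k k f \<Longrightarrow> C_k k (\<lambda>x. f (x + a))"
proof (induction k arbitrary: f)
  case 0 then show ?case by (auto intro!: continuous_on_compose2[of UNIV f] continuous_intros)
next
  case (Suc k)
  show ?case
    by (rule C_k_SucI[OF has_derivative_shift[OF C_k_frechet[OF Suc.prems]]])
       (intro Suc.IH C_k_deriv[OF Suc.prems])
qed

text \<open>Stated for a whole family of iterated derivatives, because the induction on \<open>k\<close> passes from \<open>D j\<close>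
  to \<open>D (Suc j)\<close>.\<close>

lemma C_k_inner:
  assumes "\<And>j t. (D j has_real_derivative D (Suc j) t) (at t)"
  shows "C_k k (\<lambda>x. D j (c + x \<bullet> b))"
proof (induction k arbitrary: j)
  case 0
  have "continuous_on UNIV (D j)"
    using DERIV_isCont[OF assms] by (auto simp: continuous_on_eq_continuous_at)
  then show ?case by (auto intro!: continuous_on_compose2[of UNIV "D j"] continuous_intros)
next
  case (Suc k)
  show ?case
  proof (rule C_k_SucI)
    show "((\<lambda>x. D j (c + x \<bullet> b)) has_derivative (\<lambda>h. D (Suc j) (c + x \<bullet> b) * (h \<bullet> b))) (at x)" for x
    proof -
      have 1: "((\<lambda>x. c + x \<bullet> b) has_derivative (\<lambda>h. h \<bullet> b)) (at x)"
        by (auto intro!: derivative_eq_intros)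
      have 2: "(D j has_derivative (\<lambda>h. D (Suc j) (c + x \<bullet> b) * h)) (at (c + x \<bullet> b))"
        using assms[of j "c + x \<bullet> b"] by (simp add: has_field_derivative_def)
      show ?thesis using has_derivative_compose[OF 1 2] by simp
    qed
    show "C_k k (\<lambda>x. D (Suc j) (c + x \<bullet> b) * (i \<bullet> b))" for i
      by (intro C_k_mult Suc C_k_const)
  qed
qed

text \<open>The functions \<open>p(1/t) exp(-1/t)\<close>, extended by zero to the negative half line. The family is closed
  under differentiation, which makes every member smooth.\<close>

definition flat :: "real poly \<Rightarrow> real \<Rightarrow> real" where
  "flat p t = (if t > 0 then poly p (1/t) * exp (- 1/t) else 0)"

lemma poly_exp_tendsto_0: "((\<lambda>s. poly p s * exp (- s)) \<longlongrightarrow> (0::real)) at_top"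
proof -
  have "((\<lambda>s. \<Sum>i\<le>degree p. coeff p i * (s ^ i / exp s)) \<longlongrightarrow> (\<Sum>i\<le>degree p. coeff p i * (0::real))) at_top"
    by (intro tendsto_intros tendsto_power_div_exp_0)
  then show ?thesis
    by (simp add: poly_altdef sum_distrib_right exp_minus field_simps sum_divide_distrib)
qed

lemma flat_tendsto_0: "(flat p \<longlongrightarrow> 0) (at 0)"
proof (rule filterlim_split_at)
  show "(flat p \<longlongrightarrow> 0) (at_left 0)"
    by (rule tendsto_eventually) (auto simp: flat_def eventually_at_filter)
  have "((\<lambda>t. poly p (inverse t) * exp (- inverse t)) \<longlongrightarrow> 0) (at_right (0::real))"
    by (rule filterlim_compose[OF poly_exp_tendsto_0 filterlim_inverse_at_top_right])
  then show "(flat p \<longlongrightarrow> 0) (at_right 0)"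
    by (rule Lim_transform_eventually)
       (auto simp: eventually_at_filter flat_def inverse_eq_divide)
qed

text \<open>Away from the origin this is the product rule. At the origin the difference quotient is again a
  function of the family, and exponential decay beats any polynomial.\<close>

lemma flat_deriv: "(flat p has_real_derivative flat ([:0,0,1:] * (p - pderiv p)) t) (at t)"
proof -
  consider "t > 0" | "t < 0" | "t = 0" by linarith
  then show ?thesis
  proof cases
    case 1
    have "((\<lambda>t. poly p (1/t) * exp (- 1/t)) has_real_derivative
        (poly (pderiv p) (1/t) * (- 1 / t^2) * exp (- 1/t) + poly p (1/t) * (exp (- 1/t) * (1 / t^2)))) (at t)"
      using 1 by (auto intro!: derivative_eq_intros DERIV_chain2[OF poly_DERIV] simp: power2_eq_square field_simps)
    also have "(poly (pderiv p) (1/t) * (- 1 / t^2) * exp (- 1/t) + poly p (1/t) * (exp (- 1/t) * (1 / t^2)))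
       = flat ([:0,0,1:] * (p - pderiv p)) t"
      using 1 by (simp add: flat_def power2_eq_square field_simps)
    finally show ?thesis
      by (rule has_field_derivative_transform_within_open[of _ _ _ "{0<..}"]) (use 1 in \<open>auto simp: flat_def\<close>)
  next
    case 2
    have "((\<lambda>t. 0) has_real_derivative 0) (at t)" by simp
    then have "(flat p has_real_derivative 0) (at t)"
      by (rule has_field_derivative_transform_within_open[of _ _ _ "{..<0}"]) (use 2 in \<open>auto simp: flat_def\<close>)
    then show ?thesis using 2 by (simp add: flat_def)
  next
    case 3
    have "((\<lambda>y. (flat p y - flat p 0) / (y - 0)) \<longlongrightarrow> 0) (at 0)"
      by (rule Lim_transform_eventually[OF flat_tendsto_0[of "[:0,1:] * p"]])
         (auto simp: flat_def eventually_at_filter field_simps)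
    then show ?thesis
      unfolding 3 by (simp add: has_field_derivative_iff flat_def)
  qed
qed

fun flat_poly :: "nat \<Rightarrow> real poly" where
  "flat_poly 0 = 1"
| "flat_poly (Suc j) = [:0,0,1:] * (flat_poly j - pderiv (flat_poly j))"

abbreviation \<eta> :: "real \<Rightarrow> real" where "\<eta> \<equiv> flat 1"

lemma C_k_eta: "C_k k (\<lambda>x. \<eta> (c + x \<bullet> b))"
  using C_k_inner[of "\<lambda>j. flat (flat_poly j)" k 0 c b] flat_deriv by simp

lemma eta_bounds: "0 \<le> \<eta> t" "\<eta> t \<le> 1" "t \<le> 0 \<Longrightarrow> \<eta> t = 0"
  by (auto simp: flat_def)

lemma eta_limit: "t > 0 \<Longrightarrow> (\<lambda>n. \<eta> (real (Suc n) * t)) \<longlonglongrightarrow> 1"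
proof -
  assume t: "t > 0"
  have "(\<lambda>n. exp (- (1 / t) * inverse (real (Suc n)))) \<longlonglongrightarrow> exp (- (1/t) * 0)"
    by (intro tendsto_intros LIMSEQ_inverse_real_of_nat)
  moreover have "\<eta> (real (Suc n) * t) = exp (- (1 / t) * inverse (real (Suc n)))" for n
  proof -
    have "real (Suc n) * t > 0" using t by (intro mult_pos_pos) auto
    then have "\<eta> (real (Suc n) * t) = exp (- 1 / (real (Suc n) * t))" by (simp add: flat_def)
    also have "- 1 / (real (Suc n) * t) = - (1 / t) * inverse (real (Suc n))"
      by (simp add: divide_simps)
    finally show ?thesis .
  qed
  ultimately show ?thesis by simp
qed

text \<open>The factor \<open>Suc n\<close> steepens the slopes, so that the bumps exhaust the indicator of the box from
  below as \<open>n\<close> grows.\<close>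

definition bump :: "'a::euclidean_space \<Rightarrow> 'a \<Rightarrow> nat \<Rightarrow> 'a \<Rightarrow> real" where
  "bump a c n x = (\<Prod>b\<in>Basis. \<eta> (real (Suc n) * ((x - a) \<bullet> b)) * \<eta> (real (Suc n) * ((c - x) \<bullet> b)))"

lemma bump_bounds: "0 \<le> bump a c n x" "bump a c n x \<le> 1"
  unfolding bump_def
  by (auto intro!: prod_nonneg prod_le_1 mult_le_one eta_bounds mult_nonneg_nonneg)

lemma bump_outside: "x \<notin> box a c \<Longrightarrow> bump a c n x = 0"
proof -
  assume "x \<notin> box a c"
  then obtain b where b: "b \<in> Basis" "x \<bullet> b \<le> a \<bullet> b \<or> c \<bullet> b \<le> x \<bullet> b"
    by (auto simp: mem_box not_less)
  then have "(x - a) \<bullet> b \<le> 0 \<or> (c - x) \<bullet> b \<le> 0" by (auto simp: inner_diff_left)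
  then have "real (Suc n) * ((x - a) \<bullet> b) \<le> 0 \<or> real (Suc n) * ((c - x) \<bullet> b) \<le> 0"
    by (meson mult_nonneg_nonpos of_nat_0_le_iff)
  then have "\<eta> (real (Suc n) * ((x - a) \<bullet> b)) * \<eta> (real (Suc n) * ((c - x) \<bullet> b)) = 0"
    using eta_bounds(3) by auto
  then show ?thesis unfolding bump_def using b(1) by (intro prod_zero) auto
qed

lemma bump_limit: "(\<lambda>n. bump a c n x) \<longlonglongrightarrow> indicator (box a c) x"
proof (cases "x \<in> box a c")
  case True
  then have "(x - a) \<bullet> b > 0" "(c - x) \<bullet> b > 0" if "b \<in> Basis" for b
    using that by (auto simp: mem_box inner_diff_left)
  then have "(\<lambda>n. bump a c n x) \<longlonglongrightarrow> (\<Prod>b\<in>(Basis::'a set). 1 * 1)"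
    unfolding bump_def by (intro tendsto_prod tendsto_mult eta_limit) auto
  with True show ?thesis by simp
qed (simp add: bump_outside)

lemma C_k_bump: "C_k k (bump a c n)"
proof -
  have "C_k k (\<lambda>x. \<eta> (real (Suc n) * ((x - a) \<bullet> b)) * \<eta> (real (Suc n) * ((c - x) \<bullet> b)))" for b
  proof (rule C_k_mult)
    show "C_k k (\<lambda>x. \<eta> (real (Suc n) * ((x - a) \<bullet> b)))"
      using C_k_eta[of k "- real (Suc n) * (a \<bullet> b)" "real (Suc n) *\<^sub>R b"]
      by (simp add: algebra_simps inner_diff_left)
    show "C_k k (\<lambda>x. \<eta> (real (Suc n) * ((c - x) \<bullet> b)))"
      using C_k_eta[of k "real (Suc n) * (c \<bullet> b)" "- real (Suc n) *\<^sub>R b"]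
      by (simp add: algebra_simps inner_diff_left)
  qed
  then show ?thesis unfolding bump_def[abs_def] by (intro C_k_prod) auto
qed

lemma test_functionI:
  assumes "\<And>k. C_k k \<phi>" "bounded S" "\<And>x. x \<notin> S \<Longrightarrow> \<phi> x = 0"
  shows "test_function \<phi>"
proof -
  have "bounded {x. \<phi> x \<noteq> 0}" by (rule bounded_subset[OF assms(2)]) (use assms(3) in auto)
  then show ?thesis unfolding test_function_def using assms(1) by (simp add: compact_closure)
qed

lemma test_function_bump: "test_function (bump a c n)"
  by (rule test_functionI[of _ "box a c"]) (auto simp: C_k_bump bump_outside bounded_box)

lemma test_function_C_k: "test_function \<phi> \<Longrightarrow> C_k k \<phi>"
  by (simp add: test_function_def)

lemma test_function_support:
  assumes "test_function \<phi>"
  obtains R where "R > 0" "\<And>x. norm x > R \<Longrightarrow> \<phi> x = 0"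
proof -
  have "bounded {x. \<phi> x \<noteq> 0}"
    using assms unfolding test_function_def
    by (meson bounded_subset closure_subset compact_imp_bounded)
  then obtain R where "R > 0" "\<forall>x\<in>{x. \<phi> x \<noteq> 0}. norm x \<le> R" by (auto simp: bounded_pos)
  then show thesis by (intro that[of R]) force+
qed

lemma test_function_add:
  assumes "test_function f" "test_function g" shows "test_function (\<lambda>x. f x + g x)"
proof -
  obtain R where R: "\<And>x. norm x > R \<Longrightarrow> f x = 0" using test_function_support[OF assms(1)] by blast
  obtain S where S: "\<And>x. norm x > S \<Longrightarrow> g x = 0" using test_function_support[OF assms(2)] by blast
  show ?thesis
    by (rule test_functionI[of _ "cball 0 (max R S)"])
       (use R S assms in \<open>auto intro: C_k_add test_function_C_k\<close>)
qed

lemma test_function_cmult: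
  assumes "test_function f" shows "test_function (\<lambda>x. c * f x)"
proof -
  obtain R where R: "\<And>x. norm x > R \<Longrightarrow> f x = 0" using test_function_support[OF assms(1)] by blast
  show ?thesis
    by (rule test_functionI[of _ "cball 0 R"])
       (use R assms in \<open>auto intro: C_k_mult C_k_const test_function_C_k\<close>)
qed

lemma test_function_shift:
  assumes "test_function f" shows "test_function (\<lambda>x. f (x + a))"
proof -
  obtain R where R: "\<And>x. norm x > R \<Longrightarrow> f x = 0" using test_function_support[OF assms(1)] by blast
  show ?thesis
  proof (rule test_functionI[of _ "cball (-a) R"])
    show "f (x + a) = 0" if "x \<notin> cball (- a) R" for x
      using that by (intro R) (simp add: dist_norm norm_minus_commute[of "-a"])
  qed (use assms in \<open>auto intro: C_k_shift test_function_C_k\<close>)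
qed

lemma test_function_continuous: "test_function \<phi> \<Longrightarrow> continuous_on UNIV \<phi>"
  using test_function_C_k[of \<phi> 0] by simp

lemma test_function_deriv: "test_function \<phi> \<Longrightarrow> (\<phi> has_derivative frechet_derivative \<phi> (at x)) (at x)"
  using C_k_frechet test_function_C_k by blast

lemma test_function_deriv_zero:
  assumes "\<And>x. norm x > R \<Longrightarrow> \<phi> x = 0" "norm x > R"
  shows "frechet_derivative \<phi> (at x) = (\<lambda>h. 0)"
proof -
  have "((\<lambda>x. 0) has_derivative (\<lambda>h. 0)) (at x)" by simp
  then have "(\<phi> has_derivative (\<lambda>h. 0)) (at x)"
  proof (rule has_derivative_transform_within_open[of _ _ _ _ "- cball 0 R"])
  qed (use assms in auto)
  then show ?thesis using frechet_derivative_at by metis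
qed

lemma test_function_deriv_expand:
  assumes "test_function \<phi>"
  shows "dir_deriv \<phi> e x = (\<Sum>i\<in>Basis. (e \<bullet> i) * dir_deriv \<phi> i x)"
proof -
  have "linear (frechet_derivative \<phi> (at x))"
    using has_derivative_linear[OF test_function_deriv[OF assms]] .
  then have "frechet_derivative \<phi> (at x) (\<Sum>i\<in>Basis. (e \<bullet> i) *\<^sub>R i) = (\<Sum>i\<in>Basis. (e \<bullet> i) *\<^sub>R dir_deriv \<phi> i x)"
    by (simp add: linear_sum linear_scale)
  then show ?thesis by (simp add: euclidean_representation)
qed

lemma test_function_deriv_continuous:
  assumes "test_function \<phi>"
  shows "continuous_on UNIV (\<lambda>x. dir_deriv \<phi> e x)"
  unfolding test_function_deriv_expand[OF assms, of _ e]
  using test_function_C_k[OF assms, of "Suc 0"]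
  by (intro continuous_intros) auto

lemma continuous_bounded_support:
  fixes f :: "'a::euclidean_space \<Rightarrow> real"
  assumes "continuous_on UNIV f" "\<And>x. norm x > R \<Longrightarrow> f x = 0"
  obtains B where "B > 0" "\<And>x. \<bar>f x\<bar> \<le> B"
proof -
  have "compact (f ` cball 0 R)"
    by (intro compact_continuous_image continuous_on_subset[OF assms(1)]) auto
  then obtain B where "B > 0" "\<forall>y\<in>f ` cball 0 R. norm y \<le> B"
    using compact_imp_bounded bounded_pos by blast
  then have "\<bar>f x\<bar> \<le> B" for x by (cases "norm x > R") (auto simp: assms(2) not_less)
  with \<open>B > 0\<close> show thesis by (rule that)
qed

lemma continuous_lebesgue_measurable:
  "continuous_on UNIV f \<Longrightarrow> f \<in> borel_measurable lebesgue"
  by (intro measurable_completion) (simp add: borel_measurable_continuous_onI)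

lemma L2_bounded_support:
  fixes f :: "'a::euclidean_space \<Rightarrow> real"
  assumes "f \<in> borel_measurable lebesgue" "\<And>x. \<bar>f x\<bar> \<le> B" "\<And>x. x \<notin> S \<Longrightarrow> f x = 0" "bounded S"
  shows "L2 f"
proof -
  obtain R where R: "S \<subseteq> cball 0 R" using assms(4) unfolding bounded_pos by (auto simp: subset_eq)
  show ?thesis
  proof (rule L2_bound(1)[where h = "\<lambda>x. B\<^sup>2 * indicator (cball 0 R) x"])
    have "emeasure lebesgue (cball (0::'a) R) < \<infinity>"
      using emeasure_compact_finite[of "cball 0 R"] by simp
    then show "integrable lebesgue (\<lambda>x. B\<^sup>2 * indicator (cball (0::'a) R) x)"
      by (intro integrable_mult_right integrable_real_indicator) auto
    show "AE x in lebesgue. (norm (f x))\<^sup>2 \<le> B\<^sup>2 * indicator (cball (0::'a) R) x"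
    proof (rule AE_I2)
      fix x
      have "\<bar>f x\<bar>\<^sup>2 \<le> B\<^sup>2" by (intro power_mono assms(2)) auto
      moreover have "f x = 0" if "x \<notin> cball 0 R" using that R by (intro assms(3)) blast
      ultimately show "(norm (f x))\<^sup>2 \<le> B\<^sup>2 * indicator (cball 0 R) x"
        by (cases "x \<in> cball 0 R") auto
    qed
  qed (use assms in auto)
qed

lemma test_function_L2: "test_function \<phi> \<Longrightarrow> L2 \<phi>"
  using test_function_support[of \<phi>] continuous_bounded_support[of \<phi>] test_function_continuous[of \<phi>]
  by (metis L2_bounded_support[of \<phi> _ "cball 0 _"] bounded_cball continuous_lebesgue_measurable mem_cball_0 not_le)

lemma test_function_deriv_L2:
  assumes "test_function \<phi>" shows "L2 (\<lambda>x. dir_deriv \<phi> e x)"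
proof -
  obtain R where R: "\<And>x. norm x > R \<Longrightarrow> \<phi> x = 0" using test_function_support[OF assms] by blast
  note c = test_function_deriv_continuous[OF assms, of e]
  have z: "dir_deriv \<phi> e x = 0" if "norm x > R" for x
    using test_function_deriv_zero[OF R that] by simp
  obtain B where "\<And>x. \<bar>dir_deriv \<phi> e x\<bar> \<le> B"
    using continuous_bounded_support[OF c z] by blast
  then show ?thesis
    by (rule L2_bounded_support[of _ _ "cball 0 R", OF continuous_lebesgue_measurable[OF c]])
       (use z in auto)
qed

section \<open>Functions determined by their integrals\<close>

text \<open>A countable family suffices to identify a function, and countability is what permits the
  extraction of a subsequence along which all integrals over the family converge.\<close>

definition rational_boxes :: "'a::euclidean_space set set" where
  "rational_boxes = (\<lambda>f. box (\<Sum>i\<in>Basis. fst (f i) *\<^sub>R i) (\<Sum>i\<in>Basis. snd (f i) *\<^sub>R i)) ` (Basis \<rightarrow>\<^sub>E \<rat> \<times> \<rat>)"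

lemma countable_rational_boxes: "countable (rational_boxes :: 'a::euclidean_space set set)"
  unfolding rational_boxes_def
  by (intro countable_image countable_PiE countable_SIGMA countable_rat) auto

lemma rational_boxes_box: "B \<in> rational_boxes \<Longrightarrow> \<exists>a c. B = box a c"
  unfolding rational_boxes_def by auto

lemma Int_stable_rational_boxes: "Int_stable (rational_boxes :: 'a::euclidean_space set set)"
proof (rule Int_stableI)
  fix A B :: "'a set" assume "A \<in> rational_boxes" "B \<in> rational_boxes"
  then obtain f g where f: "f \<in> Basis \<rightarrow>\<^sub>E \<rat> \<times> \<rat>" "A = box (\<Sum>i\<in>Basis. fst (f i) *\<^sub>R i) (\<Sum>i\<in>Basis. snd (f i) *\<^sub>R i)"
    and g: "g \<in> Basis \<rightarrow>\<^sub>E \<rat> \<times> \<rat>" "B = box (\<Sum>i\<in>Basis. fst (g i) *\<^sub>R i) (\<Sum>i\<in>Basis. snd (g i) *\<^sub>R i)"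
    unfolding rational_boxes_def by auto
  define h where "h = (\<lambda>i\<in>(Basis :: 'a set). (max (fst (f i)) (fst (g i)), min (snd (f i)) (snd (g i))))"
  have "h \<in> Basis \<rightarrow>\<^sub>E \<rat> \<times> \<rat>"
  proof (rule PiE_I)
    fix i :: 'a assume i: "i \<in> Basis"
    have "f i \<in> \<rat> \<times> \<rat>" "g i \<in> \<rat> \<times> \<rat>" using f(1) g(1) i by auto
    then show "h i \<in> \<rat> \<times> \<rat>" using i unfolding h_def by (cases "f i"; cases "g i") (auto simp: max_def min_def)
  qed (simp add: h_def)
  moreover have "A \<inter> B = box (\<Sum>i\<in>Basis. fst (h i) *\<^sub>R i) (\<Sum>i\<in>Basis. snd (h i) *\<^sub>R i)"
    unfolding f(2) g(2) by (auto simp: mem_box h_def)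
  ultimately show "A \<inter> B \<in> rational_boxes" unfolding rational_boxes_def by blast
qed

lemma Union_rational_boxes: 
  assumes "open (M :: 'a::euclidean_space set)" 
  shows "M = \<Union>{B \<in> rational_boxes. B \<subseteq> M}"
  by (subst open_UNION_box[OF assms]) (auto simp: rational_boxes_def)

lemma sigma_sets_rational_boxes: "sigma_sets UNIV (rational_boxes :: 'a::euclidean_space set set) = sets borel"
proof -
  have "(borel :: 'a measure) = sigma UNIV rational_boxes"
  proof (rule borel_eq_sigmaI1[where F = "\<lambda>x. x" and A = rational_boxes and X = "{S. open S}", simplified, OF borel_def])
    fix M :: "'a set" assume M: "open M"
    have "\<Union>{B \<in> rational_boxes. B \<subseteq> M} \<in> sigma_sets UNIV rational_boxes"
      by (intro sigma_sets_UNION countable_subset[OF _ countable_rational_boxes]) auto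
    then show "M \<in> sigma_sets UNIV rational_boxes"
      using Union_rational_boxes[OF M] by simp
  qed (use rational_boxes_box open_box borel_open in blast)
  then show ?thesis using sets_measure_of[of "rational_boxes :: 'a set set" UNIV] by (metis Pow_UNIV subset_UNIV)
qed

lemma box_lebesgue [measurable, simp]: "box a c \<in> sets lebesgue"
  by (rule sets_completionI_sets) simp

lemma indicator_box_measurable [measurable, simp]: "(indicator (box a c) :: _ \<Rightarrow> real) \<in> borel_measurable lebesgue"
  by (rule borel_measurable_indicator) simp

lemma L2_indicator_box: "L2 (indicator (box a c) :: 'a::euclidean_space \<Rightarrow> real)"
  by (rule L2_bounded_support[of _ 1 "box a c"]) (auto split: split_indicator simp: bounded_box)

text \<open>The positive and the negative part of \<open>f\<close> define measures that agree on the boxes, an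
  intersection-stable generator of the Borel sets, hence everywhere.\<close>

lemma L2_zero_if_zero_on_boxes:
  fixes f :: "'a::euclidean_space \<Rightarrow> real"
  assumes f: "L2 f" and z: "\<And>B. B \<in> rational_boxes \<Longrightarrow> (pairing f (indicator B)) = 0"
  shows "AE x in lebesgue. f x = 0"
proof -
  obtain g where g: "g \<in> borel_measurable lborel" "AE x in lborel. f x = g x"
    using completion_ex_borel_measurable_real L2_measurable[OF f] by blast
  have fg: "AE x in lebesgue. f x = g x" using g(2) by (rule AE_completion)
  have gm: "g \<in> borel_measurable lebesgue" using g(1) by (rule measurable_completion)
  have g2: "L2 g" by (rule L2_cong_AE[OF fg f gm])
  define P where "P = density lborel (\<lambda>x. ennreal (g x))"
  define N where "N = density lborel (\<lambda>x. ennreal (- g x))"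
  have pm: "emeasure (density lborel (\<lambda>x. ennreal (s * g x))) B = ennreal (\<integral>x. max 0 (s * g x) * indicator B x \<partial>lborel)"
    and pmi: "integrable lborel (\<lambda>x. max 0 (s * g x) * indicator B x)"
    if B: "B \<in> rational_boxes" and s: "s = 1 \<or> s = -1" for B s
  proof -
    obtain a c where ac: "B = box a c" using rational_boxes_box[OF B] by blast
    have 1: "integrable lebesgue (\<lambda>x. g x * indicator B x)"
      unfolding ac by (intro L2_mult_integrable g2 L2_indicator_box)
    have "integrable lborel (\<lambda>x. g x * indicator B x)"
      using 1 g(1) by (subst (asm) integrable_completion) (auto simp: ac)
    then show i: "integrable lborel (\<lambda>x. max 0 (s * g x) * indicator B x)"
      by (rule Bochner_Integration.integrable_bound) (use g(1) s in \<open>auto simp: ac split: split_indicator\<close>)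
    have "emeasure (density lborel (\<lambda>x. ennreal (s * g x))) B = (\<integral>\<^sup>+x. ennreal (s * g x) * indicator B x \<partial>lborel)"
      using g(1) by (intro emeasure_density) (auto simp: ac)
    also have "\<dots> = (\<integral>\<^sup>+x. ennreal (max 0 (s * g x) * indicator B x) \<partial>lborel)"
      by (intro nn_integral_cong) (auto split: split_indicator simp: max_def ennreal_neg)
    also have "\<dots> = ennreal (\<integral>x. max 0 (s * g x) * indicator B x \<partial>lborel)"
      by (intro nn_integral_eq_integral i) auto
    finally show "emeasure (density lborel (\<lambda>x. ennreal (s * g x))) B = ennreal (\<integral>x. max 0 (s * g x) * indicator B x \<partial>lborel)" .
  qed
  have "P = N"
  proof (rule measure_eqI_generator_eq_countable[where E = "rational_boxes" and \<Omega> = UNIV and A = rational_boxes])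
    show "emeasure P B = emeasure N B" if B: "B \<in> rational_boxes" for B
    proof -
      obtain a c where ac: "B = box a c" using rational_boxes_box[OF B] by blast
      have "0 = pairing f (indicator B)" using z[OF B] by simp
      also have "\<dots> = pairing g (indicator B)"
        using fg L2_measurable[OF f] gm by (intro integral_cong_AE) (auto simp: ac)
      also have "\<dots> = (\<integral>x. g x * indicator B x \<partial>lborel)"
        using g(1) by (intro integral_completion) (auto simp: ac)
      also have "\<dots> = (\<integral>x. max 0 (1 * g x) * indicator B x - max 0 (-1 * g x) * indicator B x \<partial>lborel)"
        by (intro Bochner_Integration.integral_cong) (auto split: split_indicator)
      also have "\<dots> = (\<integral>x. max 0 (1 * g x) * indicator B x \<partial>lborel) - (\<integral>x. max 0 (-1 * g x) * indicator B x \<partial>lborel)"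
        by (intro Bochner_Integration.integral_diff pmi[OF B]) auto
      finally show ?thesis
        using pm[OF B, of 1] pm[OF B, of "-1"] unfolding P_def N_def by simp
    qed
    show "\<Union>rational_boxes = (UNIV::'a set)" using Union_rational_boxes[of "UNIV::'a set"] by simp
    show "emeasure P B \<noteq> \<infinity>" if "B \<in> rational_boxes" for B
      using pm[OF that, of 1] unfolding P_def by simp
  qed (auto simp: Int_stable_rational_boxes sigma_sets_rational_boxes countable_rational_boxes P_def N_def)
  then have "AE x in lborel. ennreal (g x) = ennreal (- g x)"
    unfolding P_def N_def using g(1) by (subst (asm) sigma_finite_measure.density_unique_iff[OF sigma_finite_lborel]) auto
  then have "AE x in lborel. g x = 0"
  proof eventually_elim
    case (elim x)
    show ?case
    proof (cases "g x \<ge> 0")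
      case True
      then have "ennreal (g x) = 0" using elim by (simp add: ennreal_neg)
      with True show ?thesis by (simp add: ennreal_eq_0_iff)
    next
      case False
      then have "ennreal (- g x) = 0" using elim by (simp add: ennreal_neg)
      with False show ?thesis by (simp add: ennreal_eq_0_iff)
    qed
  qed
  then have "AE x in lebesgue. g x = 0" by (rule AE_completion)
  with fg show ?thesis by eventually_elim simp
qed

lemma L2_zero_if_orthogonal_to_test_functions:
  fixes f :: "'a::euclidean_space \<Rightarrow> real"
  assumes f: "L2 f" and z: "\<And>\<phi>. test_function \<phi> \<Longrightarrow> (pairing f \<phi>) = 0"
  shows "AE x in lebesgue. f x = 0"
proof (rule L2_zero_if_zero_on_boxes[OF f])
  fix B :: "'a set" assume "B \<in> rational_boxes"
  then obtain a c where B: "B = box a c" using rational_boxes_box by blast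
  have bm: "bump a c n \<in> borel_measurable lebesgue" for n
    by (rule L2_measurable[OF test_function_L2[OF test_function_bump]])
  have "(\<lambda>n. pairing f (bump a c n)) \<longlonglongrightarrow> pairing f (indicator B)"
  proof (rule integral_dominated_convergence[where w = "\<lambda>x. \<bar>f x * indicator B x\<bar>"])
    show "integrable lebesgue (\<lambda>x. \<bar>f x * indicator B x\<bar>)"
      unfolding B by (intro integrable_abs L2_mult_integrable f L2_indicator_box)
    show "AE x in lebesgue. (\<lambda>n. f x * bump a c n x) \<longlonglongrightarrow> f x * indicator B x"
      unfolding B by (intro AE_I2 tendsto_intros bump_limit)
    show "AE x in lebesgue. norm (f x * bump a c n x) \<le> \<bar>f x * indicator B x\<bar>" for n
      using bump_bounds[of a c n] by (auto simp: B abs_mult bump_outside mult_left_le split: split_indicator)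
  qed (use L2_measurable[OF f] bm in \<open>auto simp: B\<close>)
  moreover have "pairing f (bump a c n) = 0" for n
    by (rule z[OF test_function_bump])
  ultimately have "(\<lambda>n::nat. 0) \<longlonglongrightarrow> pairing f (indicator B)" by simp
  then show "pairing f (indicator B) = 0"
    by (simp add: LIMSEQ_const_iff)
qed

text \<open>Projection onto the closure of a subspace: almost-minimizers of the distance to \<open>f\<close> converge, and
  the difference between \<open>f\<close> and their limit is orthogonal to the subspace.\<close>

lemma L2_dense_if_total:
  fixes f :: "'a::euclidean_space \<Rightarrow> real" and P :: "('a \<Rightarrow> real) set"
  assumes P: "\<And>p. p \<in> P \<Longrightarrow> L2 p" "P \<noteq> {}" "\<And>p q. p \<in> P \<Longrightarrow> q \<in> P \<Longrightarrow> (\<lambda>x. p x + q x) \<in> P"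
     "\<And>p c. p \<in> P \<Longrightarrow> (\<lambda>x. c * p x) \<in> P"
    and tot: "\<And>w. L2 w \<Longrightarrow> (\<And>p. p \<in> P \<Longrightarrow> (pairing w p) = 0) \<Longrightarrow> AE x in lebesgue. w x = 0"
    and f: "L2 f"
  obtains p where "\<And>n. p n \<in> P" "L2_tendsto p f"
proof -
  obtain a0 where a0: "a0 \<in> P" using P(2) by auto
  obtain p where p: "\<And>n. p n \<in> P" "\<And>n a. a \<in> P \<Longrightarrow> sqnorm (\<lambda>x. f x - p n x) \<le> sqnorm (\<lambda>x. f x - a x) + 1 / Suc n"
    "\<And>e. e > 0 \<Longrightarrow> \<exists>N. \<forall>m\<ge>N. \<forall>n\<ge>N. sqnorm (\<lambda>x. p m x - p n x) / 4 < e"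
  proof (rule midpoint_minimization[where C = "\<lambda>n. P" and q = "\<lambda>a. sqnorm (\<lambda>x. f x - a x)"
        and mid = "\<lambda>a b x. (1/2) * (a x + b x)" and D = "\<lambda>a b. sqnorm (\<lambda>x. a x - b x) / 4"])
    show "\<exists>a\<in>P. sqnorm (\<lambda>x. f x - a x) \<le> sqnorm (\<lambda>x. f x - a0 x)"
      using a0 by auto
    fix a b assume ab: "a \<in> P" "b \<in> P"
    show "(\<lambda>x. (1/2) * (a x + b x)) \<in> P" by (intro P ab)
    have "(\<lambda>x. f x - (1/2) * (a x + b x)) = (\<lambda>x. (1/2) *\<^sub>R ((f x - a x) + (f x - b x)))"
      by (auto simp: algebra_simps)
    then show "sqnorm (\<lambda>x. f x - (1/2) * (a x + b x)) + sqnorm (\<lambda>x. a x - b x) / 4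
       \<le> (sqnorm (\<lambda>x. f x - a x) + sqnorm (\<lambda>x. f x - b x)) / 2"
      using sqnorm_parallelogram[OF L2_diff[OF f P(1)[OF ab(1)]] L2_diff[OF f P(1)[OF ab(2)]]]
        sqnorm_minus_commute[of a b] by simp
  qed (use P in auto)
  have "\<exists>N. \<forall>m\<ge>N. \<forall>n\<ge>N. sqnorm (\<lambda>x. p m x - p n x) < e" if "e > 0" for e
    using p(3)[of "e/4"] that by simp
  then obtain w where w: "L2 w" "L2_tendsto p w"
    using L2_complete[of p, OF P(1)[OF p(1)]] by blast
  have Lfp: "L2 (\<lambda>x. f x - p n x)" for n by (intro L2_diff f P p)
  have lim: "(\<lambda>n. sqnorm (\<lambda>x. (f x - p n x) - (f x - w x))) \<longlonglongrightarrow> 0"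
    using w(2) by (simp add: sqnorm_minus_commute[of w] )
  have "AE x in lebesgue. f x - w x = 0"
  proof (rule tot)
    show "L2 (\<lambda>x. f x - w x)" by (intro L2_diff f w)
    fix s assume s: "s \<in> P"
    define I where "I = (\<integral>x. (f x - w x) * s x \<partial>lebesgue)"
    define J where "J n = (\<integral>x. (f x - p n x) * s x \<partial>lebesgue)" for n
    have J: "J \<longlonglongrightarrow> I" unfolding I_def J_def
      by (rule L2_limit_mult[OF Lfp L2_diff[OF f w(1)] P(1)[OF s] lim])
    have "0 \<le> - 2 * t * I + t\<^sup>2 * sqnorm s" for t
    proof (rule tendsto_lowerbound)
      show "(\<lambda>n. - 2 * t * J n + t\<^sup>2 * sqnorm s + inverse (real (Suc n))) \<longlonglongrightarrow> - 2 * t * I + t\<^sup>2 * sqnorm s"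
        using tendsto_add[OF tendsto_add[OF tendsto_mult_left[OF J, of "-2*t"] tendsto_const[of "t\<^sup>2 * sqnorm s"]]
           LIMSEQ_inverse_real_of_nat] by simp
      show "\<forall>\<^sub>F n in sequentially. 0 \<le> - 2 * t * J n + t\<^sup>2 * sqnorm s + inverse (real (Suc n))"
      proof (rule always_eventually, rule allI)
        fix n
        have "(\<lambda>x. p n x + t * s x) \<in> P" by (intro P p s)
        then have "sqnorm (\<lambda>x. f x - p n x) \<le> sqnorm (\<lambda>x. f x - (p n x + t * s x)) + 1 / Suc n" by (rule p(2))
        also have "(\<lambda>x. f x - (p n x + t * s x)) = (\<lambda>x. (f x - p n x) - t * s x)" by auto
        also have "sqnorm \<dots> = sqnorm (\<lambda>x. f x - p n x) - 2 * t * J n + t\<^sup>2 * sqnorm s"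
          unfolding J_def by (rule sqnorm_diff_expand[OF Lfp P(1)[OF s]])
        finally show "0 \<le> - 2 * t * J n + t\<^sup>2 * sqnorm s + inverse (real (Suc n))"
          by (simp add: inverse_eq_divide)
      qed
    qed simp
    \<comment> \<open>The quadratic is least at \<open>I / sqnorm s\<close>; the summand \<open>1\<close> covers the case \<open>sqnorm s = 0\<close>.\<close>
    from this[of "I / (sqnorm s + 1)"] have "0 \<le> - 2 * I\<^sup>2 / (sqnorm s + 1) + I\<^sup>2 * sqnorm s / (sqnorm s + 1)\<^sup>2"
      by (simp add: power2_eq_square)
    moreover have S: "0 < sqnorm s + 1" by (rule add_nonneg_pos) auto
    moreover have "I\<^sup>2 * sqnorm s / (sqnorm s + 1)\<^sup>2 \<le> I\<^sup>2 / (sqnorm s + 1)"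
    proof -
      have "sqnorm s / (sqnorm s + 1) \<le> 1" using S by (simp add: divide_le_eq)
      then have "I\<^sup>2 / (sqnorm s + 1) * (sqnorm s / (sqnorm s + 1)) \<le> I\<^sup>2 / (sqnorm s + 1)"
        using S by (intro mult_left_le divide_nonneg_nonneg) auto
      then show ?thesis by (simp add: power2_eq_square)
    qed
    ultimately have "I\<^sup>2 / (sqnorm s + 1) \<le> 0" by simp
    then have "I = 0" using S by (simp add: divide_le_0_iff)
    then show "(\<integral>x. (f x - w x) * s x \<partial>lebesgue) = 0" unfolding I_def .
  qed
  then have fw: "AE x in lebesgue. w x = f x" by eventually_elim simp
  have "sqnorm (\<lambda>x. p n x - f x) = sqnorm (\<lambda>x. p n x - w x)" for n
    by (rule sqnorm_cong_AE) (use fw L2_measurable[OF f] L2_measurable[OF w(1)] L2_measurable[OF P(1)[OF p(1)]] in auto)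
  with w(2) have "L2_tendsto p f" by simp
  with p(1) show thesis by (rule that)
qed

lemma test_functions_dense:
  fixes f :: "'a::euclidean_space \<Rightarrow> real"
  assumes "L2 f"
  obtains \<phi> where "\<And>n. test_function (\<phi> n)" "(\<lambda>n. sqnorm (\<lambda>x. \<phi> n x - f x)) \<longlonglongrightarrow> 0"
proof -
  obtain p where "\<And>n. p n \<in> Collect test_function" "L2_tendsto p f"
  proof (rule L2_dense_if_total[of "Collect test_function" f])
    show "Collect (test_function :: ('a \<Rightarrow> real) \<Rightarrow> bool) \<noteq> {}" using test_function_bump by blast
  qed (use assms in \<open>auto intro: test_function_L2 test_function_add test_function_cmult L2_zero_if_orthogonal_to_test_functions\<close>)
  then show thesis using that by auto
qed

text \<open>Test the bound with functions that approximate \<open>f\<close> itself.\<close>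

lemma L2_norm_by_test_functions:
  fixes f :: "'a::euclidean_space \<Rightarrow> real"
  assumes f: "L2 f" and b: "\<And>\<phi>. test_function \<phi> \<Longrightarrow> (pairing f \<phi>) \<le> M * sqrt (sqnorm \<phi>)" and "0 \<le> M"
  shows "sqnorm f \<le> M\<^sup>2"
proof -
  obtain \<phi> where p: "\<And>n. test_function (\<phi> n)" "(\<lambda>n. sqnorm (\<lambda>x. \<phi> n x - f x)) \<longlonglongrightarrow> 0"
    using test_functions_dense[OF f] by blast
  define s where "s n = sqrt (sqnorm (\<lambda>x. \<phi> n x - f x))" for n
  have s0: "s \<longlonglongrightarrow> 0" using tendsto_real_sqrt[OF p(2)] unfolding s_def[abs_def] by simp
  have Lp: "L2 (\<phi> n)" for n using p(1) test_function_L2 by blast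
  have le: "sqnorm f \<le> M * sqrt (sqnorm (\<phi> n)) + sqrt (sqnorm f) * s n" for n
  proof -
    have "sqnorm f = pairing f (\<phi> n) - (\<integral>x. f x * (\<phi> n x - f x) \<partial>lebesgue)"
      using L2_mult_integrable[OF f Lp[of n]] L2_mult_integrable[OF f f]
      by (simp add: sqnorm_real power2_eq_square right_diff_distrib)
    moreover have "- (\<integral>x. f x * (\<phi> n x - f x) \<partial>lebesgue) \<le> sqrt (sqnorm f) * s n"
      using L2_Cauchy_Schwarz[OF f L2_diff[OF Lp[of n] f]] unfolding s_def by simp
    ultimately show ?thesis using b[OF p(1)[of n]] by linarith
  qed
  have conv: "(\<lambda>n. sqnorm (\<phi> n)) \<longlonglongrightarrow> sqnorm f"
  proof -
    have e: "sqnorm (\<phi> n) = (s n)\<^sup>2 + 2 * pairing (\<phi> n) f - sqnorm f" for n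
    proof -
      have "(s n)\<^sup>2 = sqnorm (\<lambda>x. \<phi> n x - f x)" by (simp add: s_def)
      then show ?thesis using sqnorm_diff_expand[OF Lp f, of n 1] by simp
    qed
    have "(\<lambda>n. (s n)\<^sup>2 + 2 * pairing (\<phi> n) f - sqnorm f) \<longlonglongrightarrow> 0\<^sup>2 + 2 * pairing f f - sqnorm f"
      by (intro tendsto_intros s0 L2_limit_mult[OF Lp f f p(2)])
    then show ?thesis unfolding e by (simp add: sqnorm_real power2_eq_square)
  qed
  have "sqnorm f \<le> M * sqrt (sqnorm f) + sqrt (sqnorm f) * 0"
  proof (rule tendsto_lowerbound)
    show "(\<lambda>n. M * sqrt (sqnorm (\<phi> n)) + sqrt (sqnorm f) * s n) \<longlonglongrightarrow> M * sqrt (sqnorm f) + sqrt (sqnorm f) * 0"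
      by (intro tendsto_intros conv s0)
  qed (auto simp: le intro!: always_eventually)
  then have "sqrt (sqnorm f) * sqrt (sqnorm f) \<le> M * sqrt (sqnorm f)" by simp
  then have "sqrt (sqnorm f) \<le> M"
    using \<open>0 \<le> M\<close> sqnorm_nonneg[of f] by (smt (verit) mult_right_le_imp_le real_sqrt_ge_zero)
  then show ?thesis using sqrt_le_D by blast
qed

section \<open>Translations\<close>

text \<open>Translation is the affine map with all scale factors equal to \<open>1\<close>.\<close>

lemma lebesgue_distr_shift:
  shows "(\<lambda>x. x + a) \<in> lebesgue \<rightarrow>\<^sub>M lebesgue" "distr lebesgue lebesgue (\<lambda>x. x + a) = (lebesgue :: 'a::euclidean_space measure)"
proof -
  have T: "(\<lambda>x. a + (\<Sum>j\<in>Basis. (1 * (x \<bullet> j)) *\<^sub>R j)) = (\<lambda>x::'a. x + a)"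
    by (auto simp: euclidean_representation add.commute)
  show "(\<lambda>x. x + a) \<in> lebesgue \<rightarrow>\<^sub>M lebesgue"
    using lebesgue_affine_measurable[of "\<lambda>_. 1" a] unfolding T by simp
  show "distr lebesgue lebesgue (\<lambda>x. x + a) = (lebesgue :: 'a measure)"
    using lebesgue_affine_euclidean[of "\<lambda>_. 1" a] unfolding T by (simp add: density_1)
qed

lemma measurable_shift:
  "f \<in> borel_measurable lebesgue \<Longrightarrow> (\<lambda>x. f (x + a)) \<in> borel_measurable lebesgue"
  using measurable_compose[OF lebesgue_distr_shift(1)] .

lemma integral_shift:
  fixes f :: "'a::euclidean_space \<Rightarrow> 'b::{second_countable_topology,banach}"
  assumes "f \<in> borel_measurable lebesgue"
  shows "(\<integral>x. f (x + a) \<partial>lebesgue) = (\<integral>x. f x \<partial>lebesgue)"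
  using integral_distr[OF lebesgue_distr_shift(1)[of a] assms] by (simp add: lebesgue_distr_shift(2))

lemma integrable_shift:
  fixes f :: "'a::euclidean_space \<Rightarrow> 'b::{second_countable_topology,banach}"
  assumes "integrable lebesgue f"
  shows "integrable lebesgue (\<lambda>x. f (x + a))"
  using integrable_distr_eq[OF lebesgue_distr_shift(1)[of a], of f] assms
  by (simp add: lebesgue_distr_shift(2) borel_measurable_integrable)

lemma AE_shift:
  assumes "AE x in lebesgue. P x"
  shows "AE x in lebesgue. P (x + (a::'a::euclidean_space))"
proof -
  obtain N where N: "\<And>x. x \<in> space lebesgue - N \<Longrightarrow> P x" "N \<in> null_sets lebesgue"
    using AE_E3[OF assms] by blast
  have "AE x in lebesgue. x \<notin> N" using N(2) by (rule AE_not_in)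
  then have "AE x in distr lebesgue lebesgue (\<lambda>x. x + a). x \<notin> N"
    unfolding lebesgue_distr_shift(2) .
  then have "AE x in lebesgue. x + a \<notin> N"
  proof (subst (asm) AE_distr_iff[OF lebesgue_distr_shift(1)])
    have "{x \<in> space lebesgue. x \<notin> N} = space lebesgue - N" by auto
    also have "\<dots> \<in> sets lebesgue" using N(2) by (intro sets.compl_sets) auto
    finally show "{x \<in> space lebesgue. x \<notin> N} \<in> sets lebesgue" .
  qed
  then show ?thesis by eventually_elim (use N(1) in auto)
qed

lemma L2_shift: "L2 f \<Longrightarrow> L2 (\<lambda>x. f (x + a))"
  unfolding L2_iff using measurable_shift[of f a] integrable_shift[of "\<lambda>x. (norm (f x))\<^sup>2" a] by blast

lemma sqnorm_shift: "L2 f \<Longrightarrow> sqnorm (\<lambda>x. f (x + a)) = sqnorm f"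
  unfolding sqnorm_def by (intro integral_shift[of "\<lambda>x. (norm (f x))\<^sup>2" a]) (auto dest: L2_measurable)

section \<open>Weak gradients\<close>

lemma gradient_L2: "has_H1_gradient u g \<Longrightarrow> L2 u" "has_H1_gradient u g \<Longrightarrow> L2 g"
  by (auto simp: has_H1_gradient_def)

lemma gradient_direction:
  assumes "has_H1_gradient u g" "test_function \<phi>"
  shows "pairing u (dir_deriv \<phi> e) = - pairing (\<lambda>x. g x \<bullet> e) \<phi>"
proof -
  note L = gradient_L2[OF assms(1)]
  have "pairing u (dir_deriv \<phi> e)
     = (\<integral>x. (\<Sum>i\<in>Basis. (e \<bullet> i) * (u x * dir_deriv \<phi> i x)) \<partial>lebesgue)"
    by (subst test_function_deriv_expand[OF assms(2), of _ e]) (simp add: sum_distrib_left mult_ac)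
  also have "\<dots> = (\<Sum>i\<in>Basis. (e \<bullet> i) * pairing u (dir_deriv \<phi> i))"
    by (subst Bochner_Integration.integral_sum)
       (auto intro!: L2_mult_integrable L test_function_deriv_L2 assms)
  also have "\<dots> = (\<Sum>i\<in>Basis. (e \<bullet> i) * - pairing (\<lambda>x. g x \<bullet> i) \<phi>)"
    using assms by (intro sum.cong) (auto simp: has_H1_gradient_def)
  also have "\<dots> = - (\<Sum>i\<in>Basis. (\<integral>x. (e \<bullet> i) * ((g x \<bullet> i) * \<phi> x) \<partial>lebesgue))"
    by (simp add: sum_negf)
  also have "\<dots> = - (\<integral>x. (\<Sum>i\<in>Basis. (e \<bullet> i) * ((g x \<bullet> i) * \<phi> x)) \<partial>lebesgue)"
    by (subst Bochner_Integration.integral_sum)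
       (auto intro!: L2_mult_integrable L2_component[OF L(2)] test_function_L2[OF assms(2)])
  also have "(\<lambda>x. (\<Sum>i\<in>Basis. (e \<bullet> i) * ((g x \<bullet> i) * \<phi> x))) = (\<lambda>x. (g x \<bullet> e) * \<phi> x)"
  proof
    fix x show "(\<Sum>i\<in>Basis. (e \<bullet> i) * ((g x \<bullet> i) * \<phi> x)) = (g x \<bullet> e) * \<phi> x"
      unfolding euclidean_inner[of "g x" e] by (simp add: sum_distrib_left mult_ac)
  qed
  finally show ?thesis .
qed

lemma gradient_add:
  assumes "has_H1_gradient u g" "has_H1_gradient v h"
  shows "has_H1_gradient (\<lambda>x. u x + v x) (\<lambda>x. g x + h x)"
  unfolding has_H1_gradient_def
proof (intro conjI allI impI ballI)
  note L = gradient_L2[OF assms(1)] gradient_L2[OF assms(2)]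
  show "L2 (\<lambda>x. u x + v x)" "L2 (\<lambda>x. g x + h x)" by (intro L2_add L)+
  fix \<phi> :: "'a \<Rightarrow> real" and i :: 'a assume p: "test_function \<phi>" "i \<in> Basis"
  note I = L2_mult_integrable[OF L(1) test_function_deriv_L2[OF p(1), of i]] L2_mult_integrable[OF L(3) test_function_deriv_L2[OF p(1), of i]]
     L2_mult_integrable[OF L2_component[OF L(2), of i] test_function_L2[OF p(1)]] L2_mult_integrable[OF L2_component[OF L(4), of i] test_function_L2[OF p(1)]]
  show "(\<integral>x. (u x + v x) * dir_deriv \<phi> i x \<partial>lebesgue) = - (\<integral>x. ((g x + h x) \<bullet> i) * \<phi> x \<partial>lebesgue)"
    using gradient_direction[OF assms(1) p(1), of i] gradient_direction[OF assms(2) p(1), of i] I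
    by (simp add: inner_add_left distrib_right)
qed

lemma gradient_cmult:
  assumes "has_H1_gradient u g"
  shows "has_H1_gradient (\<lambda>x. c * u x) (\<lambda>x. c *\<^sub>R g x)"
  unfolding has_H1_gradient_def
proof (intro conjI allI impI ballI)
  note L = gradient_L2[OF assms(1)]
  show "L2 (\<lambda>x. c * u x)" "L2 (\<lambda>x. c *\<^sub>R g x)" by (intro L2_cmult L2_scale L)+
  fix \<phi> :: "'a \<Rightarrow> real" and i :: 'a assume p: "test_function \<phi>" "i \<in> Basis"
  show "(\<integral>x. (c * u x) * dir_deriv \<phi> i x \<partial>lebesgue) = - (\<integral>x. ((c *\<^sub>R g x) \<bullet> i) * \<phi> x \<partial>lebesgue)"
    using gradient_direction[OF assms(1) p(1), of i] by (simp add: mult.assoc)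
qed

lemma gradient_diff:
  assumes "has_H1_gradient u g" "has_H1_gradient v h"
  shows "has_H1_gradient (\<lambda>x. u x - v x) (\<lambda>x. g x - h x)"
  using gradient_add[OF assms(1) gradient_cmult[OF assms(2), of "-1"]] by simp

lemma gradient_unique:
  assumes "has_H1_gradient u g" "has_H1_gradient u h"
  shows "AE x in lebesgue. g x = h x"
proof -
  note L = gradient_L2[OF assms(1)] gradient_L2[OF assms(2)]
  have "AE x in lebesgue. (g x - h x) \<bullet> i = 0" for i
  proof (rule L2_zero_if_orthogonal_to_test_functions)
    show "L2 (\<lambda>x. (g x - h x) \<bullet> i)" by (intro L2_component L2_diff L)
    fix \<phi> :: "'a \<Rightarrow> real" assume p: "test_function \<phi>"
    note I = L2_mult_integrable[OF L2_component[OF L(2), of i] test_function_L2[OF p(1)]] L2_mult_integrable[OF L2_component[OF L(4), of i] test_function_L2[OF p(1)]]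
    show "(\<integral>x. ((g x - h x) \<bullet> i) * \<phi> x \<partial>lebesgue) = 0"
      using gradient_direction[OF assms(1) p(1), of i] gradient_direction[OF assms(2) p(1), of i] I
      by (simp add: inner_diff_left left_diff_distrib)
  qed
  then have "AE x in lebesgue. \<forall>i\<in>Basis. (g x - h x) \<bullet> i = 0"
    by (intro AE_finite_allI) auto
  then show ?thesis
    by eventually_elim (metis euclidean_all_zero_iff right_minus_eq)
qed

lemma gradient_cong_AE:
  assumes "has_H1_gradient u g" "AE x in lebesgue. u x = v x" "v \<in> borel_measurable lebesgue"
  shows "has_H1_gradient v g"
  unfolding has_H1_gradient_def
proof (intro conjI allI impI ballI)
  note L = gradient_L2[OF assms(1)]
  show "L2 g" by (rule L)
  show "L2 v" by (rule L2_cong_AE[OF assms(2) L(1) assms(3)])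
  fix \<phi> :: "'a \<Rightarrow> real" and i :: 'a assume p: "test_function \<phi>" "i \<in> Basis"
  have "pairing v (dir_deriv \<phi> i) = pairing u (dir_deriv \<phi> i)"
    using assms(2,3) L2_measurable[OF L(1)] L2_measurable[OF test_function_deriv_L2[OF p(1), of i]]
    by (intro integral_cong_AE) auto
  then show "pairing v (dir_deriv \<phi> i) = - pairing (\<lambda>x. g x \<bullet> i) \<phi>"
    using gradient_direction[OF assms(1) p(1), of i] by simp
qed

lemma gradient_grad: "u \<in> H1 \<Longrightarrow> has_H1_gradient u (grad u)"
  unfolding H1_def grad_def mem_Collect_eq by (rule someI_ex[of "has_H1_gradient u"])

lemma H1I: "has_H1_gradient u g \<Longrightarrow> u \<in> H1"
  by (auto simp: H1_def)

lemma sqnorm_grad: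
  assumes "has_H1_gradient u g" shows "sqnorm (grad u) = sqnorm g"
proof -
  note g = gradient_grad[OF H1I[OF assms]]
  show ?thesis
    by (rule sqnorm_cong_AE[OF gradient_unique[OF g assms]])
       (intro L2_measurable gradient_L2(2)[OF g] gradient_L2(2)[OF assms])+
qed

lemma H1_L2: "u \<in> H1 \<Longrightarrow> L2 u"
  using gradient_L2 gradient_grad by blast

lemma H1_cong_AE: "u \<in> H1 \<Longrightarrow> AE x in lebesgue. u x = v x \<Longrightarrow> v \<in> borel_measurable lebesgue \<Longrightarrow> v \<in> H1"
  using gradient_cong_AE gradient_grad H1I by metis

lemma H1_diff: "u \<in> H1 \<Longrightarrow> v \<in> H1 \<Longrightarrow> (\<lambda>x. u x - v x) \<in> H1"
  using gradient_diff gradient_grad H1I by metis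

lemma H1_add: "u \<in> H1 \<Longrightarrow> v \<in> H1 \<Longrightarrow> (\<lambda>x. u x + v x) \<in> H1"
  using gradient_add gradient_grad H1I by metis

lemma H1_cmult: "u \<in> H1 \<Longrightarrow> (\<lambda>x. c * u x) \<in> H1"
  using gradient_cmult gradient_grad H1I by metis

section \<open>Difference quotients\<close>

lemma test_function_line_deriv:
  assumes "test_function \<phi>"
  shows "((\<lambda>s. \<phi> (x + s *\<^sub>R e)) has_real_derivative frechet_derivative \<phi> (at (x + s *\<^sub>R e)) e) (at s)"
proof -
  have l: "((\<lambda>s. x + s *\<^sub>R e) has_derivative (\<lambda>h. h *\<^sub>R e)) (at s)"
    by (auto intro!: derivative_eq_intros)
  have "((\<lambda>s. \<phi> (x + s *\<^sub>R e)) has_derivative (\<lambda>h. frechet_derivative \<phi> (at (x + s *\<^sub>R e)) (h *\<^sub>R e))) (at s)"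
    using has_derivative_compose[OF l test_function_deriv[OF assms]] .
  moreover have "frechet_derivative \<phi> (at (x + s *\<^sub>R e)) (h *\<^sub>R e) = frechet_derivative \<phi> (at (x + s *\<^sub>R e)) e * h" for h
    using linear_scale[OF has_derivative_linear[OF test_function_deriv[OF assms]]] by simp
  ultimately show ?thesis by (simp add: has_field_derivative_def)
qed

text \<open>Dominated convergence: by the mean value theorem the difference quotients of a test function are
  bounded by a constant multiple of the indicator of a fixed ball.\<close>

lemma test_function_quotient_limit:
  fixes u :: "'a::euclidean_space \<Rightarrow> real"
  assumes p: "test_function \<phi>" and u: "L2 u" and t: "t \<longlonglongrightarrow> 0" "\<And>n. t n \<noteq> (0::real)"
  shows "(\<lambda>n. \<integral>x. u x * ((\<phi> (x + t n *\<^sub>R e) - \<phi> x) / t n) \<partial>lebesgue)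
     \<longlonglongrightarrow> pairing u (dir_deriv \<phi> e)"
proof -
  obtain R where R: "\<And>x. norm x > R \<Longrightarrow> \<phi> x = 0" using test_function_support[OF p] by blast
  have z: "dir_deriv \<phi> e x = 0" if "norm x > R" for x
    using test_function_deriv_zero[OF R that] by simp
  obtain B where B: "B > 0" "\<And>x. \<bar>dir_deriv \<phi> e x\<bar> \<le> B"
    using continuous_bounded_support[OF test_function_deriv_continuous[OF p] z] by blast
  obtain K where K: "K > 0" "\<And>n. \<bar>t n\<bar> \<le> K"
    using convergent_imp_Bseq[OF convergentI[OF t(1)]] by (auto simp: Bseq_def)
  \<comment> \<open>A ball of this radius contains the supports of all the translates of \<open>\<phi>\<close>.\<close>
  define S where "S = R + K * norm e"
  have b: "\<bar>(\<phi> (x + t n *\<^sub>R e) - \<phi> x) / t n\<bar> \<le> B * indicator (cball 0 S) x" for x n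
  proof (cases "x \<in> cball 0 S")
    case True
    have "norm (\<phi> (x + t n *\<^sub>R e) - \<phi> (x + 0 *\<^sub>R e)) \<le> B * norm (t n - 0)"
      by (rule field_differentiable_bound[where S = UNIV and f' = "\<lambda>s. frechet_derivative \<phi> (at (x + s *\<^sub>R e)) e"])
         (auto intro: test_function_line_deriv[OF p] B)
    then show ?thesis using True t(2)[of n] by (simp add: field_simps)
  next
    case False
    then have "norm x > S" by simp
    have "norm (t n *\<^sub>R e) \<le> K * norm e" using K(2)[of n] by (simp add: mult_right_mono)
    then have "norm (x + t n *\<^sub>R e) > R" "norm x > R"
      using \<open>norm x > S\<close> norm_triangle_ineq2[of x "- (t n *\<^sub>R e)"] K(1) norm_ge_zero[of e] unfolding S_def
      by (simp_all, smt (verit) mult_nonneg_nonneg)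
    then show ?thesis using False R by simp
  qed
  have m: "(\<lambda>x. (\<phi> (x + t n *\<^sub>R e) - \<phi> x) / t n) \<in> borel_measurable lebesgue" for n
    using L2_measurable[OF test_function_L2[OF p]] measurable_shift by (intro borel_measurable_divide borel_measurable_diff) auto
  have Li: "L2 (indicator (cball 0 S) :: 'a \<Rightarrow> real)"
    by (rule L2_bounded_support[of _ 1 "cball 0 S"]) (auto split: split_indicator intro!: borel_measurable_indicator sets_completionI_sets)
  show ?thesis
  proof (rule integral_dominated_convergence[where w = "\<lambda>x. B * \<bar>u x * indicator (cball 0 S) x\<bar>"])
    show "integrable lebesgue (\<lambda>x. B * \<bar>u x * indicator (cball 0 S) x\<bar>)"
      by (intro integrable_mult_right integrable_abs L2_mult_integrable u Li)
    show "AE x in lebesgue. (\<lambda>n. u x * ((\<phi> (x + t n *\<^sub>R e) - \<phi> x) / t n)) \<longlonglongrightarrow> u x * dir_deriv \<phi> e x"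
    proof (rule AE_I2, rule tendsto_mult_left)
      fix x
      have "((\<lambda>s. (\<phi> (x + s *\<^sub>R e) - \<phi> (x + 0 *\<^sub>R e)) / (s - 0)) \<longlongrightarrow> frechet_derivative \<phi> (at (x + 0 *\<^sub>R e)) e) (at 0)"
        using test_function_line_deriv[OF p, of x e 0] unfolding has_field_derivative_iff .
      moreover have "filterlim t (at 0) sequentially" using t by (auto simp: filterlim_at)
      ultimately show "(\<lambda>n. (\<phi> (x + t n *\<^sub>R e) - \<phi> x) / t n) \<longlonglongrightarrow> dir_deriv \<phi> e x"
        by (auto dest: filterlim_compose)
    qed
    show "AE x in lebesgue. norm (u x * ((\<phi> (x + t n *\<^sub>R e) - \<phi> x) / t n)) \<le> B * \<bar>u x * indicator (cball 0 S) x\<bar>" for n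
    proof (rule AE_I2)
      fix x show "norm (u x * ((\<phi> (x + t n *\<^sub>R e) - \<phi> x) / t n)) \<le> B * \<bar>u x * indicator (cball 0 S) x\<bar>"
        using mult_left_mono[OF b[of x n], of "\<bar>u x\<bar>"] by (simp add: abs_mult mult_ac)
    qed
  qed (intro borel_measurable_times L2_measurable[OF u] m L2_measurable[OF test_function_deriv_L2[OF p]])+
qed

text \<open>By duality it is enough to bound the pairing of the difference with a test function \<open>\<phi>\<close>. Moving the
  translation to \<open>\<phi>\<close>, this pairing is the increment over \<open>[0, 1]\<close> of \<open>s \<mapsto> \<integral> u \<phi>(\<cdot> - s e)\<close>, whose
  derivative is the pairing of \<open>g \<bullet> e\<close> with a translate of \<open>\<phi>\<close>.\<close>

lemma gradient_bounds_difference: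
  assumes g: "has_H1_gradient u g"
  shows "sqnorm (\<lambda>x. u (x + e) - u x) \<le> sqnorm (\<lambda>x. g x \<bullet> e)"
proof -
  note L = gradient_L2[OF g]
  define M where "M = sqrt (sqnorm (\<lambda>x. g x \<bullet> e))"
  have "sqnorm (\<lambda>x. u (x + e) - u x) \<le> M\<^sup>2"
  proof (rule L2_norm_by_test_functions)
    show "L2 (\<lambda>x. u (x + e) - u x)" by (intro L2_diff L2_shift L)
    show "0 \<le> M" by (simp add: M_def)
    fix \<phi> :: "'a \<Rightarrow> real" assume p: "test_function \<phi>"
    define \<psi> where "\<psi> s x = \<phi> (x + (- s) *\<^sub>R e)" for s x
    have tp: "test_function (\<psi> s)" for s unfolding \<psi>_def by (rule test_function_shift[OF p])
    define \<Phi> where "\<Phi> s = pairing u (\<psi> s)" for s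
    define \<Phi>' where "\<Phi>' s = pairing (\<lambda>x. g x \<bullet> e) (\<psi> s)" for s
    have d: "(\<Phi> has_real_derivative \<Phi>' s) (at s)" for s
      unfolding DERIV_def LIMSEQ_SEQ_conv[symmetric]
    proof (intro allI impI)
      fix t :: "nat \<Rightarrow> real" assume "(\<forall>n. t n \<noteq> 0) \<and> t \<longlonglongrightarrow> 0"
      then have t: "t \<longlonglongrightarrow> 0" "\<And>n. t n \<noteq> 0" by auto
      have eq: "(\<Phi> (s + t n) - \<Phi> s) / t n = (\<integral>x. u x * ((\<psi> s (x + t n *\<^sub>R (- e)) - \<psi> s x) / t n) \<partial>lebesgue)" for n
      proof -
        have e: "\<psi> (s + t n) x = \<psi> s (x + t n *\<^sub>R (- e))" for x
          unfolding \<psi>_def by (simp add: algebra_simps)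
        have "\<Phi> (s + t n) - \<Phi> s = (\<integral>x. u x * (\<psi> (s + t n) x - \<psi> s x) \<partial>lebesgue)"
          unfolding \<Phi>_def using L2_mult_integrable[OF L(1) test_function_L2[OF tp]]
          by (simp add: right_diff_distrib)
        also have "\<dots> / t n = (\<integral>x. u x * (\<psi> (s + t n) x - \<psi> s x) / t n \<partial>lebesgue)"
          by simp
        finally show ?thesis by (simp add: e)
      qed
      moreover have "(\<integral>x. u x * dir_deriv (\<psi> s) (- e) x \<partial>lebesgue) = \<Phi>' s"
        unfolding gradient_direction[OF g tp] \<Phi>'_def by simp
      ultimately show "(\<lambda>n. (\<Phi> (s + t n) - \<Phi> s) / t n) \<longlonglongrightarrow> \<Phi>' s"
        using test_function_quotient_limit[OF tp[of s] L(1) t, of "- e"] unfolding eq by simp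
    qed
    obtain z where z: "\<Phi> 1 - \<Phi> 0 = (1 - 0) * \<Phi>' z"
      using MVT2[of 0 1 \<Phi> \<Phi>'] d by auto
    have "\<Phi> 1 = (\<integral>x. u (x + e) * \<psi> 1 (x + e) \<partial>lebesgue)"
      unfolding \<Phi>_def using L2_measurable[OF L(1)] L2_measurable[OF test_function_L2[OF tp]]
      by (intro integral_shift[symmetric]) auto
    then have "(\<integral>x. (u (x + e) - u x) * \<phi> x \<partial>lebesgue) = \<Phi> 1 - \<Phi> 0"
      using L2_mult_integrable[OF L(1) test_function_L2[OF p]]
        L2_mult_integrable[OF L2_shift[OF L(1), of e] test_function_L2[OF p]]
      by (simp add: left_diff_distrib \<Phi>_def \<psi>_def)
    also have "\<dots> = \<Phi>' z" using z by simp
    also have "\<dots> \<le> sqrt (sqnorm (\<lambda>x. g x \<bullet> e)) * sqrt (sqnorm (\<psi> z))"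
      unfolding \<Phi>'_def using L2_Cauchy_Schwarz[OF L2_component[OF L(2), of e] test_function_L2[OF tp[of z]]] by linarith
    also have "sqnorm (\<psi> z) = sqnorm \<phi>"
      unfolding \<psi>_def by (rule sqnorm_shift[OF test_function_L2[OF p]])
    finally show "(\<integral>x. (u (x + e) - u x) * \<phi> x \<partial>lebesgue) \<le> M * sqrt (sqnorm \<phi>)" unfolding M_def .
  qed
  then show ?thesis by (simp add: M_def)
qed

lemma sqnorm_component_le: "L2 g \<Longrightarrow> sqnorm (\<lambda>x. g x \<bullet> e) \<le> (norm e)\<^sup>2 * sqnorm g"
proof -
  assume g: "L2 g"
  have "sqnorm (\<lambda>x. g x \<bullet> e) \<le> (\<integral>x. (norm e)\<^sup>2 * (norm (g x))\<^sup>2 \<partial>lebesgue)"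
  proof (rule L2_bound(2))
    show "AE x in lebesgue. (norm (g x \<bullet> e))\<^sup>2 \<le> (norm e)\<^sup>2 * (norm (g x))\<^sup>2"
    proof (rule AE_I2)
      fix x
      have "norm (g x \<bullet> e) \<le> norm e * norm (g x)"
        using Cauchy_Schwarz_ineq2[of "g x" e] by (simp add: mult.commute)
      then show "(norm (g x \<bullet> e))\<^sup>2 \<le> (norm e)\<^sup>2 * (norm (g x))\<^sup>2"
        unfolding power_mult_distrib[symmetric] by (intro power_mono) auto
    qed
  qed (use g in \<open>auto simp: L2_iff\<close>)
  then show ?thesis by (simp add: sqnorm_def)
qed

text \<open>The quotients \<open>Q n\<close> are bounded in \<open>L\<^sup>2\<close> and converge to the distributional derivative when tested.
  The set \<open>C n\<close> contains the functions that, on every test function, miss that derivative by no more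
  than the worst of the quotients from index \<open>n\<close> on. Almost-minimizers of the norm converge strongly
  and their limit hits the derivative exactly.\<close>

lemma weak_derivative_of_bounded_quotients:
  fixes u :: "'a::euclidean_space \<Rightarrow> real"
  assumes u: "L2 u" and bd: "\<And>n. sqnorm (\<lambda>x. u (x + inverse (real (Suc n)) *\<^sub>R b) - u x) \<le> (inverse (real (Suc n)))\<^sup>2 * M"
  obtains d where "L2 d" "sqnorm d \<le> M"
    "\<And>\<phi>. test_function \<phi> \<Longrightarrow> (pairing u (dir_deriv \<phi> b)) = - pairing d \<phi>"
proof -
  define h where "h n = inverse (real (Suc n))" for n
  have h: "h n > 0" "h n \<noteq> 0" for n by (simp_all add: h_def)
  define Q where "Q n x = inverse (h n) * (u (x + h n *\<^sub>R b) - u x)" for n x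
  have LQ: "L2 (Q n)" for n unfolding Q_def by (intro L2_cmult L2_diff L2_shift u)
  have QM: "sqnorm (Q n) \<le> M" for n
  proof -
    have "sqnorm (Q n) = (inverse (h n))\<^sup>2 * sqnorm (\<lambda>x. u (x + h n *\<^sub>R b) - u x)"
      unfolding Q_def by (rule sqnorm_rmult)
    also have "\<dots> \<le> (inverse (h n))\<^sup>2 * ((h n)\<^sup>2 * M)"
      using bd[of n] unfolding h_def by (intro mult_left_mono) auto
    also have "\<dots> = M" using h(2)[of n] by (simp add: power_inverse)
    finally show ?thesis .
  qed
  define A where "A \<phi> = pairing u (dir_deriv \<phi> b)" for \<phi> :: "'a \<Rightarrow> real"
  have limQ: "(\<lambda>n. pairing (Q n) \<phi>) \<longlonglongrightarrow> - A \<phi>" if p: "test_function \<phi>" for \<phi>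
  proof -
    have "pairing (Q n) \<phi> = (\<integral>x. u x * ((\<phi> (x + h n *\<^sub>R (- b)) - \<phi> x) / h n) \<partial>lebesgue)" for n
    proof -
      have "(\<integral>x. u (x + h n *\<^sub>R b) * \<phi> x \<partial>lebesgue) = (\<integral>x. u (x + h n *\<^sub>R b) * \<phi> (x + h n *\<^sub>R b + h n *\<^sub>R (- b)) \<partial>lebesgue)"
        by simp
      also have "\<dots> = (\<integral>x. u x * \<phi> (x + h n *\<^sub>R (- b)) \<partial>lebesgue)"
        by (rule integral_shift[of "\<lambda>x. u x * \<phi> (x + h n *\<^sub>R (- b))"])
           (intro borel_measurable_times L2_measurable[OF u] L2_measurable[OF test_function_L2[OF test_function_shift[OF p]]])
      finally have e: "(\<integral>x. u (x + h n *\<^sub>R b) * \<phi> x \<partial>lebesgue) = (\<integral>x. u x * \<phi> (x + h n *\<^sub>R (- b)) \<partial>lebesgue)" .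
      have "pairing (Q n) \<phi> = (\<integral>x. inverse (h n) * (u (x + h n *\<^sub>R b) * \<phi> x - u x * \<phi> x) \<partial>lebesgue)"
        unfolding Q_def by (simp add: algebra_simps)
      also have "\<dots> = inverse (h n) * ((\<integral>x. u (x + h n *\<^sub>R b) * \<phi> x \<partial>lebesgue) - pairing u \<phi>)"
        using L2_mult_integrable[OF u test_function_L2[OF p]]
          L2_mult_integrable[OF L2_shift[OF u, of "h n *\<^sub>R b"] test_function_L2[OF p]] by simp
      also have "\<dots> = inverse (h n) * (\<integral>x. u x * (\<phi> (x + h n *\<^sub>R (- b)) - \<phi> x) \<partial>lebesgue)"
        unfolding e using L2_mult_integrable[OF u test_function_L2[OF p]]
          L2_mult_integrable[OF u test_function_L2[OF test_function_shift[OF p, of "h n *\<^sub>R (- b)"]]]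
        by (simp add: right_diff_distrib)
      also have "\<dots> = (\<integral>x. inverse (h n) * (u x * (\<phi> (x + h n *\<^sub>R (- b)) - \<phi> x)) \<partial>lebesgue)" by simp
      finally show ?thesis by (simp add: divide_inverse mult_ac)
    qed
    moreover have "(\<lambda>n. \<integral>x. u x * ((\<phi> (x + h n *\<^sub>R (- b)) - \<phi> x) / h n) \<partial>lebesgue)
       \<longlonglongrightarrow> (\<integral>x. u x * dir_deriv \<phi> (- b) x \<partial>lebesgue)"
      by (rule test_function_quotient_limit[OF p u]) (use h LIMSEQ_inverse_real_of_nat in \<open>auto simp: h_def[abs_def]\<close>)
    moreover have "dir_deriv \<phi> (- b) x = - dir_deriv \<phi> b x" for x
      using linear_neg[OF has_derivative_linear[OF test_function_deriv[OF p]]] .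
    ultimately show ?thesis by (simp add: A_def)
  qed
  define C where "C n = {w. L2 w \<and> (\<forall>\<phi> c. test_function \<phi> \<longrightarrow>
      (\<forall>k\<ge>n. \<bar>pairing (Q k) \<phi> + A \<phi>\<bar> \<le> c) \<longrightarrow> \<bar>pairing w \<phi> + A \<phi>\<bar> \<le> c)}" for n
  have QC: "Q n \<in> C n" for n unfolding C_def using LQ by auto
  have CL: "w \<in> C n \<Longrightarrow> L2 w" for w n by (simp add: C_def)
  obtain w where w: "\<And>n. w n \<in> C n" "\<And>n a. a \<in> C n \<Longrightarrow> sqnorm (w n) \<le> sqnorm a + 1 / Suc n"
    "\<And>e. e > 0 \<Longrightarrow> \<exists>N. \<forall>m\<ge>N. \<forall>n\<ge>N. sqnorm (\<lambda>x. w m x - w n x) / 4 < e"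
  proof (rule midpoint_minimization[where C = C and q = sqnorm and M = M
        and mid = "\<lambda>a b x. (1/2) *\<^sub>R (a x + b x)" and D = "\<lambda>a b. sqnorm (\<lambda>x. a x - b x) / 4"])
    show "C (Suc n) \<subseteq> C n" for n unfolding C_def by (auto dest: Suc_leD)
    show "C n \<noteq> {}" for n using QC by auto
    show "\<exists>a\<in>C n. sqnorm a \<le> M" for n using QC QM by blast
    show "sqnorm (\<lambda>x. (1/2) *\<^sub>R (a x + b x)) + sqnorm (\<lambda>x. a x - b x) / 4 \<le> (sqnorm a + sqnorm b) / 2"
      if "a \<in> C 0" "b \<in> C 0" for a b
      using sqnorm_parallelogram[OF CL[OF that(1)] CL[OF that(2)]] by simp
    show "(\<lambda>x. (1/2) *\<^sub>R (v x + w x)) \<in> C n" if vw: "v \<in> C n" "w \<in> C n" for n v w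
      unfolding C_def
    proof (intro CollectI conjI allI impI)
      show "L2 (\<lambda>x. (1/2) *\<^sub>R (v x + w x))" by (intro L2_scale L2_add CL[OF vw(1)] CL[OF vw(2)])
      fix \<phi> c assume p: "test_function \<phi>" and c: "\<forall>k\<ge>n. \<bar>pairing (Q k) \<phi> + A \<phi>\<bar> \<le> c"
      have 1: "\<bar>pairing v \<phi> + A \<phi>\<bar> \<le> c" "\<bar>pairing w \<phi> + A \<phi>\<bar> \<le> c"
        using vw p c unfolding C_def by blast+
      have "(\<integral>x. ((1/2) *\<^sub>R (v x + w x)) * \<phi> x \<partial>lebesgue) = (1/2) * (pairing v \<phi> + pairing w \<phi>)"
        using L2_mult_integrable[OF CL[OF vw(1)] test_function_L2[OF p]] L2_mult_integrable[OF CL[OF vw(2)] test_function_L2[OF p]]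
        by (simp add: distrib_right add_divide_distrib)
      moreover have "\<bar>Z + z\<bar> \<le> c" if "\<bar>X + z\<bar> \<le> c" "\<bar>Y + z\<bar> \<le> c" "Z = (1/2) * (X + Y)" for X Y Z z :: real
        using that by (auto simp: abs_le_iff)
      ultimately show "\<bar>(\<integral>x. ((1/2) *\<^sub>R (v x + w x)) * \<phi> x \<partial>lebesgue) + A \<phi>\<bar> \<le> c" using 1 by blast
    qed
    show "0 \<le> sqnorm a" for a :: "'a \<Rightarrow> real" by simp
  qed (rule that; assumption)
  have Lw: "L2 (w n)" for n using w(1) CL by blast
  have "\<exists>N. \<forall>m\<ge>N. \<forall>n\<ge>N. sqnorm (\<lambda>x. w m x - w n x) < e" if "e > 0" for e
    using w(3)[of "e/4"] that by simp
  then obtain d where d: "L2 d" "L2_tendsto w d"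
    using L2_complete[of w, OF Lw] by blast
  show thesis
  proof (rule that[OF d(1)])
    have "(\<lambda>n. M + inverse (real (Suc n))) \<longlonglongrightarrow> M + 0"
      by (intro tendsto_intros LIMSEQ_inverse_real_of_nat)
    moreover have "sqnorm (w n) \<le> M + inverse (real (Suc n))" for n
      using w(2)[OF QC[of n]] QM[of n] by (simp add: inverse_eq_divide)
    ultimately show "sqnorm d \<le> M"
      using L2_limit_sqnorm[OF Lw d, of "\<lambda>n. M + inverse (real (Suc n))" M] by simp
    fix \<phi> :: "'a \<Rightarrow> real" assume p: "test_function \<phi>"
    have "(\<lambda>n. (pairing (w n) \<phi>)) \<longlonglongrightarrow> - A \<phi>"
    proof (rule LIMSEQ_I)
      fix r :: real assume "r > 0"
      then obtain N where N: "\<And>k. k \<ge> N \<Longrightarrow> \<bar>pairing (Q k) \<phi> + A \<phi>\<bar> < r / 2"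
        using LIMSEQ_D[OF limQ[OF p], of "r/2"] by auto
      have "norm (pairing (w n) \<phi> - - A \<phi>) < r" if "n \<ge> N" for n
      proof -
        have "\<bar>pairing (w n) \<phi> + A \<phi>\<bar> \<le> r / 2"
        proof -
          have "\<forall>k\<ge>n. \<bar>pairing (Q k) \<phi> + A \<phi>\<bar> \<le> r / 2"
            using N that by (meson less_imp_le order_trans)
          then show ?thesis using w(1)[of n] p unfolding C_def by blast
        qed
        then show ?thesis using \<open>r > 0\<close> by simp
      qed
      then show "\<exists>N. \<forall>n\<ge>N. norm (pairing (w n) \<phi> - - A \<phi>) < r" by blast
    qed
    moreover have "(\<lambda>n. (pairing (w n) \<phi>)) \<longlonglongrightarrow> pairing d \<phi>"
      by (rule L2_limit_mult[OF Lw d(1) test_function_L2[OF p] d(2)])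
    ultimately have "pairing d \<phi> = - A \<phi>" using LIMSEQ_unique by blast
    then show "pairing u (dir_deriv \<phi> b) = - pairing d \<phi>"
      by (simp add: A_def)
  qed
qed

lemma norm_sq_components: "(norm (v::'a::euclidean_space))\<^sup>2 = (\<Sum>b\<in>Basis. (v \<bullet> b)\<^sup>2)"
  unfolding power2_norm_eq_inner by (subst euclidean_inner) (simp add: power2_eq_square)

lemma L2_from_components:
  fixes g :: "'a::euclidean_space \<Rightarrow> 'b::euclidean_space"
  assumes "\<And>b. b \<in> Basis \<Longrightarrow> L2 (\<lambda>x. g x \<bullet> b)"
  shows "L2 g" "sqnorm g = (\<Sum>b\<in>Basis. sqnorm (\<lambda>x. g x \<bullet> b))"
proof -
  have i: "integrable lebesgue (\<lambda>x. (g x \<bullet> b)\<^sup>2)" if "b \<in> Basis" for b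
    using L2_integrable[OF assms[OF that]] by simp
  have "(\<lambda>x. \<Sum>b\<in>Basis. (g x \<bullet> b) *\<^sub>R b) \<in> borel_measurable lebesgue"
    using assms by (intro borel_measurable_sum borel_measurable_scaleR) (auto dest: L2_measurable)
  then show "L2 g"
    unfolding L2_iff using i by (simp add: euclidean_representation norm_sq_components)
  show "sqnorm g = (\<Sum>b\<in>Basis. sqnorm (\<lambda>x. g x \<bullet> b))"
    unfolding sqnorm_def norm_sq_components[of "g _"] using i by (simp add: Bochner_Integration.integral_sum)
qed

text \<open>The converse of \<open>gradient_bounds_difference\<close>. As the hypothesis mentions only differences of
  \<open>u\<close>, it is stable under pointwise nonexpansive operations.\<close>

lemma gradient_of_bounded_quotients:
  fixes u :: "'a::euclidean_space \<Rightarrow> real"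
  assumes u: "L2 u" and bd: "\<And>b h. b \<in> Basis \<Longrightarrow> h > 0 \<Longrightarrow> sqnorm (\<lambda>x. u (x + h *\<^sub>R b) - u x) \<le> h\<^sup>2 * M b"
  obtains g where "has_H1_gradient u g" "sqnorm g \<le> (\<Sum>b\<in>Basis. M b)"
proof -
  have "\<exists>d. L2 d \<and> sqnorm d \<le> M b \<and> (\<forall>\<phi>. test_function \<phi> \<longrightarrow> (pairing u (dir_deriv \<phi> b)) = - pairing d \<phi>)"
    if b: "b \<in> Basis" for b
  proof -
    have "sqnorm (\<lambda>x. u (x + inverse (real (Suc n)) *\<^sub>R b) - u x) \<le> (inverse (real (Suc n)))\<^sup>2 * M b" for n
      by (rule bd[OF b]) simp
    from weak_derivative_of_bounded_quotients[OF u this] obtain d where "L2 d" "sqnorm d \<le> M b"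
      "\<And>\<phi>. test_function \<phi> \<Longrightarrow> (pairing u (dir_deriv \<phi> b)) = - pairing d \<phi>" by blast
    then show ?thesis by blast
  qed
  then have "\<forall>b\<in>Basis. \<exists>d. L2 d \<and> sqnorm d \<le> M b \<and> (\<forall>\<phi>. test_function \<phi> \<longrightarrow> (pairing u (dir_deriv \<phi> b)) = - pairing d \<phi>)"
    by blast
  from bchoice[OF this] obtain d where d: "\<And>b. b \<in> Basis \<Longrightarrow> L2 (d b)" "\<And>b. b \<in> Basis \<Longrightarrow> sqnorm (d b) \<le> M b"
     "\<And>b \<phi>. b \<in> Basis \<Longrightarrow> test_function \<phi> \<Longrightarrow> (pairing u (dir_deriv \<phi> b)) = - pairing (d b) \<phi>"
    by blast
  define g where "g x = (\<Sum>b\<in>Basis. d b x *\<^sub>R b)" for x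
  have gb: "g x \<bullet> b = d b x" if "b \<in> Basis" for b x
    unfolding g_def using that by (simp add: inner_sum_left_Basis)
  have Lc: "L2 (\<lambda>x. g x \<bullet> b)" if "b \<in> Basis" for b using d(1)[OF that] gb[OF that] by simp
  show thesis
  proof (rule that)
    show "has_H1_gradient u g"
      unfolding has_H1_gradient_def using u L2_from_components(1)[OF Lc] d(3) by (simp add: gb)
    show "sqnorm g \<le> (\<Sum>b\<in>Basis. M b)"
      using d(2) by (subst L2_from_components(2)[OF Lc]) (auto simp: gb intro!: sum_mono)
  qed
qed

section \<open>Suprema of Sobolev functions\<close>

definition H1_sqnorm :: "('a::euclidean_space \<Rightarrow> real) \<Rightarrow> real" where
  "H1_sqnorm u = sqnorm (grad u) + sqnorm u"

lemma H1_sqnorm_nonneg: "0 \<le> H1_sqnorm u"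
  by (simp add: H1_sqnorm_def add_nonneg_nonneg)

lemma H1_sqnorm_gradient: "has_H1_gradient u g \<Longrightarrow> H1_sqnorm u = sqnorm g + sqnorm u"
  by (simp add: H1_sqnorm_def sqnorm_grad)

lemma H1_sqnorm_cmult: "u \<in> H1 \<Longrightarrow> H1_sqnorm (\<lambda>x. c * u x) = c\<^sup>2 * H1_sqnorm u"
  using H1_sqnorm_gradient[OF gradient_cmult[OF gradient_grad]]
  by (simp add: H1_sqnorm_def sqnorm_cmult sqnorm_rmult distrib_left)

lemma H1_sqnorm_diff_commute:
  assumes "u \<in> H1" "v \<in> H1" shows "H1_sqnorm (\<lambda>x. u x - v x) = H1_sqnorm (\<lambda>x. v x - u x)"
  using H1_sqnorm_cmult[OF H1_diff[OF assms], of "-1"] by simp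

lemma H1_sqnorm_add_le:
  assumes "u \<in> H1" "v \<in> H1"
  shows "H1_sqnorm (\<lambda>x. u x + v x) \<le> 2 * H1_sqnorm u + 2 * H1_sqnorm v"
proof -
  note g = gradient_grad[OF assms(1)] gradient_grad[OF assms(2)]
  have "H1_sqnorm (\<lambda>x. u x + v x) = sqnorm (\<lambda>x. grad u x + grad v x) + sqnorm (\<lambda>x. u x + v x)"
    by (rule H1_sqnorm_gradient[OF gradient_add[OF g]])
  also have "\<dots> \<le> (2 * sqnorm (grad u) + 2 * sqnorm (grad v)) + (2 * sqnorm u + 2 * sqnorm v)"
    using gradient_L2[OF g(1)] gradient_L2[OF g(2)] by (intro add_mono sqnorm_add_le)
  finally show ?thesis by (simp add: H1_sqnorm_def)
qed

lemma H1_sqnorm_diff_triangle: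
  assumes "u \<in> H1" "v \<in> H1" "w \<in> H1"
  shows "H1_sqnorm (\<lambda>x. u x - w x) \<le> 2 * H1_sqnorm (\<lambda>x. u x - v x) + 2 * H1_sqnorm (\<lambda>x. v x - w x)"
  using H1_sqnorm_add_le[OF H1_diff[OF assms(1,2)] H1_diff[OF assms(2,3)]] by simp

lemma nn_H1_sqnorm:
  assumes "u \<in> H1"
  shows "(\<integral>\<^sup>+x. ennreal ((norm (grad u x))\<^sup>2) \<partial>lebesgue) + (\<integral>\<^sup>+x. ennreal ((u x)\<^sup>2) \<partial>lebesgue) = ennreal (H1_sqnorm u)"
  using nn_sqnorm[OF gradient_L2(2)[OF gradient_grad[OF assms]]] nn_sqnorm[OF H1_L2[OF assms]]
  by (simp add: H1_sqnorm_def ennreal_plus)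

lemma ennreal_finiteE: "x \<noteq> \<infinity> \<Longrightarrow> \<exists>t\<ge>0. x = ennreal t"
  by (cases x) auto

lemma ennreal_le_suminf: "f i \<le> (\<Sum>i. f i :: ennreal)"
  using sum_le_suminf[of f "{i}"] by simp

text \<open>Taking suprema is nonexpansive.\<close>

lemma sup_difference_le:
  fixes a b :: "nat \<Rightarrow> real"
  assumes "(SUP i. ennreal \<bar>a i\<bar>) < top" "(SUP i. ennreal \<bar>b i\<bar>) < top"
  shows "ennreal ((enn2real (SUP i. ennreal \<bar>a i\<bar>) - enn2real (SUP i. ennreal \<bar>b i\<bar>))\<^sup>2) \<le> (\<Sum>i. ennreal ((a i - b i)\<^sup>2))"
proof (cases "(\<Sum>i. ennreal ((a i - b i)\<^sup>2))")
  case top then show ?thesis by simp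
next
  case (real t)
  have key: "enn2real (SUP i. ennreal \<bar>a i\<bar>) \<le> enn2real (SUP i. ennreal \<bar>b i\<bar>) + sqrt t"
    if A: "(SUP i. ennreal \<bar>a i\<bar>) < top" "(SUP i. ennreal \<bar>b i\<bar>) < top" 
      and T: "\<And>i. (a i - b i)\<^sup>2 \<le> t" for a b :: "nat \<Rightarrow> real"
  proof -
    define B where "B = enn2real (SUP i. ennreal \<bar>b i\<bar>)"
    have t0: "0 \<le> t" using T[of 0] by (meson order_trans zero_le_power2)
    have SB: "(SUP i. ennreal \<bar>b i\<bar>) = ennreal B" using A(2) by (simp add: B_def)
    have bB: "\<bar>b i\<bar> \<le> B" for i
    proof -
      have "ennreal \<bar>b i\<bar> \<le> ennreal B" unfolding SB[symmetric] by (rule SUP_upper) simp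
      then show ?thesis by (simp add: B_def ennreal_le_iff)
    qed
    have "(SUP i. ennreal \<bar>a i\<bar>) \<le> ennreal (B + sqrt t)"
    proof (intro SUP_least ennreal_leI)
      fix i
      have "\<bar>a i - b i\<bar> \<le> sqrt t" using T[of i] by (simp add: real_le_rsqrt)
      then show "\<bar>a i\<bar> \<le> B + sqrt t" using bB[of i] by linarith
    qed
    moreover have "0 \<le> B + sqrt t" using t0 by (simp add: B_def)
    ultimately show ?thesis unfolding B_def[symmetric] by (metis enn2real_leI)
  qed
  have T: "(a i - b i)\<^sup>2 \<le> t" for i
  proof -
    have "ennreal ((a i - b i)\<^sup>2) \<le> (\<Sum>i. ennreal ((a i - b i)\<^sup>2))"
      by (rule ennreal_le_suminf)
    then show ?thesis unfolding real(2) using real(1) by (simp only: ennreal_le_iff)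
  qed
  have T': "(b i - a i)\<^sup>2 \<le> t" for i using T[of i] by (simp add: power2_commute)
  have "\<bar>enn2real (SUP i. ennreal \<bar>a i\<bar>) - enn2real (SUP i. ennreal \<bar>b i\<bar>)\<bar> \<le> sqrt t"
    using key[OF assms T] key[OF assms(2,1) T'] by linarith
  then have "\<bar>enn2real (SUP i. ennreal \<bar>a i\<bar>) - enn2real (SUP i. ennreal \<bar>b i\<bar>)\<bar>\<^sup>2 \<le> (sqrt t)\<^sup>2"
    by (intro power_mono) auto
  then have "(enn2real (SUP i. ennreal \<bar>a i\<bar>) - enn2real (SUP i. ennreal \<bar>b i\<bar>))\<^sup>2 \<le> t"
    using real(1) by simp
  then show ?thesis unfolding real(2) by (rule ennreal_leI)
qed

lemma suminf_ennreal_le: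
  assumes "\<And>i. f i \<le> ennreal (c i)" "\<And>i. 0 \<le> c i" "summable c"
  shows "(\<Sum>i. f i) \<le> ennreal (\<Sum>i. c i)"
proof -
  have "(\<Sum>i. f i) \<le> (\<Sum>i. ennreal (c i))" by (intro suminf_le assms(1)) auto
  also have "\<dots> = ennreal (\<Sum>i. c i)" by (rule suminf_ennreal2[OF assms(2,3)])
  finally show ?thesis .
qed

text \<open>Differences of the supremum are dominated by the supremum of the differences, a fortiori by their
  square sum, so the difference quotients of the supremum inherit a bound from those of the
  \<open>w i\<close>. This is the source of both positivity (the case of a single function gives
  \<open>\<bar>w\<bar>\<close>) and countable subadditivity.\<close>

lemma H1_supremum:
  fixes w :: "nat \<Rightarrow> 'a::euclidean_space \<Rightarrow> real"
  assumes w: "\<And>i. w i \<in> H1" and c: "\<And>i. H1_sqnorm (w i) \<le> c i" "summable c"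
  obtains s where "s \<in> H1" "AE x in lebesgue. \<forall>i. \<bar>w i x\<bar> \<le> s x" "H1_sqnorm s \<le> (\<Sum>i. c i)"
proof -
  note Lw = H1_L2[OF w] and gw = gradient_grad[OF w]
  note Lg = gradient_L2(2)[OF gw]
  have summ: "summable f" if "\<And>i. 0 \<le> f i" "\<And>i. f i \<le> H1_sqnorm (w i)" for f :: "nat \<Rightarrow> real"
    by (rule summable_comparison_test_ev[OF _ c(2)]) (use that c(1) order_trans in \<open>fastforce intro!: always_eventually\<close>)
  have s1: "summable (\<lambda>i. sqnorm (w i))" and s2: "summable (\<lambda>i. sqnorm (grad (w i)))"
    by (intro summ, auto simp: H1_sqnorm_def)+
  have s3: "summable (\<lambda>i. sqnorm (\<lambda>x. grad (w i) x \<bullet> b))" if "b \<in> Basis" for b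
  proof (rule summ)
    fix i
    have "sqnorm (\<lambda>x. grad (w i) x \<bullet> b) \<le> (norm b)\<^sup>2 * sqnorm (grad (w i))" by (rule sqnorm_component_le[OF Lg])
    then show "sqnorm (\<lambda>x. grad (w i) x \<bullet> b) \<le> H1_sqnorm (w i)"
      using that unfolding H1_sqnorm_def by (simp add: add_increasing2)
  qed simp
  define S where "S x = (SUP i. ennreal \<bar>w i x\<bar>)" for x
  define s where "s x = enn2real (S x)" for x
  have mS: "S \<in> borel_measurable lebesgue"
    unfolding S_def using L2_measurable[OF Lw] by (intro borel_measurable_SUP) auto
  have ms: "s \<in> borel_measurable lebesgue" unfolding s_def using mS by simp
  have S2: "S x < top \<and> ennreal ((s x)\<^sup>2) \<le> (\<Sum>i. ennreal ((w i x)\<^sup>2))" if fin: "(\<Sum>i. ennreal ((w i x)\<^sup>2)) \<noteq> \<infinity>" for x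
  proof -
    obtain t where t: "0 \<le> t" "(\<Sum>i. ennreal ((w i x)\<^sup>2)) = ennreal t" using ennreal_finiteE[OF fin] by blast
    have "(w i x)\<^sup>2 \<le> t" for i
      using ennreal_le_suminf[of "\<lambda>i. ennreal ((w i x)\<^sup>2)" i] t(1) unfolding t(2) by (simp only: ennreal_le_iff)
    then have "\<bar>w i x\<bar> \<le> sqrt t" for i by (simp add: real_le_rsqrt)
    then have "S x \<le> ennreal (sqrt t)" unfolding S_def by (intro SUP_least ennreal_leI)
    then have 1: "S x < top" and "s x \<le> sqrt t"
      unfolding s_def using t(1) le_less_trans[OF _ ennreal_less_top] by (blast, intro enn2real_leI) auto
    then have "(s x)\<^sup>2 \<le> (sqrt t)\<^sup>2" by (intro power_mono) (auto simp: s_def)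
    then show ?thesis using 1 t(1) unfolding t(2) by (simp add: ennreal_leI)
  qed
  have intw: "(\<integral>\<^sup>+x. (\<Sum>i. ennreal ((w i x)\<^sup>2)) \<partial>lebesgue) \<le> ennreal (\<Sum>i. sqnorm (w i))"
  proof -
    have "(\<integral>\<^sup>+x. (\<Sum>i. ennreal ((w i x)\<^sup>2)) \<partial>lebesgue) = (\<Sum>i. \<integral>\<^sup>+x. ennreal ((w i x)\<^sup>2) \<partial>lebesgue)"
      using L2_measurable[OF Lw] by (intro nn_integral_suminf) auto
    also have "\<dots> \<le> ennreal (\<Sum>i. sqnorm (w i))"
      using nn_sqnorm[OF Lw] by (intro suminf_ennreal_le s1) auto
    finally show ?thesis .
  qed
  then have "(\<integral>\<^sup>+x. (\<Sum>i. ennreal ((w i x)\<^sup>2)) \<partial>lebesgue) \<noteq> \<infinity>" by (auto simp: top_unique)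
  then have "AE x in lebesgue. (\<Sum>i. ennreal ((w i x)\<^sup>2)) \<noteq> \<infinity>"
    using L2_measurable[OF Lw] by (intro nn_integral_PInf_AE) auto
  then have fin: "AE x in lebesgue. S x < top \<and> ennreal ((s x)\<^sup>2) \<le> (\<Sum>i. ennreal ((w i x)\<^sup>2))"
    by eventually_elim (rule S2)
  have "(\<integral>\<^sup>+x. ennreal ((norm (s x))\<^sup>2) \<partial>lebesgue) \<le> (\<integral>\<^sup>+x. (\<Sum>i. ennreal ((w i x)\<^sup>2)) \<partial>lebesgue)"
    using fin by (intro nn_integral_mono_AE) auto
  also note intw
  finally have Ls: "L2 s" "sqnorm s \<le> (\<Sum>i. sqnorm (w i))"
    using L2_I_nn[OF ms] suminf_nonneg[OF s1] by auto
  define M where "M b = (\<Sum>i. sqnorm (\<lambda>x. grad (w i) x \<bullet> b))" for b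
  have quot: "sqnorm (\<lambda>x. s (x + h *\<^sub>R b) - s x) \<le> h\<^sup>2 * M b" if b: "b \<in> Basis" for b h
  proof -
    have Ld: "L2 (\<lambda>x. w i (x + h *\<^sub>R b) - w i x)" for i by (intro L2_diff L2_shift Lw)
    have d: "sqnorm (\<lambda>x. w i (x + h *\<^sub>R b) - w i x) \<le> h\<^sup>2 * sqnorm (\<lambda>x. grad (w i) x \<bullet> b)" for i
      using gradient_bounds_difference[OF gw, of i "h *\<^sub>R b"] sqnorm_rmult[of h "\<lambda>x. grad (w i) x \<bullet> b"] by simp
    have "(\<integral>\<^sup>+x. ennreal ((norm (s (x + h *\<^sub>R b) - s x))\<^sup>2) \<partial>lebesgue)
       \<le> (\<integral>\<^sup>+x. (\<Sum>i. ennreal ((w i (x + h *\<^sub>R b) - w i x)\<^sup>2)) \<partial>lebesgue)"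
    proof (rule nn_integral_mono_AE)
      show "AE x in lebesgue. ennreal ((norm (s (x + h *\<^sub>R b) - s x))\<^sup>2) \<le> (\<Sum>i. ennreal ((w i (x + h *\<^sub>R b) - w i x)\<^sup>2))"
        using fin AE_shift[OF fin, of "h *\<^sub>R b"]
      proof eventually_elim
        case (elim x)
        then show ?case
          using sup_difference_le[of "\<lambda>i. w i (x + h *\<^sub>R b)" "\<lambda>i. w i x"]
          unfolding s_def S_def real_norm_def power2_abs by blast
      qed
    qed
    also have "\<dots> = (\<Sum>i. \<integral>\<^sup>+x. ennreal ((w i (x + h *\<^sub>R b) - w i x)\<^sup>2) \<partial>lebesgue)"
      using L2_measurable[OF Ld] by (intro nn_integral_suminf) auto
    also have "\<dots> \<le> ennreal (\<Sum>i. h\<^sup>2 * sqnorm (\<lambda>x. grad (w i) x \<bullet> b))"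
    proof (rule suminf_ennreal_le)
      show "(\<integral>\<^sup>+x. ennreal ((w i (x + h *\<^sub>R b) - w i x)\<^sup>2) \<partial>lebesgue) \<le> ennreal (h\<^sup>2 * sqnorm (\<lambda>x. grad (w i) x \<bullet> b))" for i
        using nn_sqnorm[OF Ld[of i]] d[of i] by (simp add: ennreal_leI)
    qed (auto intro!: summable_mult s3 b)
    also have "(\<Sum>i. h\<^sup>2 * sqnorm (\<lambda>x. grad (w i) x \<bullet> b)) = h\<^sup>2 * M b"
      unfolding M_def by (rule suminf_mult[OF s3[OF b]])
    finally show ?thesis
    proof (rule L2_I_nn(2)[rotated])
      show "(\<lambda>x. s (x + h *\<^sub>R b) - s x) \<in> borel_measurable lebesgue"
        by (intro borel_measurable_diff measurable_shift ms)
      show "0 \<le> h\<^sup>2 * M b" unfolding M_def by (intro mult_nonneg_nonneg suminf_nonneg s3[OF b]) auto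
    qed
  qed
  obtain g where g: "has_H1_gradient s g" "sqnorm g \<le> (\<Sum>b\<in>Basis. M b)"
    using gradient_of_bounded_quotients[OF Ls(1) quot] by metis
  have Mg: "(\<Sum>b\<in>Basis. M b) = (\<Sum>i. sqnorm (grad (w i)))"
  proof -
    have "(\<Sum>b\<in>Basis. M b) = (\<Sum>i. \<Sum>b\<in>Basis. sqnorm (\<lambda>x. grad (w i) x \<bullet> b))"
      unfolding M_def by (rule suminf_sum[OF s3, symmetric])
    also have "\<dots> = (\<Sum>i. sqnorm (grad (w i)))"
      by (intro suminf_cong L2_from_components(2)[symmetric] L2_component Lg)
    finally show ?thesis .
  qed
  show thesis
  proof (rule that)
    show "s \<in> H1" by (rule H1I[OF g(1)])
    have "H1_sqnorm s \<le> (\<Sum>i. sqnorm (grad (w i))) + (\<Sum>i. sqnorm (w i))"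
      unfolding H1_sqnorm_gradient[OF g(1)] using g(2) Ls(2) Mg by simp
    also have "\<dots> = (\<Sum>i. H1_sqnorm (w i))"
      unfolding H1_sqnorm_def by (rule suminf_add[OF s2 s1])
    also have "\<dots> \<le> (\<Sum>i. c i)"
      by (intro suminf_le c) (auto intro!: summ H1_sqnorm_nonneg)
    finally show "H1_sqnorm s \<le> (\<Sum>i. c i)" .
    show "AE x in lebesgue. \<forall>i. \<bar>w i x\<bar> \<le> s x"
      using fin
    proof eventually_elim
      case (elim x)
      have "ennreal \<bar>w i x\<bar> \<le> ennreal (s x)" for i
      proof -
        have "ennreal \<bar>w i x\<bar> \<le> S x" unfolding S_def by (rule SUP_upper) simp
        then show ?thesis using elim unfolding s_def by simp
      qed
      then show ?case by (simp add: s_def ennreal_le_iff)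
    qed
  qed
qed

section \<open>Capacity\<close>

text \<open>Witnesses of either sign may share the work of being at least \<open>1\<close> in absolute value near \<open>E\<close>; their
  supremum is an admissible competitor for the capacity of \<open>E\<close>.\<close>

lemma cap_le:
  fixes w :: "nat \<Rightarrow> 'a::euclidean_space \<Rightarrow> real"
  assumes w: "\<And>i. w i \<in> H1" and c: "\<And>i. H1_sqnorm (w i) \<le> c i" "summable c"
    and U: "open U" "E \<subseteq> U" "AE x in lebesgue. x \<in> U \<longrightarrow> (\<exists>i. 1 \<le> \<bar>w i x\<bar>)"
  shows "cap E \<le> ennreal (\<Sum>i. c i)"
proof -
  obtain s where s: "s \<in> H1" "AE x in lebesgue. \<forall>i. \<bar>w i x\<bar> \<le> s x" "H1_sqnorm s \<le> (\<Sum>i. c i)"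
    using H1_supremum[OF w c] by blast
  have "AE x in lebesgue. x \<in> U \<longrightarrow> 1 \<le> s x"
    using U(3) s(2) by eventually_elim (meson order_trans)
  then have "cap E \<le> (\<integral>\<^sup>+x. ennreal ((norm (grad s x))\<^sup>2) \<partial>lebesgue) + (\<integral>\<^sup>+x. ennreal ((s x)\<^sup>2) \<partial>lebesgue)"
    unfolding cap_def using s(1) U by (intro INF_lower) auto
  also have "\<dots> = ennreal (H1_sqnorm s)" by (rule nn_H1_sqnorm[OF s(1)])
  also have "\<dots> \<le> ennreal (\<Sum>i. c i)" by (intro ennreal_leI s)
  finally show ?thesis .
qed

lemma H1_zero: "(\<lambda>x. 0) \<in> H1" and H1_sqnorm_zero: "H1_sqnorm (\<lambda>x. 0) = 0"
proof -
  have "has_H1_gradient (\<lambda>x. 0) (\<lambda>x. 0)" by (simp add: has_H1_gradient_def)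
  then show "(\<lambda>x. 0) \<in> H1" "H1_sqnorm (\<lambda>x. 0) = 0"
    using H1_sqnorm_gradient[of "\<lambda>x. 0" "\<lambda>x. 0"] by (auto intro: H1I simp: sqnorm_def)
qed

lemma cap_le_two:
  assumes w: "v \<in> H1" "w \<in> H1"
    and U: "open U" "E \<subseteq> U" "AE x in lebesgue. x \<in> U \<longrightarrow> 1 \<le> \<bar>v x\<bar> \<or> 1 \<le> \<bar>w x\<bar>"
  shows "cap E \<le> ennreal (H1_sqnorm v + H1_sqnorm w)"
proof -
  define f where "f i = (if i = 0 then v else if i = Suc 0 then w else (\<lambda>x. 0))" for i :: nat
  have z: "H1_sqnorm (f i) = 0" if "i \<notin> {0, Suc 0}" for i using that by (auto simp: f_def H1_sqnorm_zero)
  have "cap E \<le> ennreal (\<Sum>i. H1_sqnorm (f i))"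
  proof (rule cap_le[where w = f])
    show "summable (\<lambda>i. H1_sqnorm (f i))" by (rule summable_finite[of "{0, Suc 0}"]) (use z in auto)
    show "AE x in lebesgue. x \<in> U \<longrightarrow> (\<exists>i. 1 \<le> \<bar>f i x\<bar>)"
      using U(3)
    proof eventually_elim
      case (elim x)
      have "1 \<le> \<bar>v x\<bar> \<Longrightarrow> 1 \<le> \<bar>f 0 x\<bar>" "1 \<le> \<bar>w x\<bar> \<Longrightarrow> 1 \<le> \<bar>f (Suc 0) x\<bar>" by (auto simp: f_def)
      with elim show ?case by blast
    qed
  qed (use w U H1_zero in \<open>auto simp: f_def\<close>)
  also have "(\<Sum>i. H1_sqnorm (f i)) = (\<Sum>i\<in>{0, Suc 0}. H1_sqnorm (f i))"
    by (rule suminf_finite) (use z in auto)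
  finally show ?thesis by (simp add: f_def)
qed

lemma cap_witness:
  assumes "cap E < ennreal \<epsilon>"
  obtains w U where "w \<in> H1" "open U" "E \<subseteq> U" "AE x in lebesgue. x \<in> U \<longrightarrow> 1 \<le> w x" "H1_sqnorm w < \<epsilon>"
proof -
  obtain w where w: "w \<in> H1" "\<exists>U. open U \<and> E \<subseteq> U \<and> (AE x in lebesgue. x \<in> U \<longrightarrow> 1 \<le> w x)"
    "(\<integral>\<^sup>+x. ennreal ((norm (grad w x))\<^sup>2) \<partial>lebesgue) + (\<integral>\<^sup>+x. ennreal ((w x)\<^sup>2) \<partial>lebesgue) < ennreal \<epsilon>"
    using assms unfolding cap_def INF_less_iff by blast
  have "H1_sqnorm w < \<epsilon>"
    using w(3) nn_H1_sqnorm[OF w(1)] H1_sqnorm_nonneg[of w] by (simp add: ennreal_less_iff)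
  with w that show thesis by blast
qed

lemma cap_mono: "A \<subseteq> B \<Longrightarrow> cap A \<le> cap B"
  unfolding cap_def by (intro INF_superset_mono) auto

lemma cap_countable_Union:
  assumes "\<And>i. cap (E i) < ennreal (c i)" "summable c"
  shows "cap (\<Union>i. E i) \<le> ennreal (\<Sum>i. c i)"
proof -
  have "\<exists>w U. w \<in> H1 \<and> open U \<and> E i \<subseteq> U \<and> (AE x in lebesgue. x \<in> U \<longrightarrow> 1 \<le> w x) \<and> H1_sqnorm w < c i" for i
    using cap_witness[OF assms(1)] by metis
  then obtain w U where w: "\<And>i. w i \<in> H1" "\<And>i. open (U i)" "\<And>i. E i \<subseteq> U i"
    "\<And>i. AE x in lebesgue. x \<in> U i \<longrightarrow> 1 \<le> w i x" "\<And>i. H1_sqnorm (w i) < c i" by metis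
  have "AE x in lebesgue. \<forall>i. x \<in> U i \<longrightarrow> 1 \<le> w i x" using w(4) by (simp add: AE_all_countable)
  then have ae: "AE x in lebesgue. x \<in> (\<Union>i. U i) \<longrightarrow> (\<exists>i. 1 \<le> \<bar>w i x\<bar>)"
    by eventually_elim (use abs_ge_self order_trans in blast)
  show ?thesis
    by (rule cap_le[OF w(1) less_imp_le[OF w(5)] assms(2) _ _ ae]) (use w(2,3) in blast)+
qed

lemma cap_Un:
  assumes "cap A < ennreal a" "cap B < ennreal b" shows "cap (A \<union> B) \<le> ennreal (a + b)"
proof -
  obtain v U where v: "v \<in> H1" "open U" "A \<subseteq> U" "AE x in lebesgue. x \<in> U \<longrightarrow> 1 \<le> v x" "H1_sqnorm v < a"
    using cap_witness[OF assms(1)] by blast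
  obtain w V where w: "w \<in> H1" "open V" "B \<subseteq> V" "AE x in lebesgue. x \<in> V \<longrightarrow> 1 \<le> w x" "H1_sqnorm w < b"
    using cap_witness[OF assms(2)] by blast
  have "AE x in lebesgue. x \<in> U \<union> V \<longrightarrow> 1 \<le> \<bar>v x\<bar> \<or> 1 \<le> \<bar>w x\<bar>"
    using v(4) w(4) by eventually_elim auto
  then have "cap (A \<union> B) \<le> ennreal (H1_sqnorm v + H1_sqnorm w)"
    using v w by (intro cap_le_two[of v w "U \<union> V"]) auto
  also have "\<dots> \<le> ennreal (a + b)" using v w by (intro ennreal_leI) auto
  finally show ?thesis .
qed

lemma zero_if_le_all_pos: "(\<And>\<epsilon>. 0 < \<epsilon> \<Longrightarrow> x \<le> ennreal \<epsilon>) \<Longrightarrow> x = 0"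
  using ennreal_le_epsilon[of 0 x] by simp

lemma half_powers: "summable (\<lambda>i. e * (1/2) ^ Suc i)" "(\<Sum>i. e * (1/2) ^ Suc i) = (e::real)"
proof -
  have "(\<lambda>i. e * (1/2) ^ Suc i) sums (e * 1)" by (intro sums_mult power_half_series)
  then show "summable (\<lambda>i. e * (1/2) ^ Suc i)" "(\<Sum>i. e * (1/2) ^ Suc i) = (e::real)"
    by (auto simp: sums_iff)
qed

lemma cap_null_UN: "(\<And>i::nat. cap (E i) = 0) \<Longrightarrow> cap (\<Union>i. E i) = 0"
proof (rule zero_if_le_all_pos)
  fix \<epsilon> :: real assume z: "\<And>i. cap (E i) = 0" and "\<epsilon> > 0"
  then have "cap (\<Union>i. E i) \<le> ennreal (\<Sum>i. \<epsilon> * (1/2) ^ Suc i)"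
    by (intro cap_countable_Union half_powers) auto
  then show "cap (\<Union>i. E i) \<le> ennreal \<epsilon>" by (simp only: half_powers)
qed

lemma cap_null_subset: "cap B = 0 \<Longrightarrow> A \<subseteq> B \<Longrightarrow> cap A = 0"
  using cap_mono[of A B] by simp

lemma cap_empty: "cap {} = 0"
  using cap_le_two[OF H1_zero H1_zero, of "{}" "{}"] by (simp add: H1_sqnorm_zero)

lemma cap_null_Un: "cap A = 0 \<Longrightarrow> cap B = 0 \<Longrightarrow> cap (A \<union> B) = 0"
proof -
  assume "cap A = 0" "cap B = 0"
  then have "cap (\<Union>i. if i = (0::nat) then A else B) = 0" by (intro cap_null_UN) auto
  then show ?thesis by (rule cap_null_subset) (auto split: if_splits)
qed

text \<open>A competitor is at least \<open>1\<close> on an open set around \<open>E\<close>, so the measure of that open set is at most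
  the square norm of the competitor.\<close>

lemma cap_null_imp_null:
  assumes "cap (E :: 'a::euclidean_space set) = 0"
  shows "E \<in> null_sets lebesgue"
proof -
  have "\<exists>U. open U \<and> E \<subseteq> U \<and> emeasure lborel U \<le> ennreal (inverse (real (Suc n)))" for n
  proof -
    have "cap E < ennreal (inverse (real (Suc n)))" using assms by simp
    then obtain w U where w: "w \<in> H1" "open U" "E \<subseteq> U" "AE x in lebesgue. x \<in> U \<longrightarrow> 1 \<le> w x" "H1_sqnorm w < inverse (real (Suc n))"
      by (rule cap_witness)
    have "emeasure lebesgue U = (\<integral>\<^sup>+x. indicator U x \<partial>lebesgue)" using w(2) by simp
    also have "\<dots> \<le> (\<integral>\<^sup>+x. ennreal ((norm (w x))\<^sup>2) \<partial>lebesgue)"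
    proof (rule nn_integral_mono_AE)
      show "AE x in lebesgue. indicator U x \<le> ennreal ((norm (w x))\<^sup>2)"
        using w(4)
      proof eventually_elim
        case (elim x)
        then have "x \<in> U \<Longrightarrow> 1 \<le> (w x)\<^sup>2" by (simp add: one_le_power)
        then show ?case by (auto split: split_indicator simp: ennreal_1[symmetric] simp del: ennreal_1 intro!: ennreal_leI)
      qed
    qed
    also have "\<dots> = ennreal (sqnorm w)" by (rule nn_sqnorm[OF H1_L2[OF w(1)]])
    also have "\<dots> \<le> ennreal (inverse (real (Suc n)))"
      using w(5) sqnorm_nonneg[of "grad w"] unfolding H1_sqnorm_def by (intro ennreal_leI) linarith
    finally show ?thesis using w by (intro exI[of _ U]) auto
  qed
  then obtain U where U: "\<And>n. open (U n)" "\<And>n. E \<subseteq> U n" "\<And>n. emeasure lborel (U n) \<le> ennreal (inverse (real (Suc n)))" by metis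
  have "emeasure lborel (\<Inter>n. U n) = 0"
  proof (rule zero_if_le_all_pos)
    fix \<epsilon> :: real assume "\<epsilon> > 0"
    then obtain n where n: "inverse (real (Suc n)) < \<epsilon>" using reals_Archimedean by blast
    have "emeasure lborel (\<Inter>n. U n) \<le> emeasure lborel (U n)" using U(1) by (intro emeasure_mono) auto
    also have "\<dots> \<le> ennreal (inverse (real (Suc n)))" by (rule U(3))
    also have "\<dots> \<le> ennreal \<epsilon>" using n by (intro ennreal_leI) simp
    finally show "emeasure lborel (\<Inter>n. U n) \<le> ennreal \<epsilon>" .
  qed
  then have "(\<Inter>n. U n) \<in> null_sets lborel" using U(1) by (auto simp: null_sets_def)
  moreover have "E \<subseteq> (\<Inter>n. U n)" using U(2) by auto
  ultimately show ?thesis by (metis null_sets_completion_subset null_sets_completionI)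
qed

text \<open>Competitors are bounded below almost everywhere on an open set, so enlarging that set by a null set
  costs nothing as long as it stays open.\<close>

lemma cap_Un_null_le:
  assumes "open (A \<union> N)" "AE x in lebesgue. x \<notin> N"
  shows "cap (A \<union> N) \<le> cap A"
proof -
  define Z where "Z u = (\<integral>\<^sup>+x. ennreal ((norm (grad u x))\<^sup>2) \<partial>lebesgue) + (\<integral>\<^sup>+x. ennreal ((u x)\<^sup>2) \<partial>lebesgue)"
    for u :: "'a \<Rightarrow> real"
  show ?thesis
    unfolding cap_def Z_def[symmetric]
  proof (rule INF_superset_mono)
    show "{u \<in> H1. \<exists>U. open U \<and> A \<subseteq> U \<and> (AE x in lebesgue. x \<in> U \<longrightarrow> 1 \<le> u x)}
       \<subseteq> {u \<in> H1. \<exists>U. open U \<and> A \<union> N \<subseteq> U \<and> (AE x in lebesgue. x \<in> U \<longrightarrow> 1 \<le> u x)}"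
    proof safe
      fix u :: "'a \<Rightarrow> real" and U assume U: "open U" "A \<subseteq> U" "AE x in lebesgue. x \<in> U \<longrightarrow> 1 \<le> u x"
      have "AE x in lebesgue. x \<in> U \<union> (A \<union> N) \<longrightarrow> 1 \<le> u x"
        using U(3) assms(2) by eventually_elim (use U(2) in auto)
      then show "\<exists>U. open U \<and> A \<union> N \<subseteq> U \<and> (AE x in lebesgue. x \<in> U \<longrightarrow> 1 \<le> u x)"
        using U(1) assms(1) by (intro exI[of _ "U \<union> (A \<union> N)"]) auto
    qed
  qed simp
qed

section \<open>Quasi-continuous functions\<close>

lemma open_Un_preimage:
  assumes "open A" "continuous_on (- A) f" "open S"
  shows "open (A \<union> {x. f x \<in> S})"
proof -
  obtain T where T: "open T" "T \<inter> - A = f -` S \<inter> - A"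
    using assms(2,3) unfolding continuous_on_open_invariant by blast
  then have "A \<union> {x. f x \<in> S} = A \<union> T" by auto
  with assms(1) T(1) show ?thesis by (simp add: open_Un)
qed

lemma quasi_continuousD:
  assumes "quasi_continuous v" "0 < \<epsilon>"
  obtains A where "open A" "cap A < ennreal \<epsilon>" "continuous_on (- A) v"
  using assms unfolding quasi_continuous_def by (meson ennreal_less_zero_iff)

lemma quasi_continuousI:
  assumes "\<And>\<epsilon>. 0 < \<epsilon> \<Longrightarrow> \<exists>A. open A \<and> cap A \<le> ennreal \<epsilon> \<and> continuous_on (- A) v"
  shows "quasi_continuous v"
  unfolding quasi_continuous_def
proof (intro allI impI)
  fix \<epsilon> :: ennreal assume "\<epsilon> > 0"
  then obtain d where d: "0 < d" "d < \<epsilon>" using dense by blast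
  then obtain r where r: "d = ennreal r" "0 < r" by (cases d) auto
  obtain A where "open A" "cap A \<le> ennreal r" "continuous_on (- A) v" using assms[OF r(2)] by blast
  with d r show "\<exists>A. open A \<and> cap A < \<epsilon> \<and> continuous_on (- A) v" by (metis le_less_trans)
qed

lemma continuous_imp_quasi_continuous: "continuous_on UNIV v \<Longrightarrow> quasi_continuous v"
  by (rule quasi_continuousI) (intro exI[of _ "{}"], auto simp: cap_empty)

lemma quasi_continuous_lincomb:
  assumes "quasi_continuous v" "quasi_continuous w"
  shows "quasi_continuous (\<lambda>x. a * v x + b * w x)"
proof (rule quasi_continuousI)
  fix \<epsilon> :: real assume e: "\<epsilon> > 0"
  obtain A where A: "open A" "cap A < ennreal (\<epsilon>/2)" "continuous_on (- A) v"
    using quasi_continuousD[OF assms(1), of "\<epsilon>/2"] e by auto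
  obtain B where B: "open B" "cap B < ennreal (\<epsilon>/2)" "continuous_on (- B) w"
    using quasi_continuousD[OF assms(2), of "\<epsilon>/2"] e by auto
  have "cap (A \<union> B) \<le> ennreal \<epsilon>" using cap_Un[OF A(2) B(2)] by simp
  moreover have "continuous_on (- (A \<union> B)) (\<lambda>x. a * v x + b * w x)"
    by (intro continuous_intros continuous_on_subset[OF A(3)] continuous_on_subset[OF B(3)]) auto
  ultimately show "\<exists>A. open A \<and> cap A \<le> ennreal \<epsilon> \<and> continuous_on (- A) (\<lambda>x. a * v x + b * w x)"
    using A(1) B(1) by (intro exI[of _ "A \<union> B"]) auto
qed

lemma quasi_continuous_diff:
  "quasi_continuous v \<Longrightarrow> quasi_continuous w \<Longrightarrow> quasi_continuous (\<lambda>x. v x - w x)"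
  using quasi_continuous_lincomb[of v w 1 "-1"] by simp

text \<open>Outside a small open set \<open>A\<close> the set where \<open>v\<close> does not vanish is relatively open; together with
  \<open>A\<close> it is open, and it adds only a null set.\<close>

lemma quasi_continuous_AE_zero:
  assumes "quasi_continuous v" "AE x in lebesgue. v x = 0"
  shows "cap {x. v x \<noteq> 0} = 0"
proof (rule zero_if_le_all_pos)
  fix \<epsilon> :: real assume "\<epsilon> > 0"
  then obtain A where A: "open A" "cap A < ennreal \<epsilon>" "continuous_on (- A) v"
    using quasi_continuousD[OF assms(1)] by blast
  have o: "open (A \<union> {x. v x \<noteq> 0})"
    using open_Un_preimage[OF A(1,3), of "- {0}"] by (simp add: open_Compl)
  have "cap {x. v x \<noteq> 0} \<le> cap (A \<union> {x. v x \<noteq> 0})" by (intro cap_mono) auto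
  also have "\<dots> \<le> cap A" by (rule cap_Un_null_le[OF o]) (use assms(2) in auto)
  finally show "cap {x. v x \<noteq> 0} \<le> ennreal \<epsilon>" using A(2) by simp
qed

text \<open>The weak-type inequality. The superlevel set is open after adding the exceptional set \<open>A\<close> of \<open>v\<close>;
  on it \<open>v / t\<close> is a competitor, and a competitor for \<open>A\<close> covers the rest. An open superset is
  recorded because exceptional sets of quasi-continuous functions have to be open.\<close>

lemma quasi_continuous_superlevel:
  assumes v: "v \<in> H1" "quasi_continuous v" and t: "t > 0" "\<delta> > 0"
  obtains H where "open H" "{x. t < \<bar>v x\<bar>} \<subseteq> H" "cap H \<le> ennreal (H1_sqnorm v / t\<^sup>2 + \<delta>)"
proof -
  obtain A where A: "open A" "cap A < ennreal \<delta>" "continuous_on (- A) v"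
    using quasi_continuousD[OF v(2) t(2)] by blast
  obtain w U where w: "w \<in> H1" "open U" "A \<subseteq> U" "AE x in lebesgue. x \<in> U \<longrightarrow> 1 \<le> w x" "H1_sqnorm w < \<delta>"
    using cap_witness[OF A(2)] by blast
  define H where "H = (A \<union> {x. v x \<in> - cball 0 t}) \<union> U"
  have vt: "(\<lambda>x. (1/t) * v x) \<in> H1" by (rule H1_cmult[OF v(1)])
  have oH: "open H" unfolding H_def by (intro open_Un[OF open_Un_preimage[OF A(1,3) open_Compl[OF closed_cball]] w(2)])
  show thesis
  proof (rule that[OF oH])
    show "{x. t < \<bar>v x\<bar>} \<subseteq> H" by (auto simp: H_def)
    have "AE x in lebesgue. x \<in> H \<longrightarrow> 1 \<le> \<bar>(1/t) * v x\<bar> \<or> 1 \<le> \<bar>w x\<bar>"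
      using w(4) by eventually_elim (use w(3) t in \<open>auto simp: H_def abs_mult\<close>)
    then have "cap H \<le> ennreal (H1_sqnorm (\<lambda>x. (1/t) * v x) + H1_sqnorm w)"
      by (intro cap_le_two[OF vt w(1) oH]) auto
    also have "\<dots> \<le> ennreal (H1_sqnorm v / t\<^sup>2 + \<delta>)"
      using w(5) unfolding H1_sqnorm_cmult[OF v(1)] by (intro ennreal_leI) (simp add: power_divide)
    finally show "cap H \<le> ennreal (H1_sqnorm v / t\<^sup>2 + \<delta>)" .
  qed
qed

lemma geometric_tail:
  fixes a :: "nat \<Rightarrow> real"
  assumes "\<And>n. n \<ge> m \<Longrightarrow> \<bar>a (Suc n) - a n\<bar> \<le> (1/2) ^ n"
  shows "n \<ge> m \<Longrightarrow> \<bar>a (n + k) - a n\<bar> \<le> 2 * (1/2) ^ n" "convergent a"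
proof -
  have b: "\<bar>a (n + k) - a n\<bar> \<le> 2 * (1/2) ^ n - 2 * (1/2) ^ (n + k)" if "n \<ge> m" for n k
  proof (induction k)
    case (Suc k)
    have "\<bar>a (Suc (n + k)) - a (n + k)\<bar> \<le> (1/2) ^ (n + k)" by (rule assms) (use that in auto)
    with Suc show ?case by simp
  qed simp
  show b': "\<bar>a (n + k) - a n\<bar> \<le> 2 * (1/2) ^ n" if "n \<ge> m" for n k
    using b[OF that, of k] by (smt (verit) zero_le_power divide_nonneg_nonneg)
  have "Cauchy a"
  proof (rule CauchyI')
    fix e :: real assume "e > 0"
    then obtain N where N: "(1/2) ^ N < e / 2" using real_arch_pow_inv[of "e/2" "1/2"] by auto
    show "\<exists>M. \<forall>p\<ge>M. \<forall>n>p. dist (a p) (a n) < e"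
    proof (intro exI[of _ "max m N"] allI impI)
      fix p n assume p: "p \<ge> max m N" "n > p"
      have "\<bar>a (p + (n - p)) - a p\<bar> \<le> 2 * (1/2) ^ p" by (rule b') (use p in auto)
      moreover have "(1/2::real) ^ p \<le> (1/2) ^ N" using p by (intro power_decreasing) auto
      ultimately have "\<bar>a (p + (n - p)) - a p\<bar> < e" using N by linarith
      then show "dist (a p) (a n) < e" using p(2) by (simp add: dist_real_def abs_minus_commute)
    qed
  qed
  then show "convergent a" by (simp add: Cauchy_convergent_iff)
qed

text \<open>Outside the open set \<open>B m\<close>, whose capacity is at most \<open>8 (1/2)\<^sup>m\<close>, all \<open>v n\<close> with \<open>n \<ge> m\<close> are
  continuous and converge uniformly. The rate \<open>(1/8)\<^sup>n\<close> leaves capacity \<open>(1/2)\<^sup>n\<close> after division by the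
  square of the threshold \<open>(1/2)\<^sup>n\<close>.\<close>

lemma quasi_continuous_limit:
  fixes v :: "nat \<Rightarrow> 'a::euclidean_space \<Rightarrow> real"
  assumes v: "\<And>n. v n \<in> H1" "\<And>n. quasi_continuous (v n)"
    and fast: "\<And>n. H1_sqnorm (\<lambda>x. v (Suc n) x - v n x) \<le> (1/8) ^ n"
  shows "quasi_continuous (\<lambda>x. lim (\<lambda>n. v n x))"
proof -
  have "\<exists>H. open H \<and> {x. (1/2) ^ n < \<bar>v (Suc n) x - v n x\<bar>} \<subseteq> H \<and> cap H \<le> ennreal (2 * (1/2) ^ n)" for n
  proof -
    obtain H where H: "open H" "{x. (1/2) ^ n < \<bar>v (Suc n) x - v n x\<bar>} \<subseteq> H"
      "cap H \<le> ennreal (H1_sqnorm (\<lambda>x. v (Suc n) x - v n x) / ((1/2) ^ n)\<^sup>2 + (1/2) ^ n)"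
      by (rule quasi_continuous_superlevel[OF H1_diff[OF v(1)[of "Suc n"] v(1)[of n]]
            quasi_continuous_diff[OF v(2)[of "Suc n"] v(2)[of n]], of "(1/2)^n" "(1/2)^n"]) auto
    have "H1_sqnorm (\<lambda>x. v (Suc n) x - v n x) / ((1/2) ^ n)\<^sup>2 \<le> (1/8)^n / ((1/2) ^ n)\<^sup>2"
      by (intro divide_right_mono fast) auto
    also have "\<dots> = (1/2) ^ n"
    proof -
      have "(1/8::real) ^ n = (1/2) ^ n * ((1/2) ^ n)\<^sup>2"
        by (simp add: power2_eq_square flip: power_mult_distrib)
      then show ?thesis by simp
    qed
    finally have "H1_sqnorm (\<lambda>x. v (Suc n) x - v n x) / ((1/2) ^ n)\<^sup>2 + (1/2) ^ n \<le> 2 * (1/2)^n" by simp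
    from H(1,2) order_trans[OF H(3) ennreal_leI[OF this]] show ?thesis by (intro exI[of _ H] conjI)
  qed
  then obtain H where H: "\<And>n. open (H n)" "\<And>n. {x. (1/2) ^ n < \<bar>v (Suc n) x - v n x\<bar>} \<subseteq> H n"
     "\<And>n. cap (H n) \<le> ennreal (2 * (1/2) ^ n)" by metis
  have "\<exists>A. open A \<and> cap A < ennreal ((1/2)^n) \<and> continuous_on (- A) (v n)" for n
    using quasi_continuousD[OF v(2), of "(1/2)^n"] by (metis half_gt_zero_iff zero_less_one zero_less_power)
  then obtain G where G: "\<And>n. open (G n)" "\<And>n. cap (G n) < ennreal ((1/2)^n)" "\<And>n. continuous_on (- G n) (v n)" by metis
  define B where "B m = (\<Union>k. H (m + k) \<union> G (m + k))" for m
  have oB: "open (B m)" for m unfolding B_def using H(1) G(1) by auto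
  have HG: "cap (H n \<union> G n) < ennreal (8 * (1/2) ^ Suc n)" for n
  proof -
    \<comment> \<open>The union bound takes strict inequalities, hence \<open>5/2\<close> in place of \<open>2\<close>.\<close>
    have "cap (H n) < ennreal (5/2 * (1/2) ^ n)"
      using H(3)[of n] by (rule le_less_trans) (simp add: ennreal_less_iff)
    from cap_Un[OF this G(2)[of n]] have "cap (H n \<union> G n) \<le> ennreal (7/2 * (1/2) ^ n)" by simp
    also have "\<dots> < ennreal (8 * (1/2) ^ Suc n)" by (simp add: ennreal_less_iff)
    finally show ?thesis .
  qed
  have capB: "cap (B m) \<le> ennreal (8 * (1/2) ^ m)" for m
  proof -
    have "cap (B m) \<le> ennreal (\<Sum>k. (8 * (1/2) ^ m) * (1/2) ^ Suc k)"
      unfolding B_def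
    proof (rule cap_countable_Union)
      fix k show "cap (H (m + k) \<union> G (m + k)) < ennreal (8 * (1/2) ^ m * (1/2) ^ Suc k)"
        using HG[of "m + k"] by (simp add: power_add mult_ac)
    qed (rule half_powers)
    then show ?thesis by (simp only: half_powers)
  qed
  have step: "\<bar>v (Suc n) x - v n x\<bar> \<le> (1/2) ^ n" if "x \<notin> B m" "n \<ge> m" for x m n
  proof -
    have "x \<notin> H (m + (n - m))" using that(1) unfolding B_def by blast
    then show ?thesis using H(2)[of n] that(2) by (auto simp: not_less[symmetric])
  qed
  have conv: "convergent (\<lambda>n. v n x)" if "x \<notin> B m" for x m
    using geometric_tail(2)[of m "\<lambda>n. v n x"] step[OF that] by blast
  have small: "\<exists>m. 8 * (1/2) ^ m \<le> \<epsilon>" if e: "\<epsilon> > 0" for \<epsilon> :: real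
  proof -
    obtain n where "(1/2) ^ n < \<epsilon> / 8" using real_arch_pow_inv[of "\<epsilon>/8" "1/2"] e by auto
    then show ?thesis by (intro exI[of _ n]) simp
  qed
  show "quasi_continuous (\<lambda>x. lim (\<lambda>n. v n x))"
  proof (rule quasi_continuousI)
    fix \<epsilon> :: real assume "\<epsilon> > 0"
    then obtain m where m: "8 * (1/2) ^ m \<le> \<epsilon>" using small by blast
    have "continuous_on (- B m) (\<lambda>x. lim (\<lambda>n. v n x))"
    proof (rule uniform_limit_theorem)
      show "\<forall>\<^sub>F n in sequentially. continuous_on (- B m) (v n)"
        unfolding eventually_sequentially
      proof (intro exI[of _ m] allI impI)
        fix n assume "m \<le> n"
        then have "G (m + (n - m)) \<subseteq> B m" unfolding B_def by blast
        with \<open>m \<le> n\<close> have "G n \<subseteq> B m" by simp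
        then show "continuous_on (- B m) (v n)" by (intro continuous_on_subset[OF G(3)]) auto
      qed
      show "uniform_limit (- B m) v (\<lambda>x. lim (\<lambda>n. v n x)) sequentially"
      proof (rule uniform_limitI)
        fix e :: real assume "e > 0"
        then obtain N where N: "(1/2) ^ N < e / 2" using real_arch_pow_inv[of "e/2" "1/2"] by auto
        show "\<forall>\<^sub>F n in sequentially. \<forall>x\<in>- B m. dist (v n x) (lim (\<lambda>n. v n x)) < e"
          unfolding eventually_sequentially
        proof (intro exI[of _ "max m N"] allI impI ballI)
          fix n x assume n: "max m N \<le> n" and x: "x \<in> - B m"
          have l: "(\<lambda>n. v n x) \<longlonglongrightarrow> lim (\<lambda>n. v n x)" using conv[of x m] x by (simp add: convergent_LIMSEQ_iff)
          have "\<bar>lim (\<lambda>n. v n x) - v n x\<bar> \<le> 2 * (1/2) ^ n"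
          proof (rule tendsto_upperbound)
            show "(\<lambda>k. \<bar>v (n + k) x - v n x\<bar>) \<longlonglongrightarrow> \<bar>lim (\<lambda>n. v n x) - v n x\<bar>"
              using LIMSEQ_ignore_initial_segment[OF l, of n] by (intro tendsto_intros) (simp add: add.commute)
            show "\<forall>\<^sub>F k in sequentially. \<bar>v (n + k) x - v n x\<bar> \<le> 2 * (1/2) ^ n"
              using geometric_tail(1)[of m "\<lambda>n. v n x" n, OF step[of x m]] n x
              by (intro always_eventually allI) simp
          qed simp
          moreover have "(1/2::real) ^ n \<le> (1/2) ^ N" using n by (intro power_decreasing) auto
          ultimately have "\<bar>lim (\<lambda>n. v n x) - v n x\<bar> < e" using N by linarith
          then show "dist (v n x) (lim (\<lambda>n. v n x)) < e" by (simp add: dist_real_def abs_minus_commute)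
        qed
      qed
    qed simp
    then show "\<exists>A. open A \<and> cap A \<le> ennreal \<epsilon> \<and> continuous_on (- A) (\<lambda>x. lim (\<lambda>n. v n x))"
      using oB[of m] order_trans[OF capB[of m] ennreal_leI[OF m]] by blast
  qed
qed

section \<open>Passing to strong limits\<close>

lemma gradient_limit:
  fixes u :: "nat \<Rightarrow> 'a::euclidean_space \<Rightarrow> real"
  assumes g: "\<And>n. has_H1_gradient (u n) (g n)" and L: "L2 w" "L2 h"
    and lim: "L2_tendsto u w" "L2_tendsto g h"
  shows "has_H1_gradient w h"
  unfolding has_H1_gradient_def
proof (intro conjI L allI impI ballI)
  fix \<phi> :: "'a \<Rightarrow> real" and i :: 'a assume p: "test_function \<phi>" "i \<in> Basis"
  have c: "(\<lambda>n. sqnorm (\<lambda>x. g n x \<bullet> i - h x \<bullet> i)) \<longlonglongrightarrow> 0"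
  proof (rule Lim_null_comparison)
    show "(\<lambda>n. (norm i)\<^sup>2 * sqnorm (\<lambda>x. g n x - h x)) \<longlonglongrightarrow> 0"
      using tendsto_mult_left[OF lim(2), of "(norm i)\<^sup>2"] by simp
    show "\<forall>\<^sub>F n in sequentially. norm (sqnorm (\<lambda>x. g n x \<bullet> i - h x \<bullet> i)) \<le> (norm i)\<^sup>2 * sqnorm (\<lambda>x. g n x - h x)"
      using sqnorm_component_le[OF L2_diff[OF gradient_L2(2)[OF g] L(2)], of _ i]
      by (intro always_eventually) (simp add: inner_diff_left)
  qed
  have 1: "(\<lambda>n. pairing (u n) (dir_deriv \<phi> i)) \<longlonglongrightarrow> pairing w (dir_deriv \<phi> i)"
    by (rule L2_limit_mult[OF gradient_L2(1)[OF g] L(1) test_function_deriv_L2[OF p(1)] lim(1)])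
  have 2: "(\<lambda>n. pairing (\<lambda>x. g n x \<bullet> i) \<phi>) \<longlonglongrightarrow> pairing (\<lambda>x. h x \<bullet> i) \<phi>"
    by (rule L2_limit_mult[OF L2_component[OF gradient_L2(2)[OF g]] L2_component[OF L(2)] test_function_L2[OF p(1)] c])
  have "(\<lambda>n. - pairing (\<lambda>x. g n x \<bullet> i) \<phi>) \<longlonglongrightarrow> pairing w (dir_deriv \<phi> i)"
    using 1 unfolding gradient_direction[OF g p(1)] .
  then show "pairing w (dir_deriv \<phi> i) = - pairing (\<lambda>x. h x \<bullet> i) \<phi>"
    using tendsto_minus[OF 2] LIMSEQ_unique by blast
qed

text \<open>A bounded sequence in a midpoint-convex set of Sobolev functions which converges in \<open>L\<^sup>2\<close> may be
  replaced by one that converges to the same limit in \<open>H\<^sup>1\<close>. This yields both the weak closedness of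
  the set, once its strong closedness is known, and the lower semicontinuity of the Dirichlet
  integral.\<close>

lemma energy_midpoint:
  fixes K :: "('a::euclidean_space \<Rightarrow> real) set" and z :: "nat \<Rightarrow> 'a \<Rightarrow> real"
  assumes K: "\<And>v. v \<in> K \<Longrightarrow> v \<in> H1" "\<And>v w. v \<in> K \<Longrightarrow> w \<in> K \<Longrightarrow> (\<lambda>x. (1/2) * (v x + w x)) \<in> K"
    and z: "\<And>n. z n \<in> K" "\<And>n. sqnorm (grad (z n)) \<le> M" and u: "L2 u" and lim: "L2_tendsto z u"
  obtains w where "\<And>n. w n \<in> K" "u \<in> H1" "sqnorm (grad u) \<le> M" "(\<lambda>n. H1_sqnorm (\<lambda>x. w n x - u x)) \<longlonglongrightarrow> 0"
proof -
  define C where "C n = {w \<in> K. \<forall>c. (\<forall>k\<ge>n. sqnorm (\<lambda>x. z k x - u x) \<le> c) \<longrightarrow> sqnorm (\<lambda>x. w x - u x) \<le> c}" for n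
  have zC: "z n \<in> C n" for n unfolding C_def using z(1) by auto
  have CK: "w \<in> C n \<Longrightarrow> w \<in> K" for w n by (simp add: C_def)
  have KL: "w \<in> K \<Longrightarrow> L2 w" "w \<in> K \<Longrightarrow> L2 (grad w)" for w
    using K(1) H1_L2 gradient_L2(2)[OF gradient_grad] by blast+
  obtain w where w: "\<And>n. w n \<in> C n" "\<And>n a. a \<in> C n \<Longrightarrow> sqnorm (grad (w n)) \<le> sqnorm (grad a) + 1 / Suc n"
    "\<And>e. e > 0 \<Longrightarrow> \<exists>N. \<forall>m\<ge>N. \<forall>n\<ge>N. sqnorm (\<lambda>x. grad (w m) x - grad (w n) x) / 4 < e"
  proof (rule midpoint_minimization[where C = C and q = "\<lambda>w. sqnorm (grad w)" and M = M
        and mid = "\<lambda>a b x. (1/2) * (a x + b x)" and D = "\<lambda>a b. sqnorm (\<lambda>x. grad a x - grad b x) / 4"])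
    show "C (Suc n) \<subseteq> C n" for n unfolding C_def by (auto dest: Suc_leD)
    show "C n \<noteq> {}" for n using zC by auto
    show "\<exists>a\<in>C n. sqnorm (grad a) \<le> M" for n using zC z(2) by blast
    show "0 \<le> sqnorm (grad a)" for a :: "'a \<Rightarrow> real" by simp
    show "sqnorm (grad (\<lambda>x. (1/2) * (a x + b x))) + sqnorm (\<lambda>x. grad a x - grad b x) / 4 \<le> (sqnorm (grad a) + sqnorm (grad b)) / 2"
      if "a \<in> C 0" "b \<in> C 0" for a b
    proof -
      note ab = CK[OF that(1)] CK[OF that(2)]
      have "sqnorm (grad (\<lambda>x. (1/2) * (a x + b x))) = sqnorm (\<lambda>x. (1/2) *\<^sub>R (grad a x + grad b x))"
        by (rule sqnorm_grad[OF gradient_cmult[OF gradient_add[OF gradient_grad gradient_grad]]]) (use K(1) ab in auto)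
      then show ?thesis using sqnorm_parallelogram[OF KL(2)[OF ab(1)] KL(2)[OF ab(2)]] by simp
    qed
    show "(\<lambda>x. (1/2) * (a x + b x)) \<in> C n" if ab: "a \<in> C n" "b \<in> C n" for n a b
      unfolding C_def
    proof (intro CollectI conjI allI impI)
      show "(\<lambda>x. (1/2) * (a x + b x)) \<in> K" by (intro K CK[OF ab(1)] CK[OF ab(2)])
      fix c assume c: "\<forall>k\<ge>n. sqnorm (\<lambda>x. z k x - u x) \<le> c"
      have 1: "sqnorm (\<lambda>x. a x - u x) \<le> c" "sqnorm (\<lambda>x. b x - u x) \<le> c" using ab c unfolding C_def by blast+
      have "(\<lambda>x. (1/2) * (a x + b x) - u x) = (\<lambda>x. (1/2) *\<^sub>R ((a x - u x) + (b x - u x)))" by (auto simp: algebra_simps)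
      then have "sqnorm (\<lambda>x. (1/2) * (a x + b x) - u x) + sqnorm (\<lambda>x. (a x - u x) - (b x - u x)) / 4
          = (sqnorm (\<lambda>x. a x - u x) + sqnorm (\<lambda>x. b x - u x)) / 2"
        using sqnorm_parallelogram[OF L2_diff[OF KL(1)[OF CK[OF ab(1)]] u] L2_diff[OF KL(1)[OF CK[OF ab(2)]] u]] by simp
      moreover have "0 \<le> sqnorm (\<lambda>x. (a x - u x) - (b x - u x))" by simp
      ultimately show "sqnorm (\<lambda>x. (1/2) * (a x + b x) - u x) \<le> c" using 1 by argo
    qed
  qed (rule that; assumption)
  have wK: "w n \<in> K" for n using w(1) CK by blast
  have Cau: "\<exists>N. \<forall>m\<ge>N. \<forall>n\<ge>N. sqnorm (\<lambda>x. grad (w m) x - grad (w n) x) < e" if "e > 0" for e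
    using w(3)[of "e/4"] that by simp
  obtain h where h: "L2 h" "(\<lambda>n. sqnorm (\<lambda>x. grad (w n) x - h x)) \<longlonglongrightarrow> 0"
    using L2_complete[of "\<lambda>n. grad (w n)", OF KL(2)[OF wK] Cau] by blast
  have wu: "L2_tendsto w u"
  proof (rule LIMSEQ_I)
    fix r :: real assume "r > 0"
    then obtain N where N: "\<And>k. k \<ge> N \<Longrightarrow> sqnorm (\<lambda>x. z k x - u x) < r / 2"
      using LIMSEQ_D[OF lim, of "r/2"] by auto
    have "norm (sqnorm (\<lambda>x. w n x - u x) - 0) < r" if "n \<ge> N" for n
    proof -
      have "\<forall>k\<ge>n. sqnorm (\<lambda>x. z k x - u x) \<le> r / 2" using N that by (meson less_imp_le order_trans)
      then have "sqnorm (\<lambda>x. w n x - u x) \<le> r / 2" using w(1)[of n] unfolding C_def by blast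
      then show ?thesis using \<open>r > 0\<close> by simp
    qed
    then show "\<exists>N. \<forall>n\<ge>N. norm (sqnorm (\<lambda>x. w n x - u x) - 0) < r" by blast
  qed
  note gw = gradient_grad[OF K(1)[OF wK]]
  have uh: "has_H1_gradient u h" by (rule gradient_limit[OF gw u h(1) wu h(2)])
  show thesis
  proof (rule that[OF wK H1I[OF uh]])
    have "(\<lambda>n. M + inverse (real (Suc n))) \<longlonglongrightarrow> M + 0"
      by (intro tendsto_intros LIMSEQ_inverse_real_of_nat)
    moreover have "sqnorm (grad (w n)) \<le> M + inverse (real (Suc n))" for n
      using w(2)[OF zC[of n]] z(2)[of n] by (simp add: inverse_eq_divide)
    ultimately show "sqnorm (grad u) \<le> M"
      unfolding sqnorm_grad[OF uh]
      using L2_limit_sqnorm[OF KL(2)[OF wK] h, of "\<lambda>n. M + inverse (real (Suc n))" M] by simp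
    have "H1_sqnorm (\<lambda>x. w n x - u x) = sqnorm (\<lambda>x. grad (w n) x - h x) + sqnorm (\<lambda>x. w n x - u x)" for n
      by (rule H1_sqnorm_gradient[OF gradient_diff[OF gw uh]])
    then show "(\<lambda>n. H1_sqnorm (\<lambda>x. w n x - u x)) \<longlonglongrightarrow> 0"
      using tendsto_add[OF h(2) wu] by simp
  qed
qed

section \<open>Density of continuous functions\<close>

lemma borel_lebesgue_measurable: "f \<in> borel_measurable borel \<Longrightarrow> f \<in> borel_measurable lebesgue"
  by (intro measurable_completion) simp

text \<open>Jensen's inequality for the probability density \<open>\<rho>\<close>, followed by Tonelli's theorem.\<close>

lemma averaging_L2:
  fixes F :: "'a::euclidean_space \<Rightarrow> 'a \<Rightarrow> real"
  assumes F: "(\<lambda>(x, z). F x z) \<in> borel_measurable (lborel \<Otimes>\<^sub>M lborel)"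
    and r: "\<rho> \<in> borel_measurable borel" "\<And>z. 0 \<le> \<rho> z" "integrable lebesgue \<rho>" "(\<integral>z. \<rho> z \<partial>lebesgue) = 1"
    and bd: "\<And>z. \<rho> z \<noteq> 0 \<Longrightarrow> (\<integral>\<^sup>+x. ennreal ((F x z)\<^sup>2) \<partial>lborel) \<le> ennreal c" and c: "0 \<le> c"
  shows "L2 (\<lambda>x. \<integral>z. F x z * \<rho> z \<partial>lebesgue)" "sqnorm (\<lambda>x. \<integral>z. F x z * \<rho> z \<partial>lebesgue) \<le> c"
proof -
  have F'[measurable]: "case_prod F \<in> borel_measurable (lborel \<Otimes>\<^sub>M lborel)" using F by simp
  note r(1)[measurable]
  have Fx: "F x \<in> borel_measurable borel" for x
    using measurable_Pair2[OF F', of x] by simp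
  have Fz: "(\<lambda>x. F x z) \<in> borel_measurable borel" for z
    using measurable_Pair1[OF F', of z] by simp
  have eq: "(\<integral>z. F x z * \<rho> z \<partial>lebesgue) = (\<integral>z. F x z * \<rho> z \<partial>lborel)" for x
    using Fx r(1) by (intro integral_completion) auto
  have "(\<lambda>x. \<integral>z. F x z * \<rho> z \<partial>lborel) \<in> borel_measurable lborel"
    by (rule lborel.borel_measurable_lebesgue_integral) measurable
  then have m: "(\<lambda>x. \<integral>z. F x z * \<rho> z \<partial>lebesgue) \<in> borel_measurable lebesgue"
    unfolding eq by (rule measurable_completion)
  have pt: "ennreal ((norm (\<integral>z. F x z * \<rho> z \<partial>lebesgue))\<^sup>2) \<le> (\<integral>\<^sup>+z. ennreal ((F x z)\<^sup>2 * \<rho> z) \<partial>lborel)" for x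
  proof (cases "(\<integral>\<^sup>+z. ennreal ((F x z)\<^sup>2 * \<rho> z) \<partial>lborel) = \<infinity>")
    case False
    define f where "f z = F x z * sqrt (\<rho> z)" for z
    define g where "g z = sqrt (\<rho> z)" for z
    have fm: "f \<in> borel_measurable lebesgue" "g \<in> borel_measurable lebesgue"
      unfolding f_def g_def using Fx r(1) by (auto intro!: borel_lebesgue_measurable)
    have f2: "(norm (f z))\<^sup>2 = (F x z)\<^sup>2 * \<rho> z" and g2: "(norm (g z))\<^sup>2 = \<rho> z" and fg: "f z * g z = F x z * \<rho> z" for z
      using r(2)[of z] by (simp_all add: f_def g_def power_mult_distrib)
    have n: "(\<integral>\<^sup>+z. ennreal ((norm (f z))\<^sup>2) \<partial>lebesgue) = (\<integral>\<^sup>+z. ennreal ((F x z)\<^sup>2 * \<rho> z) \<partial>lborel)"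
      unfolding f2 by (rule nn_integral_completion)
    have Lf: "L2 f" unfolding L2_on_def using fm(1) n False
      by (auto simp: lebesgue_on_UNIV_eq top.not_eq_extremum)
    have Lg: "L2 g" unfolding L2_iff g2 using fm(2) r(3) by simp
    have g1: "sqnorm g = 1" unfolding sqnorm_def g2 by (rule r(4))
    have "\<bar>\<integral>z. F x z * \<rho> z \<partial>lebesgue\<bar> \<le> sqrt (sqnorm f)"
      using L2_Cauchy_Schwarz[OF Lf Lg] unfolding fg g1 by simp
    then have "\<bar>\<integral>z. F x z * \<rho> z \<partial>lebesgue\<bar>\<^sup>2 \<le> (sqrt (sqnorm f))\<^sup>2" by (intro power_mono) auto
    then have "(norm (\<integral>z. F x z * \<rho> z \<partial>lebesgue))\<^sup>2 \<le> sqnorm f" by simp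
    then have "ennreal ((norm (\<integral>z. F x z * \<rho> z \<partial>lebesgue))\<^sup>2) \<le> ennreal (sqnorm f)" by (rule ennreal_leI)
    also have "\<dots> = (\<integral>\<^sup>+z. ennreal ((F x z)\<^sup>2 * \<rho> z) \<partial>lborel)" using nn_sqnorm[OF Lf] n by simp
    finally show ?thesis .
  qed simp
  have "(\<integral>\<^sup>+x. ennreal ((norm (\<integral>z. F x z * \<rho> z \<partial>lebesgue))\<^sup>2) \<partial>lebesgue)
      = (\<integral>\<^sup>+x. ennreal ((norm (\<integral>z. F x z * \<rho> z \<partial>lborel))\<^sup>2) \<partial>lborel)"
    unfolding eq by (rule nn_integral_completion)
  also have "\<dots> \<le> (\<integral>\<^sup>+x. \<integral>\<^sup>+z. ennreal ((F x z)\<^sup>2 * \<rho> z) \<partial>lborel \<partial>lborel)"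
    using pt unfolding eq by (intro nn_integral_mono) auto
  also have "\<dots> = (\<integral>\<^sup>+z. \<integral>\<^sup>+x. ennreal ((F x z)\<^sup>2 * \<rho> z) \<partial>lborel \<partial>lborel)"
    by (rule lborel_pair.Fubini'[symmetric]) measurable
  also have "\<dots> \<le> (\<integral>\<^sup>+z. ennreal c * ennreal (\<rho> z) \<partial>lborel)"
  proof (rule nn_integral_mono)
    fix z
    have "(\<integral>\<^sup>+x. ennreal ((F x z)\<^sup>2 * \<rho> z) \<partial>lborel) = (\<integral>\<^sup>+x. ennreal ((F x z)\<^sup>2) \<partial>lborel) * ennreal (\<rho> z)"
      using Fz[of z] r(2)[of z] by (simp add: ennreal_mult nn_integral_multc)
    also have "\<dots> \<le> ennreal c * ennreal (\<rho> z)"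
      using bd[of z] by (cases "\<rho> z = 0") (auto intro: mult_right_mono)
    finally show "(\<integral>\<^sup>+x. ennreal ((F x z)\<^sup>2 * \<rho> z) \<partial>lborel) \<le> ennreal c * ennreal (\<rho> z)" .
  qed
  also have "\<dots> = ennreal c * (\<integral>\<^sup>+z. ennreal (\<rho> z) \<partial>lborel)"
    using r(1) by (intro nn_integral_cmult) auto
  also have "(\<integral>\<^sup>+z. ennreal (\<rho> z) \<partial>lborel) = (\<integral>\<^sup>+z. ennreal (\<rho> z) \<partial>lebesgue)"
    by (rule nn_integral_completion[symmetric])
  also have "\<dots> = 1" using nn_integral_eq_integral[OF r(3)] r(2,4) by simp
  finally have "(\<integral>\<^sup>+x. ennreal ((norm (\<integral>z. F x z * \<rho> z \<partial>lebesgue))\<^sup>2) \<partial>lebesgue) \<le> ennreal c" by simp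
  from L2_I_nn[OF m this c]
  show "L2 (\<lambda>x. \<integral>z. F x z * \<rho> z \<partial>lebesgue)" "sqnorm (\<lambda>x. \<integral>z. F x z * \<rho> z \<partial>lebesgue) \<le> c" .
qed

lemma L2_indicator_cball: "L2 (indicator (cball 0 R) :: 'a::euclidean_space \<Rightarrow> real)"
  by (rule L2_bounded_support[of _ 1 "cball 0 R"])
     (auto split: split_indicator intro!: borel_measurable_indicator sets_completionI_sets)

lemma mollifier_exists:
  assumes r: "r > 0"
  obtains \<rho> :: "'a::euclidean_space \<Rightarrow> real" where "continuous_on UNIV \<rho>" "\<And>z. 0 \<le> \<rho> z"
    "\<And>z. \<rho> z \<noteq> 0 \<Longrightarrow> norm z \<le> r" "L2 \<rho>" "integrable lebesgue \<rho>" "(\<integral>z. \<rho> z \<partial>lebesgue) = 1"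
proof -
  define k where "k z = max 0 (1 - norm z / r)" for z :: 'a
  have kc: "continuous_on UNIV k" unfolding k_def using r by (intro continuous_intros) auto
  have ks: "k z = 0" if "norm z > r" for z using that r by (simp add: k_def max_def field_simps)
  have k01: "0 \<le> k z" "k z \<le> 1" for z using r by (auto simp: k_def)
  have Lk: "L2 k"
    by (rule L2_bounded_support[of _ 1 "cball 0 r"]) (use k01 ks in \<open>auto simp: continuous_lebesgue_measurable[OF kc]\<close>)
  have "integrable lebesgue (\<lambda>z. k z * indicator (cball 0 r) z)"
    by (rule L2_mult_integrable[OF Lk L2_indicator_cball])
  moreover have "(\<lambda>z. k z * indicator (cball 0 r) z) = k" using ks by (auto split: split_indicator simp: fun_eq_iff)
  ultimately have ik: "integrable lebesgue k" by simp
  have pos: "(\<integral>z. k z \<partial>lebesgue) > 0"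
  proof -
    have "0 < (1/2) * measure lebesgue (cball (0::'a) (r/2))"
      using content_cball_pos[of "r/2" "0::'a"] r by simp
    also have "\<dots> = (\<integral>z. (1/2) * indicator (cball (0::'a) (r/2)) z \<partial>lebesgue)" by simp
    also have "\<dots> \<le> (\<integral>z. k z \<partial>lebesgue)"
    proof (rule integral_mono[OF _ ik])
      have "integrable lebesgue (\<lambda>z::'a. indicator (cball 0 (r/2)) z * indicator (cball 0 (r/2)) z :: real)"
        by (rule L2_mult_integrable[OF L2_indicator_cball L2_indicator_cball])
      then show "integrable lebesgue (\<lambda>z::'a. 1 / 2 * indicator (cball 0 (r/2)) z :: real)"
        by (intro integrable_mult_right) (simp add: indicator_inter_arith[symmetric])
      show "1 / 2 * indicator (cball 0 (r/2)) z \<le> k z" for z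
        using r k01(1)[of z] by (auto simp: k_def field_simps split: split_indicator)
    qed
    finally show ?thesis .
  qed
  define I where "I = (\<integral>z. k z \<partial>lebesgue)"
  have I: "I > 0" using pos by (simp add: I_def)
  show thesis
  proof (rule that[of "\<lambda>z. inverse I * k z"])
    show "continuous_on UNIV (\<lambda>z. inverse I * k z)" by (intro continuous_intros kc)
    show "0 \<le> inverse I * k z" for z using I k01 by simp
    show "norm z \<le> r" if "inverse I * k z \<noteq> 0" for z using ks[of z] that by (cases "norm z > r") auto
    show "L2 (\<lambda>z. inverse I * k z)" by (rule L2_cmult[OF Lk])
    show "integrable lebesgue (\<lambda>z. inverse I * k z)" by (intro integrable_mult_right ik)
    show "(\<integral>z. inverse I * k z \<partial>lebesgue) = 1" using I by (simp add: I_def[symmetric])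
  qed
qed

lemma L2_borel_version:
  assumes "f \<in> borel_measurable lebesgue"
  obtains g :: "'a::euclidean_space \<Rightarrow> real" where "g \<in> borel_measurable borel" "AE x in lebesgue. f x = g x"
proof -
  obtain g where g: "g \<in> borel_measurable lborel" "AE x in lborel. f x = g x"
    using completion_ex_borel_measurable_real[OF assms] by blast
  show thesis by (rule that[OF _ AE_completion[OF g(2)]]) (use g(1) in simp)
qed

text \<open>The average \<open>s\<close> of translates of \<open>u\<close> against a mollifier is continuous. Differences of \<open>s\<close> are
  averages of differences of \<open>u\<close>, so \<open>s\<close> has at most the energy of \<open>u\<close>; and \<open>s - u\<close> is an average of
  differences over shifts of length at most \<open>r\<close>.\<close>

lemma continuous_approximation:
  fixes u :: "'a::euclidean_space \<Rightarrow> real"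
  assumes u0: "has_H1_gradient u g" and r: "r > 0"
  obtains s where "continuous_on UNIV s" "s \<in> H1" "sqnorm (grad s) \<le> sqnorm g" "sqnorm (\<lambda>x. s x - u x) \<le> r\<^sup>2 * sqnorm g"
proof -
  \<comment> \<open>With a Borel version the function \<open>(x, z) \<mapsto> v (x + z)\<close> is measurable on the product space.\<close>
  obtain v where vm: "v \<in> borel_measurable borel" and vu: "AE x in lebesgue. u x = v x"
    using L2_borel_version[OF L2_measurable[OF gradient_L2(1)[OF u0]]] by blast
  have v: "has_H1_gradient v g" by (rule gradient_cong_AE[OF u0 vu borel_lebesgue_measurable[OF vm]])
  note L = gradient_L2[OF v]
  obtain \<rho> :: "'a \<Rightarrow> real" where \<rho>: "continuous_on UNIV \<rho>" "\<And>z. 0 \<le> \<rho> z"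
    "\<And>z. \<rho> z \<noteq> 0 \<Longrightarrow> norm z \<le> r" "L2 \<rho>" "integrable lebesgue \<rho>" "(\<integral>z. \<rho> z \<partial>lebesgue) = 1"
    using mollifier_exists[OF r] by blast
  have \<rho>m: "\<rho> \<in> borel_measurable borel" by (rule borel_measurable_continuous_onI[OF \<rho>(1)])
  define s where "s x = (\<integral>z. v (x + z) * \<rho> z \<partial>lebesgue)" for x
  have Lx: "L2 (\<lambda>z. v (x + z))" for x using L2_shift[OF L(1), of x] by (simp add: add.commute)
  have int: "integrable lebesgue (\<lambda>z. v (x + z) * \<rho> z)" for x by (rule L2_mult_integrable[OF Lx \<rho>(4)])
  have nn: "(\<integral>\<^sup>+x. ennreal ((v (x + a) - v (x + b))\<^sup>2) \<partial>lborel) = ennreal (sqnorm (\<lambda>x. v (x + (a - b)) - v x))" for a b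
  proof -
    have Ld: "L2 (\<lambda>x. v (x + (a - b)) - v x)" by (intro L2_diff L2_shift L)
    have "(\<integral>\<^sup>+x. ennreal ((v (x + a) - v (x + b))\<^sup>2) \<partial>lborel) = (\<integral>\<^sup>+x. ennreal ((norm (v (x + b + (a - b)) - v (x + b)))\<^sup>2) \<partial>lebesgue)"
      unfolding nn_integral_completion by simp
    also have "\<dots> = ennreal (sqnorm (\<lambda>x. v (x + b + (a - b)) - v (x + b)))"
      by (rule nn_sqnorm[OF L2_shift[OF Ld, of b]])
    also have "\<dots> = ennreal (sqnorm (\<lambda>x. v (x + (a - b)) - v x))"
      using sqnorm_shift[OF Ld, of b] by simp
    finally show ?thesis .
  qed
  have su: "L2 (\<lambda>x. s x - v x)" "sqnorm (\<lambda>x. s x - v x) \<le> r\<^sup>2 * sqnorm g"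
  proof -
    have e: "s x - v x = (\<integral>z. (v (x + z) - v x) * \<rho> z \<partial>lebesgue)" for x
    proof -
      have "(\<integral>z. (v (x + z) - v x) * \<rho> z \<partial>lebesgue) = (\<integral>z. v (x + z) * \<rho> z - v x * \<rho> z \<partial>lebesgue)"
        by (simp add: left_diff_distrib)
      also have "\<dots> = s x - v x * 1"
        unfolding s_def \<rho>(6)[symmetric] using int \<rho>(5) by simp
      finally show ?thesis by simp
    qed
    have b: "(\<integral>\<^sup>+x. ennreal ((v (x + z) - v x)\<^sup>2) \<partial>lborel) \<le> ennreal (r\<^sup>2 * sqnorm g)" if "\<rho> z \<noteq> 0" for z
    proof -
      have "sqnorm (\<lambda>x. v (x + z) - v x) \<le> sqnorm (\<lambda>x. g x \<bullet> z)" by (rule gradient_bounds_difference[OF v])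
      also have "\<dots> \<le> (norm z)\<^sup>2 * sqnorm g" by (rule sqnorm_component_le[OF L(2)])
      also have "\<dots> \<le> r\<^sup>2 * sqnorm g" using \<rho>(3)[OF that] by (intro mult_right_mono power_mono) auto
      finally show ?thesis using nn[of z 0] by (simp add: ennreal_leI)
    qed
    have m: "(\<lambda>(x, z). v (x + z) - v x) \<in> borel_measurable (lborel \<Otimes>\<^sub>M lborel)" using vm by measurable
    show "L2 (\<lambda>x. s x - v x)" "sqnorm (\<lambda>x. s x - v x) \<le> r\<^sup>2 * sqnorm g"
      unfolding e using averaging_L2[OF m \<rho>m \<rho>(2,5,6) b] by auto
  qed
  have Ls: "L2 s" using L2_add[OF su(1) L(1)] by simp
  have quot: "sqnorm (\<lambda>x. s (x + h *\<^sub>R b) - s x) \<le> h\<^sup>2 * sqnorm (\<lambda>x. g x \<bullet> b)" for b h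
  proof -
    have e: "s (x + h *\<^sub>R b) - s x = (\<integral>z. (v (x + h *\<^sub>R b + z) - v (x + z)) * \<rho> z \<partial>lebesgue)" for x
      unfolding s_def left_diff_distrib using int by simp
    have b: "(\<integral>\<^sup>+x. ennreal ((v (x + h *\<^sub>R b + z) - v (x + z))\<^sup>2) \<partial>lborel) \<le> ennreal (h\<^sup>2 * sqnorm (\<lambda>x. g x \<bullet> b))" for z
    proof -
      have "sqnorm (\<lambda>x. v (x + h *\<^sub>R b) - v x) \<le> h\<^sup>2 * sqnorm (\<lambda>x. g x \<bullet> b)"
        using gradient_bounds_difference[OF v, of "h *\<^sub>R b"] sqnorm_rmult[of h "\<lambda>x. g x \<bullet> b"] by simp
      then show ?thesis using nn[of "h *\<^sub>R b + z" z] by (simp add: ennreal_leI add.assoc)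
    qed
    have m: "(\<lambda>(x, z). v (x + h *\<^sub>R b + z) - v (x + z)) \<in> borel_measurable (lborel \<Otimes>\<^sub>M lborel)" using vm by measurable
    show ?thesis unfolding e by (rule averaging_L2(2)[OF m \<rho>m \<rho>(2,5,6) b]) simp
  qed
  obtain g' where g': "has_H1_gradient s g'" "sqnorm g' \<le> (\<Sum>b\<in>Basis. sqnorm (\<lambda>x. g x \<bullet> b))"
    using gradient_of_bounded_quotients[OF Ls quot] by metis
  have cont: "continuous_on UNIV s"
  proof -
    obtain B where B: "B > 0" "\<And>x. \<bar>\<rho> x\<bar> \<le> B"
      by (rule continuous_bounded_support[OF \<rho>(1), of r]) (use \<rho>(3) in \<open>auto simp: not_le[symmetric]\<close>)
    have s': "s x = (\<integral>y. v y * \<rho> (y - x) \<partial>lebesgue)" for x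
    proof -
      have "(\<lambda>y. v y * \<rho> (y - x)) \<in> borel_measurable lebesgue"
        using vm \<rho>m by (intro borel_lebesgue_measurable borel_measurable_times measurable_compose[OF _ \<rho>m]) auto
      from integral_shift[OF this, of x] show ?thesis by (simp add: s_def add.commute)
    qed
    have "isCont s x" for x
      unfolding continuous_at_sequentially comp_def
    proof (intro allI impI)
      fix X :: "nat \<Rightarrow> 'a" assume X: "X \<longlonglongrightarrow> x"
      obtain K where K: "K > 0" "\<And>n. norm (X n) \<le> K"
        using convergent_imp_Bseq[OF convergentI[OF X]] by (auto simp: Bseq_def)
      show "(\<lambda>n. s (X n)) \<longlonglongrightarrow> s x"
        unfolding s'
      proof (rule integral_dominated_convergence[where w = "\<lambda>y. B * \<bar>v y * indicator (cball 0 (K + r)) y\<bar>"])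
        show "integrable lebesgue (\<lambda>y. B * \<bar>v y * indicator (cball 0 (K + r)) y\<bar>)"
          by (intro integrable_mult_right integrable_abs L2_mult_integrable L L2_indicator_cball)
        show "AE y in lebesgue. (\<lambda>n. v y * \<rho> (y - X n)) \<longlonglongrightarrow> v y * \<rho> (y - x)"
          by (intro AE_I2 tendsto_mult_left continuous_on_tendsto_compose[OF \<rho>(1)] tendsto_intros X) auto
        show "AE y in lebesgue. norm (v y * \<rho> (y - X n)) \<le> B * \<bar>v y * indicator (cball 0 (K + r)) y\<bar>" for n
        proof (rule AE_I2)
          fix y
          show "norm (v y * \<rho> (y - X n)) \<le> B * \<bar>v y * indicator (cball 0 (K + r)) y\<bar>"
          proof (cases "\<rho> (y - X n) = 0")
            case False
            then have "norm (y - X n) \<le> r" by (rule \<rho>(3))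
            then have "norm y \<le> K + r" using K(2)[of n] norm_triangle_sub[of y "X n"] by linarith
            then show ?thesis using mult_left_mono[OF B(2)[of "y - X n"], of "\<bar>v y\<bar>"]
              by (simp add: abs_mult mult.commute)
          qed (use B in simp)
        qed
      qed (use vm \<rho>m in \<open>auto intro!: borel_lebesgue_measurable\<close>)
    qed
    then show ?thesis by (simp add: continuous_on_eq_continuous_at)
  qed
  show thesis
  proof (rule that[OF cont H1I[OF g'(1)]])
    show "sqnorm (grad s) \<le> sqnorm g"
      unfolding sqnorm_grad[OF g'(1)] using g'(2) L2_from_components(2)[OF L2_component[OF L(2)]] by simp
    have "sqnorm (\<lambda>x. s x - u x) = sqnorm (\<lambda>x. s x - v x)"
      by (rule sqnorm_cong_AE) (use vu L2_measurable[OF gradient_L2(1)[OF u0]] L2_measurable[OF Ls] L2_measurable[OF L(1)] in auto)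
    then show "sqnorm (\<lambda>x. s x - u x) \<le> r\<^sup>2 * sqnorm g" using su(2) by simp
  qed
qed

text \<open>The averages converge in \<open>L\<^sup>2\<close> with bounded energy only; \<open>energy_midpoint\<close> upgrades the
  convergence.\<close>

lemma continuous_dense_H1:
  fixes u :: "'a::euclidean_space \<Rightarrow> real"
  assumes u: "u \<in> H1"
  obtains w where "\<And>n. w n \<in> H1" "\<And>n. continuous_on UNIV (w n)" "(\<lambda>n. H1_sqnorm (\<lambda>x. w n x - u x)) \<longlonglongrightarrow> 0"
proof -
  define K where "K = {v \<in> H1. continuous_on UNIV (v :: 'a \<Rightarrow> real)}"
  have "\<exists>s. s \<in> K \<and> sqnorm (grad s) \<le> sqnorm (grad u) \<and> sqnorm (\<lambda>x. s x - u x) \<le> (inverse (real (Suc n)))\<^sup>2 * sqnorm (grad u)" for n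
    using continuous_approximation[OF gradient_grad[OF u], of "inverse (real (Suc n))"] unfolding K_def by auto
  then obtain z where z: "\<And>n. z n \<in> K" "\<And>n. sqnorm (grad (z n)) \<le> sqnorm (grad u)"
    "\<And>n. sqnorm (\<lambda>x. z n x - u x) \<le> (inverse (real (Suc n)))\<^sup>2 * sqnorm (grad u)" by metis
  have "(\<lambda>n. (inverse (real (Suc n)))\<^sup>2 * sqnorm (grad u)) \<longlonglongrightarrow> 0\<^sup>2 * sqnorm (grad u)"
    by (intro tendsto_intros LIMSEQ_inverse_real_of_nat)
  then have lim: "L2_tendsto z u"
    by (intro Lim_null_comparison[of "\<lambda>n. sqnorm (\<lambda>x. z n x - u x)"]) (use z(3) in auto)
  obtain w where w: "\<And>n. w n \<in> K" "(\<lambda>n. H1_sqnorm (\<lambda>x. w n x - u x)) \<longlonglongrightarrow> 0"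
  proof (rule energy_midpoint[of K z "sqnorm (grad u)" u, OF _ _ z(1,2) H1_L2[OF u] lim])
    show "(\<lambda>x. (1/2) * (a x + b x)) \<in> K" if "a \<in> K" "b \<in> K" for a b
      using that unfolding K_def
      by (intro CollectI conjI H1_cmult[of _ "1/2"] H1_add continuous_intros) auto
  qed (auto simp: K_def)
  then show thesis using that[of w] by (auto simp: K_def)
qed

section \<open>Quasi-continuous representatives\<close>

text \<open>The constants are chosen so that consecutive members of the subsequence are within \<open>(1/8)\<^sup>n\<close>, as
  \<open>quasi_continuous_limit\<close> demands.\<close>

lemma quasi_continuous_H1_limit:
  fixes v :: "nat \<Rightarrow> 'a::euclidean_space \<Rightarrow> real"
  assumes v: "\<And>n. v n \<in> H1" "\<And>n. quasi_continuous (v n)" and u: "u \<in> H1"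
    and lim: "(\<lambda>n. H1_sqnorm (\<lambda>x. v n x - u x)) \<longlonglongrightarrow> 0"
  obtains r where "strict_mono (r :: nat \<Rightarrow> nat)" "quasi_continuous (\<lambda>x. lim (\<lambda>n. v (r n) x))"
    "AE x in lebesgue. lim (\<lambda>n. v (r n) x) = u x"
proof -
  \<comment> \<open>The distance from the limit is inserted as a distance between indices that ignores the second one.\<close>
  have "\<exists>N. \<forall>m\<ge>N. \<forall>n\<ge>N. H1_sqnorm (\<lambda>x. v m x - u x) < e" if e: "e > 0" for e :: real
  proof -
    obtain N where "\<forall>n\<ge>N. norm (H1_sqnorm (\<lambda>x. v n x - u x) - 0) < e" using LIMSEQ_D[OF lim e] by blast
    then have "H1_sqnorm (\<lambda>x. v m x - u x) < e" if "m \<ge> N" for m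
      using that abs_ge_self[of "H1_sqnorm (\<lambda>x. v m x - u x)"] by fastforce
    then show ?thesis by blast
  qed
  then obtain r where r: "strict_mono r" "\<And>n m. n \<le> m \<Longrightarrow> H1_sqnorm (\<lambda>x. v (r m) x - u x) \<le> (1/8)^n / 4"
    using fast_subseq[of "\<lambda>m n. H1_sqnorm (\<lambda>x. v m x - u x)" "\<lambda>n. (1/8)^n / 4"] by auto
  have fast: "H1_sqnorm (\<lambda>x. v (r (Suc n)) x - v (r n) x) \<le> (1/8) ^ n" for n
  proof -
    have "H1_sqnorm (\<lambda>x. v (r (Suc n)) x - v (r n) x)
      \<le> 2 * H1_sqnorm (\<lambda>x. v (r (Suc n)) x - u x) + 2 * H1_sqnorm (\<lambda>x. u x - v (r n) x)"
      by (rule H1_sqnorm_diff_triangle[OF v(1) u v(1)])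
    also have "\<dots> \<le> 2 * ((1/8)^n / 4) + 2 * ((1/8)^n / 4)"
      using r(2)[of n "Suc n"] r(2)[of n n] unfolding H1_sqnorm_diff_commute[OF u v(1)] by (intro add_mono mult_left_mono) auto
    finally show ?thesis by simp
  qed
  note q = quasi_continuous_limit[of "\<lambda>n. v (r n)", OF v(1) v(2) fast]
  have "AE x in lebesgue. (\<lambda>n. v (r n) x) \<longlonglongrightarrow> u x"
  proof (rule fast_L2_limit_AE[of _ _ 1])
    show "L2 (v (r n))" for n by (rule H1_L2[OF v(1)])
    show "L2 u" by (rule H1_L2[OF u])
    fix n
    have "sqnorm (\<lambda>x. v (r n) x - u x) \<le> H1_sqnorm (\<lambda>x. v (r n) x - u x)" by (simp add: H1_sqnorm_def)
    also have "\<dots> \<le> (1/8)^n / 4" by (rule r(2)) simp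
    also have "\<dots> \<le> (1/4)^n"
    proof -
      have "(1/8::real)^n / 4 \<le> (1/8)^n" by simp
      also have "\<dots> \<le> (1/4)^n" by (intro power_mono) auto
      finally show ?thesis .
    qed
    finally show "sqnorm (\<lambda>x. v (r n) x - u x) \<le> 1 * (1/4)^n" by simp
  qed
  then have "AE x in lebesgue. lim (\<lambda>n. v (r n) x) = u x" by eventually_elim (rule limI)
  then show thesis using that[OF r(1) q] by simp
qed

lemma qc_rep_exists:
  fixes u :: "'a::euclidean_space \<Rightarrow> real"
  assumes u: "u \<in> H1"
  shows "quasi_continuous (qc_rep u)" "qc_rep u \<in> borel_measurable borel" "AE x in lebesgue. qc_rep u x = u x"
proof -
  obtain w where w: "\<And>n. w n \<in> H1" "\<And>n. continuous_on UNIV (w n)" "(\<lambda>n. H1_sqnorm (\<lambda>x. w n x - u x)) \<longlonglongrightarrow> 0"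
    using continuous_dense_H1[OF u] by blast
  obtain r where r: "quasi_continuous (\<lambda>x. lim (\<lambda>n. w (r n) x))" "AE x in lebesgue. lim (\<lambda>n. w (r n) x) = u x"
    using quasi_continuous_H1_limit[of w, OF w(1) continuous_imp_quasi_continuous[OF w(2)] u w(3)] by blast
  have "(\<lambda>x. lim (\<lambda>n. w (r n) x)) \<in> borel_measurable borel"
    using borel_measurable_continuous_onI[OF w(2)] by (intro borel_measurable_lim_metric)
  with r have "\<exists>v. quasi_continuous v \<and> v \<in> borel_measurable borel \<and> (AE x in lebesgue. v x = u x)" by blast
  from someI_ex[OF this]
  show "quasi_continuous (qc_rep u)" "qc_rep u \<in> borel_measurable borel" "AE x in lebesgue. qc_rep u x = u x"
    unfolding qc_rep_def by auto
qed

lemma quasi_continuous_AE_eq: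
  assumes "quasi_continuous v" "quasi_continuous w" "AE x in lebesgue. v x = w x"
  shows "cap {x. v x \<noteq> w x} = 0"
proof -
  have "cap {x. v x - w x \<noteq> 0} = 0"
    by (rule quasi_continuous_AE_zero[OF quasi_continuous_diff[OF assms(1,2)]]) (use assms(3) in auto)
  then show ?thesis by simp
qed

section \<open>Sobolev functions vanishing quasi-everywhere outside a set\<close>

text \<open>The space \<open>H\<^sup>1\<^sub>0(\<Omega>)\<close>, by its quasi-everywhere characterization.\<close>

definition H10 :: "'a::euclidean_space set \<Rightarrow> ('a \<Rightarrow> real) set" where
  "H10 \<Omega> = {u \<in> H1. cap ({x. qc_rep u x \<noteq> 0} - \<Omega>) = 0}"

text \<open>Any quasi-continuous representative may be used to test membership, by uniqueness
  quasi-everywhere.\<close>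

lemma H10I:
  assumes "u \<in> H1" "quasi_continuous v" "AE x in lebesgue. v x = u x" "cap ({x. v x \<noteq> 0} - \<Omega>) = 0"
  shows "u \<in> H10 \<Omega>"
proof -
  note q = qc_rep_exists[OF assms(1)]
  have "AE x in lebesgue. qc_rep u x = v x" using q(3) assms(3) by eventually_elim simp
  then have "cap {x. qc_rep u x \<noteq> v x} = 0" by (rule quasi_continuous_AE_eq[OF q(1) assms(2)])
  then have "cap ({x. qc_rep u x \<noteq> v x} \<union> ({x. v x \<noteq> 0} - \<Omega>)) = 0" using assms(4) by (rule cap_null_Un)
  then have "cap ({x. qc_rep u x \<noteq> 0} - \<Omega>) = 0" by (rule cap_null_subset) auto
  then show ?thesis using assms(1) by (simp add: H10_def)
qed

text \<open>The strong approximation from \<open>energy_midpoint\<close> stays in the space; its representatives vanish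
  quasi-everywhere outside \<open>\<Omega>\<close>, and so does the pointwise limit of a subsequence, which is a
  quasi-continuous representative of \<open>u\<close>.\<close>

lemma H10_lower_semicontinuity:
  fixes z :: "nat \<Rightarrow> 'a::euclidean_space \<Rightarrow> real"
  assumes z: "\<And>n. z n \<in> H10 \<Omega>" "\<And>n. sqnorm (grad (z n)) \<le> M"
    and u: "L2 u" and lim: "L2_tendsto z u"
  shows "u \<in> H10 \<Omega>" "sqnorm (grad u) \<le> M"
proof -
  have H: "v \<in> H10 \<Omega> \<Longrightarrow> v \<in> H1" for v by (simp add: H10_def)
  obtain w where w: "\<And>n. w n \<in> H10 \<Omega>" "u \<in> H1" "sqnorm (grad u) \<le> M" "(\<lambda>n. H1_sqnorm (\<lambda>x. w n x - u x)) \<longlonglongrightarrow> 0"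
  proof (rule energy_midpoint[of "H10 \<Omega>" z M u, OF _ _ z u lim])
    show "v \<in> H1" if "v \<in> H10 \<Omega>" for v by (rule H[OF that])
    fix a b assume ab: "a \<in> H10 \<Omega>" "b \<in> H10 \<Omega>"
    note qa = qc_rep_exists[OF H[OF ab(1)]] and qb = qc_rep_exists[OF H[OF ab(2)]]
    show "(\<lambda>x. (1/2) * (a x + b x)) \<in> H10 \<Omega>"
    proof (rule H10I)
      show "(\<lambda>x. (1/2) * (a x + b x)) \<in> H1" by (intro H1_cmult[of _ "1/2"] H1_add H ab)
      show "quasi_continuous (\<lambda>x. (1/2) * qc_rep a x + (1/2) * qc_rep b x)"
        by (rule quasi_continuous_lincomb[OF qa(1) qb(1)])
      show "AE x in lebesgue. (1/2) * qc_rep a x + (1/2) * qc_rep b x = (1/2) * (a x + b x)"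
        using qa(3) qb(3) by eventually_elim simp
      have "cap (({x. qc_rep a x \<noteq> 0} - \<Omega>) \<union> ({x. qc_rep b x \<noteq> 0} - \<Omega>)) = 0"
        using ab by (intro cap_null_Un) (auto simp: H10_def)
      then show "cap ({x. (1/2) * qc_rep a x + (1/2) * qc_rep b x \<noteq> 0} - \<Omega>) = 0"
        by (rule cap_null_subset) auto
    qed
  qed (rule that; assumption)
  show "sqnorm (grad u) \<le> M" by (rule w(3))
  define v where "v n = qc_rep (w n)" for n
  note q = qc_rep_exists[OF H[OF w(1)], folded v_def]
  have vw: "AE x in lebesgue. w n x = v n x" for n using q(3)[of n] by eventually_elim simp
  have v1: "v n \<in> H1" for n by (rule H1_cong_AE[OF H[OF w(1)] vw borel_lebesgue_measurable[OF q(2)]])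
  have "H1_sqnorm (\<lambda>x. v n x - u x) = H1_sqnorm (\<lambda>x. w n x - u x)" for n
  proof -
    have gv: "has_H1_gradient (v n) (grad (w n))"
      by (rule gradient_cong_AE[OF gradient_grad[OF H[OF w(1)]] vw borel_lebesgue_measurable[OF q(2)]])
    have "sqnorm (\<lambda>x. v n x - u x) = sqnorm (\<lambda>x. w n x - u x)"
      by (rule sqnorm_cong_AE)
         (use q(3)[of n] L2_measurable[OF H1_L2[OF v1]] L2_measurable[OF H1_L2[OF w(2)]] L2_measurable[OF H1_L2[OF H[OF w(1)]]] in auto)
    then show ?thesis
      unfolding H1_sqnorm_gradient[OF gradient_diff[OF gv gradient_grad[OF w(2)]]]
        H1_sqnorm_gradient[OF gradient_diff[OF gradient_grad[OF H[OF w(1)]] gradient_grad[OF w(2)]]] by simp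
  qed
  with w(4) have "(\<lambda>n. H1_sqnorm (\<lambda>x. v n x - u x)) \<longlonglongrightarrow> 0" by simp
  then obtain r where r: "quasi_continuous (\<lambda>x. lim (\<lambda>n. v (r n) x))"
    "AE x in lebesgue. lim (\<lambda>n. v (r n) x) = u x"
    using quasi_continuous_H1_limit[of v u, OF v1 q(1) w(2)] by blast
  show "u \<in> H10 \<Omega>"
  proof (rule H10I[OF w(2) r(1,2)])
    have "cap ({x. v n x \<noteq> 0} - \<Omega>) = 0" for n using w(1)[of n] by (simp add: H10_def v_def)
    then have "cap (\<Union>n. {x. v n x \<noteq> 0} - \<Omega>) = 0" by (rule cap_null_UN)
    then show "cap ({x. lim (\<lambda>n. v (r n) x) \<noteq> 0} - \<Omega>) = 0"
    proof (rule cap_null_subset)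
      show "{x. lim (\<lambda>n. v (r n) x) \<noteq> 0} - \<Omega> \<subseteq> (\<Union>n. {x. v n x \<noteq> 0} - \<Omega>)"
      proof (rule subsetI, rule ccontr)
        fix x assume x: "x \<in> {x. lim (\<lambda>n. v (r n) x) \<noteq> 0} - \<Omega>" "x \<notin> (\<Union>n. {x. v n x \<noteq> 0} - \<Omega>)"
        then have "v (r n) x = 0" for n by auto
        then have "lim (\<lambda>n. v (r n) x) = 0" by simp
        with x(1) show False by simp
      qed
    qed
  qed
qed

section \<open>The measure of a potential\<close>

lemma borel_imp_lebesgue: "E \<in> sets borel \<Longrightarrow> E \<in> sets lebesgue"
  by (rule sets_completionI_sets) simp

text \<open>The absolutely continuous part lives on the Lebesgue sets, since \<open>V\<close> is only Lebesgue measurable.\<close>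

definition potential_density :: "'a::euclidean_space set \<Rightarrow> ('a \<Rightarrow> ennreal) \<Rightarrow> 'a measure" where
  "potential_density \<Omega> V = density lebesgue (\<lambda>x. V x * indicator \<Omega> x)"

lemma potential_density_measurable:
  fixes \<Omega> :: "'a::euclidean_space set" and V :: "'a \<Rightarrow> ennreal"
  assumes "open \<Omega>" "V \<in> borel_measurable (lebesgue_on \<Omega>)"
  shows "(\<lambda>x. V x * indicator \<Omega> x) \<in> borel_measurable lebesgue"
  using assms(2) borel_measurable_restrict_space_iff_ennreal[of \<Omega> lebesgue V]
    borel_imp_lebesgue[OF borel_open[OF assms(1)]] by simp

lemma emeasure_potential_density:
  assumes "open \<Omega>" "V \<in> borel_measurable (lebesgue_on \<Omega>)" "E \<in> sets lebesgue"
  shows "emeasure (potential_density \<Omega> V) E = (\<integral>\<^sup>+x\<in>E \<inter> \<Omega>. V x \<partial>lebesgue)"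
  unfolding potential_density_def
  by (subst emeasure_density[OF potential_density_measurable[OF assms(1,2)] assms(3)])
     (auto intro!: nn_integral_cong split: split_indicator)

lemma sets_potential_measure: "sets (potential_measure \<Omega> V) = sets borel"
  unfolding potential_measure_def using sets.sets_measure_of_eq[of borel] by simp

text \<open>The set function that defines the measure is countably additive: its second summand is so because
  countable unions of sets of zero capacity have zero capacity.\<close>

lemma emeasure_potential_measure:
  assumes O: "open \<Omega>" "V \<in> borel_measurable (lebesgue_on \<Omega>)" and E: "E \<in> sets borel"
  shows "emeasure (potential_measure \<Omega> V) E = (\<integral>\<^sup>+x\<in>E \<inter> \<Omega>. V x \<partial>lebesgue) + I_dom \<Omega> E"
proof (rule emeasure_measure_of[OF potential_measure_def])
  show "sets borel \<subseteq> Pow (UNIV :: 'a set)" by simp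
  show "positive (sets (potential_measure \<Omega> V)) (\<lambda>E. (\<integral>\<^sup>+x\<in>E \<inter> \<Omega>. V x \<partial>lebesgue) + I_dom \<Omega> E)"
    unfolding positive_def by (simp add: I_dom_def cap_empty)
  show "E \<in> sets (potential_measure \<Omega> V)" using E by (simp add: sets_potential_measure)
  show "countably_additive (sets (potential_measure \<Omega> V)) (\<lambda>E. (\<integral>\<^sup>+x\<in>E \<inter> \<Omega>. V x \<partial>lebesgue) + I_dom \<Omega> E)"
    unfolding countably_additive_def sets_potential_measure
  proof (intro allI impI)
    fix A :: "nat \<Rightarrow> 'a set" assume A: "range A \<subseteq> sets borel" "disjoint_family A" "\<Union> (range A) \<in> sets borel"
    have AL: "A i \<in> sets lebesgue" for i using A(1) by (intro borel_imp_lebesgue) auto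
    have "(\<Sum>i. \<integral>\<^sup>+x\<in>A i \<inter> \<Omega>. V x \<partial>lebesgue) = (\<Sum>i. emeasure (potential_density \<Omega> V) (A i))"
      by (intro suminf_cong emeasure_potential_density[symmetric] O AL)
    also have "\<dots> = emeasure (potential_density \<Omega> V) (\<Union> (range A))"
      using AL A(2) by (intro suminf_emeasure) (auto simp: potential_density_def)
    also have "\<dots> = (\<integral>\<^sup>+x\<in>\<Union> (range A) \<inter> \<Omega>. V x \<partial>lebesgue)"
      by (intro emeasure_potential_density O borel_imp_lebesgue A)
    finally have 1: "(\<Sum>i. \<integral>\<^sup>+x\<in>A i \<inter> \<Omega>. V x \<partial>lebesgue) = (\<integral>\<^sup>+x\<in>\<Union> (range A) \<inter> \<Omega>. V x \<partial>lebesgue)" .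
    have 2: "(\<Sum>i. I_dom \<Omega> (A i)) = I_dom \<Omega> (\<Union> (range A))"
    proof (cases "\<forall>i. cap (A i - \<Omega>) = 0")
      case True
      then have "cap (\<Union>i. A i - \<Omega>) = 0" by (intro cap_null_UN) auto
      moreover have "(\<Union>i. A i - \<Omega>) = \<Union> (range A) - \<Omega>" by auto
      ultimately show ?thesis using True by (simp add: I_dom_def)
    next
      case False
      then obtain i where i: "cap (A i - \<Omega>) \<noteq> 0" by auto
      then have "cap (\<Union> (range A) - \<Omega>) \<noteq> 0" using cap_null_subset[of "\<Union> (range A) - \<Omega>" "A i - \<Omega>"] by auto
      moreover have "I_dom \<Omega> (A i) \<le> (\<Sum>i. I_dom \<Omega> (A i))" by (rule ennreal_le_suminf)
      ultimately show ?thesis using i by (simp add: I_dom_def top_unique)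
    qed
    show "(\<Sum>i. (\<integral>\<^sup>+x\<in>A i \<inter> \<Omega>. V x \<partial>lebesgue) + I_dom \<Omega> (A i)) =
       (\<integral>\<^sup>+x\<in>\<Union> (range A) \<inter> \<Omega>. V x \<partial>lebesgue) + I_dom \<Omega> (\<Union> (range A))"
      unfolding 1[symmetric] 2[symmetric] by (intro suminf_add[symmetric]) auto
  qed
qed

lemma potential_measure_in_Mcap:
  assumes O: "open \<Omega>" "V \<in> borel_measurable (lebesgue_on \<Omega>)"
  shows "potential_measure \<Omega> V \<in> Mcap \<Omega>"
  unfolding Mcap_def capacitary_measure_def
proof (intro CollectI conjI ballI impI)
  show "sets (potential_measure \<Omega> V) = sets borel" by (rule sets_potential_measure)
  show "emeasure (potential_measure \<Omega> V) E = 0" if E: "E \<in> sets borel" "cap E = 0" for E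
  proof -
    have "AE x in lebesgue. x \<notin> E" by (rule AE_not_in[OF cap_null_imp_null[OF E(2)]])
    then have "(\<integral>\<^sup>+x\<in>E \<inter> \<Omega>. V x \<partial>lebesgue) = (\<integral>\<^sup>+x. 0 \<partial>(lebesgue :: 'a measure))"
      by (intro nn_integral_cong_AE) auto
    moreover have "cap (E - \<Omega>) = 0" by (rule cap_null_subset[OF E(2)]) auto
    ultimately show ?thesis unfolding emeasure_potential_measure[OF O E(1)] I_dom_def by simp
  qed
  show "emeasure (potential_measure \<Omega> V) E = \<infinity>" if E: "E \<in> sets borel" "0 < cap (E - \<Omega>)" for E
  proof -
    have "cap (E - \<Omega>) \<noteq> 0" using E(2) by auto
    then show ?thesis unfolding emeasure_potential_measure[OF O E(1)] I_dom_def by simp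
  qed
qed

lemma potential_measure_mono:
  assumes O: "open \<Omega>" "V \<in> borel_measurable (lebesgue_on \<Omega>)" "W \<in> borel_measurable (lebesgue_on \<Omega>)"
    and le: "\<And>x. x \<in> \<Omega> \<Longrightarrow> V x \<le> W x" and E: "E \<in> sets borel"
  shows "emeasure (potential_measure \<Omega> V) E \<le> emeasure (potential_measure \<Omega> W) E"
  unfolding emeasure_potential_measure[OF O(1,2) E] emeasure_potential_measure[OF O(1,3) E]
  by (intro add_right_mono nn_integral_mono) (auto split: split_indicator intro: le)

text \<open>If \<open>f\<close> vanishes quasi-everywhere outside \<open>\<Omega>\<close>, the measure agrees with its absolutely continuous
  part on the Borel subsets of \<open>{f \<noteq> 0}\<close>. Otherwise some set \<open>{f \<ge> 1/(n+1)}\<close> has positive capacity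
  outside \<open>\<Omega>\<close>, hence infinite measure.\<close>

lemma nn_integral_potential_measure:
  assumes O: "open \<Omega>" "V \<in> borel_measurable (lebesgue_on \<Omega>)" and f: "f \<in> borel_measurable borel"
  shows "(\<integral>\<^sup>+x. f x \<partial>potential_measure \<Omega> V) =
    (\<integral>\<^sup>+x\<in>\<Omega>. f x * V x \<partial>lebesgue) + (if cap ({x. f x \<noteq> 0} - \<Omega>) = 0 then 0 else \<infinity>)"
proof (cases "cap ({x. f x \<noteq> 0} - \<Omega>) = 0")
  case True
  define S where "S = {x. f x \<noteq> 0}"
  have S: "S \<in> sets borel"
  proof -
    have "S = f -` (- {0}) \<inter> space borel" by (auto simp: S_def)
    then show ?thesis using f by (metis borel_comp borel_singleton measurable_sets sets.empty_sets)
  qed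
  note sp = sets_eq_imp_space_eq[OF sets_potential_measure[of \<Omega> V]]
  define \<nu> where "\<nu> = distr (potential_density \<Omega> V) borel (\<lambda>x. x)"
  have id: "(\<lambda>x. x) \<in> potential_density \<Omega> V \<rightarrow>\<^sub>M borel"
    unfolding potential_density_def by (intro measurableI) (auto intro: borel_imp_lebesgue)
  have eq: "restrict_space (potential_measure \<Omega> V) S = restrict_space \<nu> S"
  proof (rule measure_eqI)
    show "sets (restrict_space (potential_measure \<Omega> V) S) = sets (restrict_space \<nu> S)"
      by (simp add: sets_restrict_space sets_potential_measure \<nu>_def)
    fix E assume "E \<in> sets (restrict_space (potential_measure \<Omega> V) S)"
    then have E: "E \<in> sets borel" "E \<subseteq> S"
      using S by (auto simp: sets_restrict_space sets_potential_measure)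
    have "cap (E - \<Omega>) = 0" by (rule cap_null_subset[OF True]) (use E(2) in \<open>auto simp: S_def\<close>)
    then have "emeasure (potential_measure \<Omega> V) E = emeasure (potential_density \<Omega> V) E"
      unfolding emeasure_potential_measure[OF O E(1)] emeasure_potential_density[OF O borel_imp_lebesgue[OF E(1)]]
      by (simp add: I_dom_def)
    also have "\<dots> = emeasure \<nu> E"
      unfolding \<nu>_def using emeasure_distr[OF id E(1)] by (simp add: potential_density_def)
    finally show "emeasure (restrict_space (potential_measure \<Omega> V) S) E = emeasure (restrict_space \<nu> S) E"
      using S E by (subst (1 2) emeasure_restrict_space) (auto simp: sets_potential_measure \<nu>_def sp)
  qed
  have fS: "f x * indicator S x = f x" for x by (auto simp: S_def split: split_indicator)
  have "(\<integral>\<^sup>+x. f x \<partial>potential_measure \<Omega> V) = (\<integral>\<^sup>+x. f x \<partial>restrict_space (potential_measure \<Omega> V) S)"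
    using S by (subst nn_integral_restrict_space) (auto simp: sets_potential_measure sp fS)
  also have "\<dots> = (\<integral>\<^sup>+x. f x \<partial>\<nu>)"
    unfolding eq using S by (subst nn_integral_restrict_space) (auto simp: \<nu>_def fS)
  also have "\<dots> = (\<integral>\<^sup>+x. f x \<partial>potential_density \<Omega> V)"
    unfolding \<nu>_def by (rule nn_integral_distr[OF id]) (use f in auto)
  also have "\<dots> = (\<integral>\<^sup>+x. V x * indicator \<Omega> x * f x \<partial>lebesgue)"
    unfolding potential_density_def
    by (rule nn_integral_density[OF potential_density_measurable[OF O]]) (use f in \<open>auto intro: measurable_completion\<close>)
  also have "\<dots> = (\<integral>\<^sup>+x\<in>\<Omega>. f x * V x \<partial>lebesgue)" by (simp add: mult_ac)
  finally show ?thesis using True by simp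
next
  case False
  define S where "S n = {x. ennreal (inverse (real (Suc n))) \<le> f x}" for n
  have Sb: "S n \<in> sets borel" for n
  proof -
    have "S n = f -` {ennreal (inverse (real (Suc n)))..} \<inter> space borel" by (auto simp: S_def)
    then show ?thesis using measurable_sets[OF f, of "{ennreal (inverse (real (Suc n)))..}"] by simp
  qed
  have "{x. f x \<noteq> 0} - \<Omega> \<subseteq> (\<Union>n. S n - \<Omega>)"
  proof
    fix x assume x: "x \<in> {x. f x \<noteq> 0} - \<Omega>"
    then have "0 < f x" by (auto simp: zero_less_iff_neq_zero)
    then obtain d where d: "0 < d" "d < f x" using dense by blast
    then obtain r where r: "d = ennreal r" "0 < r" by (cases d) auto
    obtain n where "inverse (real (Suc n)) < r" using reals_Archimedean[OF r(2)] by blast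
    then have "ennreal (inverse (real (Suc n))) \<le> f x"
      using d r by (meson ennreal_leI less_imp_le order_trans)
    then show "x \<in> (\<Union>n. S n - \<Omega>)" using x by (auto simp: S_def)
  qed
  then have "\<exists>n. cap (S n - \<Omega>) \<noteq> 0"
    using False cap_null_UN[of "\<lambda>n. S n - \<Omega>"] cap_null_subset by blast
  then obtain n where n: "cap (S n - \<Omega>) \<noteq> 0" by blast
  have "emeasure (potential_measure \<Omega> V) (S n) = \<infinity>"
    unfolding emeasure_potential_measure[OF O Sb] using n by (simp add: I_dom_def)
  then have "\<infinity> = ennreal (inverse (real (Suc n))) * emeasure (potential_measure \<Omega> V) (S n)"
    by (simp add: ennreal_mult_top)
  also have "\<dots> = (\<integral>\<^sup>+x. ennreal (inverse (real (Suc n))) * indicator (S n) x \<partial>potential_measure \<Omega> V)"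
    using Sb by (subst nn_integral_cmult_indicator) (auto simp: sets_potential_measure)
  also have "\<dots> \<le> (\<integral>\<^sup>+x. f x \<partial>potential_measure \<Omega> V)"
    by (intro nn_integral_mono) (auto simp: S_def split: split_indicator)
  finally show ?thesis using False by (simp add: top_unique)
qed

section \<open>The energy of a potential\<close>

lemma zero_ext_measurable:
  assumes "open \<Omega>" "u \<in> borel_measurable (lebesgue_on \<Omega>)"
  shows "zero_ext \<Omega> u \<in> borel_measurable lebesgue"
  unfolding zero_ext_def using assms by (intro borel_measurable_if_I borel_imp_lebesgue) auto

lemma nn_integral_zero_ext:
  "(\<integral>\<^sup>+x\<in>\<Omega>. ennreal ((norm (u x))\<^sup>2) \<partial>lebesgue) = (\<integral>\<^sup>+x. ennreal ((norm (zero_ext \<Omega> u x))\<^sup>2) \<partial>lebesgue)"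
  by (intro nn_integral_cong) (auto simp: zero_ext_def split: split_indicator)

lemma L2_zero_ext:
  assumes "open \<Omega>" "L2_on \<Omega> u" shows "L2 (zero_ext \<Omega> u)"
proof -
  have "u \<in> borel_measurable (lebesgue_on \<Omega>)" using assms(2) by (simp add: L2_on_def)
  moreover have "(\<integral>\<^sup>+x. ennreal ((norm (zero_ext \<Omega> u x))\<^sup>2) \<partial>lebesgue) < \<infinity>"
    using assms(2) unfolding nn_integral_zero_ext[symmetric] L2_on_def by blast
  ultimately show ?thesis
    using zero_ext_measurable[OF assms(1), of u] unfolding L2_on_def lebesgue_on_UNIV_eq by simp
qed

lemma L2_lim_zero_ext:
  assumes "open \<Omega>" "L2_lim_on \<Omega> us u"
  shows "(\<lambda>n. sqnorm (\<lambda>x. zero_ext \<Omega> (us n) x - zero_ext \<Omega> u x)) \<longlonglongrightarrow> 0"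
proof -
  have L: "L2 (zero_ext \<Omega> (us n))" "L2 (zero_ext \<Omega> u)" for n
    using assms by (auto simp: L2_lim_on_def intro: L2_zero_ext)
  have "(\<integral>\<^sup>+x\<in>\<Omega>. ennreal ((us n x - u x)\<^sup>2) \<partial>lebesgue) = ennreal (sqnorm (\<lambda>x. zero_ext \<Omega> (us n) x - zero_ext \<Omega> u x))" for n
    unfolding nn_sqnorm[OF L2_diff[OF L], symmetric]
    by (intro nn_integral_cong) (auto simp: zero_ext_def split: split_indicator)
  then have "(\<lambda>n. ennreal (sqnorm (\<lambda>x. zero_ext \<Omega> (us n) x - zero_ext \<Omega> u x))) \<longlonglongrightarrow> 0"
    using assms(2) by (simp add: L2_lim_on_def)
  then show ?thesis by (subst (asm) ennreal_tendsto_0_iff) auto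
qed

text \<open>If the integral against the measure is infinite, the sum is infinite as well, so the case
  distinction in the definition of the energy reduces to membership in \<open>H10 \<Omega>\<close>.\<close>

lemma Q_energy_potential:
  assumes O: "open \<Omega>" "V \<in> borel_measurable (lebesgue_on \<Omega>)"
  shows "Q_energy \<Omega> (potential_measure \<Omega> V) u =
    (if zero_ext \<Omega> u \<in> H10 \<Omega>
     then ennreal (sqnorm (grad (zero_ext \<Omega> u))) + (\<integral>\<^sup>+x\<in>\<Omega>. ennreal ((u x)\<^sup>2) * V x \<partial>lebesgue) else \<infinity>)"
proof (cases "zero_ext \<Omega> u \<in> H1")
  case False
  then show ?thesis by (simp add: Q_energy_def H10_def)
next
  case True
  define z where "z = zero_ext \<Omega> u"
  have z: "z \<in> H1" using True by (simp add: z_def)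
  note q = qc_rep_exists[OF z]
  define J where "J = (\<integral>\<^sup>+x. ennreal ((qc_rep z x)\<^sup>2) \<partial>potential_measure \<Omega> V)"
  have "J = (\<integral>\<^sup>+x\<in>\<Omega>. ennreal ((qc_rep z x)\<^sup>2) * V x \<partial>lebesgue)
      + (if cap ({x. ennreal ((qc_rep z x)\<^sup>2) \<noteq> 0} - \<Omega>) = 0 then 0 else \<infinity>)"
    unfolding J_def using q(2) by (intro nn_integral_potential_measure O) auto
  also have "{x. ennreal ((qc_rep z x)\<^sup>2) \<noteq> 0} = {x. qc_rep z x \<noteq> 0}" by (auto simp: ennreal_eq_0_iff)
  also have "(\<integral>\<^sup>+x\<in>\<Omega>. ennreal ((qc_rep z x)\<^sup>2) * V x \<partial>lebesgue) = (\<integral>\<^sup>+x\<in>\<Omega>. ennreal ((u x)\<^sup>2) * V x \<partial>lebesgue)"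
    by (rule nn_integral_cong_AE) (use q(3) in \<open>eventually_elim, auto simp: z_def zero_ext_def split: split_indicator\<close>)
  finally have J: "J = (\<integral>\<^sup>+x\<in>\<Omega>. ennreal ((u x)\<^sup>2) * V x \<partial>lebesgue) + (if z \<in> H10 \<Omega> then 0 else \<infinity>)"
    using z by (simp add: H10_def)
  have G: "(\<integral>\<^sup>+x. ennreal ((norm (grad z x))\<^sup>2) \<partial>lebesgue) = ennreal (sqnorm (grad z))"
    by (rule nn_sqnorm[OF gradient_L2(2)[OF gradient_grad[OF z]]])
  have "Q_energy \<Omega> (potential_measure \<Omega> V) u = ennreal (sqnorm (grad z)) + J"
    unfolding Q_energy_def z_def[symmetric] J_def[symmetric] G using z by (auto simp: not_less top_unique)
  then show ?thesis unfolding J z_def[symmetric] by simp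
qed

section \<open>Gamma-convergence of potentials\<close>

definition bounded_potential :: "real \<Rightarrow> ('a::euclidean_space \<Rightarrow> real) \<Rightarrow> bool" where
  "bounded_potential k W \<longleftrightarrow> W \<in> borel_measurable lebesgue \<and> (\<forall>x. 0 \<le> W x \<and> W x \<le> k)"

lemma bounded_potential_measurable:
  "bounded_potential k W \<Longrightarrow> (\<lambda>x. ennreal (W x)) \<in> borel_measurable (lebesgue_on \<Omega>)"
  unfolding bounded_potential_def by (intro measurable_restrict_space1) auto

lemma bounded_potential_integrable:
  assumes "bounded_potential k W" "integrable lebesgue f"
  shows "integrable lebesgue (\<lambda>x. f x * W x)" "\<bar>pairing f W\<bar> \<le> k * (\<integral>x. \<bar>f x\<bar> \<partial>lebesgue)"
proof -
  have b: "\<bar>f x * W x\<bar> \<le> k * \<bar>f x\<bar>" for x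
  proof -
    have "\<bar>f x\<bar> * \<bar>W x\<bar> \<le> \<bar>f x\<bar> * k"
      using assms(1) by (intro mult_left_mono) (auto simp: bounded_potential_def)
    then show ?thesis by (simp add: abs_mult mult.commute)
  qed
  have ik: "integrable lebesgue (\<lambda>x. k * \<bar>f x\<bar>)" using assms(2) by auto
  show i: "integrable lebesgue (\<lambda>x. f x * W x)"
    by (rule Bochner_Integration.integrable_bound[OF ik])
       (use assms b in \<open>auto simp: bounded_potential_def intro!: AE_I2 order_trans[OF b]\<close>)
  have "\<bar>pairing f W\<bar> \<le> (\<integral>x. \<bar>f x * W x\<bar> \<partial>lebesgue)" by (rule integral_abs_bound)
  also have "\<dots> \<le> (\<integral>x. k * \<bar>f x\<bar> \<partial>lebesgue)" by (intro integral_mono integrable_abs i ik b)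
  finally show "\<bar>pairing f W\<bar> \<le> k * (\<integral>x. \<bar>f x\<bar> \<partial>lebesgue)" by simp
qed

lemma L2_square_integrable: "L2 z \<Longrightarrow> integrable lebesgue (\<lambda>x. (z x)\<^sup>2)" for z :: "'a::euclidean_space \<Rightarrow> real"
  using L2_integrable[of z] by simp

lemma Q_energy_bounded_potential:
  fixes \<Omega> :: "'a::euclidean_space set"
  assumes O: "open \<Omega>" and W: "bounded_potential k W" and u: "L2_on \<Omega> u"
  shows "Q_energy \<Omega> (potential_measure \<Omega> (\<lambda>x. ennreal (W x))) u =
    (if zero_ext \<Omega> u \<in> H10 \<Omega>
     then ennreal (sqnorm (grad (zero_ext \<Omega> u)) + (\<integral>x. (zero_ext \<Omega> u x)\<^sup>2 * W x \<partial>lebesgue)) else \<infinity>)"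
proof -
  have n: "0 \<le> (zero_ext \<Omega> u x)\<^sup>2 * W x" for x using W by (auto simp: bounded_potential_def)
  have "(\<integral>\<^sup>+x\<in>\<Omega>. ennreal ((u x)\<^sup>2) * ennreal (W x) \<partial>lebesgue) = (\<integral>\<^sup>+x. ennreal ((zero_ext \<Omega> u x)\<^sup>2 * W x) \<partial>lebesgue)"
    using W by (intro nn_integral_cong) (auto simp: bounded_potential_def zero_ext_def ennreal_mult split: split_indicator)
  also have "\<dots> = ennreal (\<integral>x. (zero_ext \<Omega> u x)\<^sup>2 * W x \<partial>lebesgue)"
    by (intro nn_integral_eq_integral bounded_potential_integrable(1)[OF W] L2_square_integrable L2_zero_ext[OF O u])
       (use n in auto)
  finally show ?thesis
    unfolding Q_energy_potential[OF O bounded_potential_measurable[OF W]]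
    by (simp add: ennreal_plus n)
qed

text \<open>Strong convergence handles the change from \<open>z n\<close> to \<open>u\<close> uniformly in the potential; weak convergence
  is then applied to the single function \<open>u\<^sup>2\<close>.\<close>

lemma potential_term_converges:
  fixes z :: "nat \<Rightarrow> 'a::euclidean_space \<Rightarrow> real"
  assumes W: "\<And>n. bounded_potential k (W n)" and k: "0 \<le> k"
    and weak: "\<And>f. integrable lebesgue f \<Longrightarrow> (\<lambda>n. pairing f (W n)) \<longlonglongrightarrow> pairing f U"
    and z: "\<And>n. L2 (z n)" "L2 u" "L2_tendsto z u"
  shows "(\<lambda>n. \<integral>x. (z n x)\<^sup>2 * W n x \<partial>lebesgue) \<longlonglongrightarrow> (\<integral>x. (u x)\<^sup>2 * U x \<partial>lebesgue)"
proof -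
  define s where "s n = sqnorm (\<lambda>x. z n x - u x)" for n
  have s: "s \<longlonglongrightarrow> 0" using z(3) unfolding s_def[abs_def] .
  note Ld = L2_diff[OF z(1,2)] and La = L2_add[OF z(1,2)]
  have "(\<lambda>n. \<integral>x. ((z n x)\<^sup>2 - (u x)\<^sup>2) * W n x \<partial>lebesgue) \<longlonglongrightarrow> 0"
  proof (rule Lim_null_comparison)
    show "\<forall>\<^sub>F n in sequentially. norm (\<integral>x. ((z n x)\<^sup>2 - (u x)\<^sup>2) * W n x \<partial>lebesgue)
        \<le> k * (sqrt (s n) * sqrt (2 * s n + 8 * sqnorm u))"
    proof (rule always_eventually, rule allI)
      fix n
      have i: "integrable lebesgue (\<lambda>x. (z n x - u x) * (z n x + u x))"
        by (rule L2_mult_integrable[OF Ld La])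
      have e: "(z n x)\<^sup>2 - (u x)\<^sup>2 = (z n x - u x) * (z n x + u x)" for x
        by (simp add: power2_eq_square algebra_simps)
      have "\<bar>\<integral>x. ((z n x)\<^sup>2 - (u x)\<^sup>2) * W n x \<partial>lebesgue\<bar> \<le> k * (\<integral>x. \<bar>(z n x - u x) * (z n x + u x)\<bar> \<partial>lebesgue)"
        unfolding e by (rule bounded_potential_integrable(2)[OF W i])
      also have "(\<integral>x. \<bar>(z n x - u x) * (z n x + u x)\<bar> \<partial>lebesgue) = (\<integral>x. \<bar>z n x - u x\<bar> * \<bar>z n x + u x\<bar> \<partial>lebesgue)"
        by (simp add: abs_mult)
      also have "\<dots> \<le> sqrt (sqnorm (\<lambda>x. \<bar>z n x - u x\<bar>)) * sqrt (sqnorm (\<lambda>x. \<bar>z n x + u x\<bar>))"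
      proof -
        have "L2 (\<lambda>x. \<bar>z n x - u x\<bar>)" "L2 (\<lambda>x. \<bar>z n x + u x\<bar>)" using Ld[of n] La[of n] by (auto simp: L2_iff)
        from L2_Cauchy_Schwarz[OF this] show ?thesis by linarith
      qed
      also have "sqnorm (\<lambda>x. \<bar>z n x - u x\<bar>) = s n" by (simp add: s_def sqnorm_def)
      also have "sqnorm (\<lambda>x. \<bar>z n x + u x\<bar>) = sqnorm (\<lambda>x. z n x + u x)" by (simp add: sqnorm_def)
      also have "sqrt (s n) * sqrt (sqnorm (\<lambda>x. z n x + u x)) \<le> sqrt (s n) * sqrt (2 * s n + 8 * sqnorm u)"
      proof (intro mult_left_mono real_sqrt_le_mono)
        have "sqnorm (\<lambda>x. (z n x - u x) + 2 * u x) \<le> 2 * s n + 2 * sqnorm (\<lambda>x. 2 * u x)"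
          unfolding s_def by (rule sqnorm_add_le[OF Ld L2_cmult[OF z(2)]])
        moreover have "(\<lambda>x. (z n x - u x) + 2 * u x) = (\<lambda>x. z n x + u x)" by auto
        ultimately show "sqnorm (\<lambda>x. z n x + u x) \<le> 2 * s n + 8 * sqnorm u"
          unfolding sqnorm_rmult by simp
      qed (simp add: s_def)
      finally show "norm (\<integral>x. ((z n x)\<^sup>2 - (u x)\<^sup>2) * W n x \<partial>lebesgue)
        \<le> k * (sqrt (s n) * sqrt (2 * s n + 8 * sqnorm u))" using k by (simp add: mult_left_mono)
    qed
    have "(\<lambda>n. k * (sqrt (s n) * sqrt (2 * s n + 8 * sqnorm u))) \<longlonglongrightarrow> k * (sqrt 0 * sqrt (2 * 0 + 8 * sqnorm u))"
      by (intro tendsto_intros s)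
    then show "(\<lambda>n. k * (sqrt (s n) * sqrt (2 * s n + 8 * sqnorm u))) \<longlonglongrightarrow> 0" by simp
  qed
  from tendsto_add[OF this weak[OF L2_square_integrable[OF z(2)]]]
  have "(\<lambda>n. (\<integral>x. ((z n x)\<^sup>2 - (u x)\<^sup>2) * W n x \<partial>lebesgue) + (\<integral>x. (u x)\<^sup>2 * W n x \<partial>lebesgue)) \<longlonglongrightarrow> (\<integral>x. (u x)\<^sup>2 * U x \<partial>lebesgue)"
    by simp
  moreover have "(\<integral>x. ((z n x)\<^sup>2 - (u x)\<^sup>2) * W n x \<partial>lebesgue) + (\<integral>x. (u x)\<^sup>2 * W n x \<partial>lebesgue) = (\<integral>x. (z n x)\<^sup>2 * W n x \<partial>lebesgue)" for n
    using bounded_potential_integrable(1)[OF W L2_square_integrable[OF z(1)], of n n]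
      bounded_potential_integrable(1)[OF W L2_square_integrable[OF z(2)], of n]
    by (simp add: left_diff_distrib)
  ultimately show ?thesis by simp
qed

text \<open>The recovery sequence is constant. For the lower bound, a subsequence with energies below \<open>r\<close> has
  Dirichlet integrals eventually below \<open>r - I + \<delta>\<close>, where \<open>I\<close> is the limit of the potential terms, so the
  lower semicontinuity of the Dirichlet integral on \<open>H10 \<Omega>\<close> applies.\<close>

lemma gamma_converges_weak:
  fixes \<Omega> :: "'a::euclidean_space set"
  assumes O: "open \<Omega>" and W: "\<And>n. bounded_potential k (W n)" "bounded_potential k U" and k: "0 \<le> k"
    and weak: "\<And>f. integrable lebesgue f \<Longrightarrow> (\<lambda>n. pairing f (W n)) \<longlonglongrightarrow> pairing f U"
  shows "gamma_converges \<Omega> (\<lambda>n. potential_measure \<Omega> (\<lambda>x. ennreal (W n x))) (potential_measure \<Omega> (\<lambda>x. ennreal (U x)))"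
  unfolding gamma_converges_def
proof (intro conjI allI impI)
  fix us :: "nat \<Rightarrow> 'a \<Rightarrow> real" and u assume l: "L2_lim_on \<Omega> us u"
  then have L: "L2_on \<Omega> (us n)" "L2_on \<Omega> u" for n by (auto simp: L2_lim_on_def)
  define z where "z n = zero_ext \<Omega> (us n)" for n
  define y where "y = zero_ext \<Omega> u"
  have zL: "L2 (z n)" "L2 y" for n unfolding z_def y_def by (intro L2_zero_ext O L)+
  have lim: "L2_tendsto z y"
    unfolding z_def y_def by (rule L2_lim_zero_ext[OF O l])
  define Q where "Q n = Q_energy \<Omega> (potential_measure \<Omega> (\<lambda>x. ennreal (W n x))) (us n)" for n
  define Q' where "Q' = Q_energy \<Omega> (potential_measure \<Omega> (\<lambda>x. ennreal (U x))) u"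
  have Qn: "Q n = (if z n \<in> H10 \<Omega> then ennreal (sqnorm (grad (z n)) + (\<integral>x. (z n x)\<^sup>2 * W n x \<partial>lebesgue)) else \<infinity>)" for n
    unfolding Q_def z_def by (rule Q_energy_bounded_potential[OF O W(1) L(1)])
  have Q'e: "Q' = (if y \<in> H10 \<Omega> then ennreal (sqnorm (grad y) + (\<integral>x. (y x)\<^sup>2 * U x \<partial>lebesgue)) else \<infinity>)"
    unfolding Q'_def y_def by (rule Q_energy_bounded_potential[OF O W(2) L(2)])
  have "Q' \<le> liminf Q"
  proof (rule ccontr)
    assume "\<not> Q' \<le> liminf Q"
    then obtain c where c: "liminf Q < c" "c < Q'" using dense[of "liminf Q" Q'] by (auto simp: not_le)
    obtain r where r: "c = ennreal r" "0 \<le> r" using c(2) by (cases c) auto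
    have "\<not> eventually (\<lambda>n. c \<le> Q n) sequentially"
      using Liminf_bounded[of c Q sequentially] c(1) by auto
    from not_eventually_sequentiallyD[OF this] obtain s :: "nat \<Rightarrow> nat" where s: "strict_mono s" "\<And>n. Q (s n) < c"
      by (auto simp: not_le)
    have zs: "z (s n) \<in> H10 \<Omega>" and es: "sqnorm (grad (z (s n))) + (\<integral>x. (z (s n) x)\<^sup>2 * W (s n) x \<partial>lebesgue) < r" for n
    proof -
      show "z (s n) \<in> H10 \<Omega>" using s(2)[of n] unfolding Qn r by (auto split: if_splits)
      then have "ennreal (sqnorm (grad (z (s n))) + (\<integral>x. (z (s n) x)\<^sup>2 * W (s n) x \<partial>lebesgue)) < ennreal r"
        using s(2)[of n] unfolding Qn r by simp
      then show "sqnorm (grad (z (s n))) + (\<integral>x. (z (s n) x)\<^sup>2 * W (s n) x \<partial>lebesgue) < r"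
        using r(2) ennreal_leI leD not_le by blast
    qed
    have lims: "(\<lambda>n. sqnorm (\<lambda>x. z (s n) x - y x)) \<longlonglongrightarrow> 0"
      using LIMSEQ_subseq_LIMSEQ[OF lim s(1)] by (simp add: comp_def)
    define I where "I = (\<integral>x. (y x)\<^sup>2 * U x \<partial>lebesgue)"
    have I: "(\<lambda>n. \<integral>x. (z (s n) x)\<^sup>2 * W (s n) x \<partial>lebesgue) \<longlonglongrightarrow> I"
      unfolding I_def
    proof (rule potential_term_converges[OF W(1) k _ zL(1) zL(2) lims])
      show "(\<lambda>n. pairing f (W (s n))) \<longlonglongrightarrow> pairing f U" if "integrable lebesgue f" for f
        using LIMSEQ_subseq_LIMSEQ[OF weak[OF that] s(1)] by (simp add: comp_def)
    qed
    have main: "y \<in> H10 \<Omega> \<and> sqnorm (grad y) \<le> r - I + \<delta>" if d: "\<delta> > 0" for \<delta>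
    proof -
      have "eventually (\<lambda>n. I - \<delta> < (\<integral>x. (z (s n) x)\<^sup>2 * W (s n) x \<partial>lebesgue)) sequentially"
        using order_tendstoD(1)[OF I, of "I - \<delta>"] d by simp
      then obtain N where N: "\<And>n. n \<ge> N \<Longrightarrow> I - \<delta> < (\<integral>x. (z (s n) x)\<^sup>2 * W (s n) x \<partial>lebesgue)"
        by (auto simp: eventually_sequentially)
      have "sqnorm (grad (z (s (n + N)))) \<le> r - I + \<delta>" for n
        using N[of "n + N"] es[of "n + N"] by simp
      moreover have "(\<lambda>n. sqnorm (\<lambda>x. z (s (n + N)) x - y x)) \<longlonglongrightarrow> 0"
        using LIMSEQ_ignore_initial_segment[OF lims, of N] by simp
      ultimately show ?thesis
        using H10_lower_semicontinuity[of "\<lambda>n. z (s (n + N))" \<Omega> "r - I + \<delta>" y, OF zs _ zL(2)] by blast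
    qed
    have "y \<in> H10 \<Omega>" using main[of 1] by simp
    moreover have "sqnorm (grad y) \<le> r - I" 
    proof (rule field_le_epsilon)
      fix \<delta> :: real assume "0 < \<delta>"
      then show "sqnorm (grad y) \<le> r - I + \<delta>" using main by blast
    qed
    ultimately have "Q' \<le> ennreal r" unfolding Q'e I_def by (simp add: ennreal_leI)
    with c(2) r(1) show False by simp
  qed
  then show "Q_energy \<Omega> (potential_measure \<Omega> (\<lambda>x. ennreal (U x))) u
     \<le> liminf (\<lambda>n. Q_energy \<Omega> (potential_measure \<Omega> (\<lambda>x. ennreal (W n x))) (us n))"
    unfolding Q_def[abs_def] Q'_def .
next
  fix u :: "'a \<Rightarrow> real" assume u: "L2_on \<Omega> u"
  note zL = L2_zero_ext[OF O u]
  show "\<exists>us. L2_lim_on \<Omega> us u \<and> (\<lambda>n. Q_energy \<Omega> (potential_measure \<Omega> (\<lambda>x. ennreal (W n x))) (us n)) \<longlonglongrightarrow>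
     Q_energy \<Omega> (potential_measure \<Omega> (\<lambda>x. ennreal (U x))) u"
  proof (intro exI[of _ "\<lambda>n. u"] conjI)
    show "L2_lim_on \<Omega> (\<lambda>n. u) u" using u by (simp add: L2_lim_on_def)
    show "(\<lambda>n. Q_energy \<Omega> (potential_measure \<Omega> (\<lambda>x. ennreal (W n x))) u) \<longlonglongrightarrow>
       Q_energy \<Omega> (potential_measure \<Omega> (\<lambda>x. ennreal (U x))) u"
      unfolding Q_energy_bounded_potential[OF O W(1) u] Q_energy_bounded_potential[OF O W(2) u]
      using weak[OF L2_square_integrable[OF zL]] by (auto intro!: tendsto_ennrealI tendsto_add)
  qed
qed

text \<open>By monotone convergence the limit energy is the supremum of the energies \<open>Q j\<close>, and each \<open>Q j\<close> is
  lower semicontinuous by the case of a constant sequence in \<open>gamma_converges_weak\<close>.\<close>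

lemma gamma_converges_increasing:
  fixes \<Omega> :: "'a::euclidean_space set"
  assumes O: "open \<Omega>" and W: "\<And>j. bounded_potential (b j) (W j)" "\<And>j x. W j x \<le> W (Suc j) x"
  shows "gamma_converges \<Omega> (\<lambda>j. potential_measure \<Omega> (\<lambda>x. ennreal (W j x))) (potential_measure \<Omega> (\<lambda>x. SUP j. ennreal (W j x)))"
proof -
  have b: "0 \<le> b j" for j using W(1)[of j] by (auto simp: bounded_potential_def intro: order_trans)
  have mono: "W i x \<le> W j x" if "i \<le> j" for i j x using lift_Suc_mono_le[of "\<lambda>j. W j x", OF W(2) that] .
  note mW = bounded_potential_measurable[OF W(1)]
  have mV: "(\<lambda>x. SUP j. ennreal (W j x)) \<in> borel_measurable (lebesgue_on \<Omega>)"
    by (intro borel_measurable_SUP mW) auto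
  define Q where "Q j = Q_energy \<Omega> (potential_measure \<Omega> (\<lambda>x. ennreal (W j x)))" for j
  define Q' where "Q' = Q_energy \<Omega> (potential_measure \<Omega> (\<lambda>x. SUP j. ennreal (W j x)))"
  note Qj = Q_energy_potential[OF O mW, folded Q_def]
  note Q'e = Q_energy_potential[OF O mV, folded Q'_def]
  have Qmono: "Q i u \<le> Q j u" if "i \<le> j" for i j u
    unfolding Qj using mono[OF that] by (auto intro!: add_left_mono nn_integral_mono mult_right_mono mult_left_mono ennreal_leI)
  have Qsup: "Q' u = (SUP j. Q j u)" if u: "L2_on \<Omega> u" for u
  proof (cases "zero_ext \<Omega> u \<in> H10 \<Omega>")
    case True
    have um: "(\<lambda>x. ennreal ((zero_ext \<Omega> u x)\<^sup>2)) \<in> borel_measurable lebesgue"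
      using L2_measurable[OF L2_zero_ext[OF O u]] by simp
    have e: "(\<integral>\<^sup>+x\<in>\<Omega>. ennreal ((u x)\<^sup>2) * V x \<partial>lebesgue) = (\<integral>\<^sup>+x. ennreal ((zero_ext \<Omega> u x)\<^sup>2) * V x \<partial>lebesgue)" for V
      by (intro nn_integral_cong) (auto simp: zero_ext_def split: split_indicator)
    have "(\<integral>\<^sup>+x. ennreal ((zero_ext \<Omega> u x)\<^sup>2) * (SUP j. ennreal (W j x)) \<partial>lebesgue)
       = (\<integral>\<^sup>+x. (SUP j. ennreal ((zero_ext \<Omega> u x)\<^sup>2) * ennreal (W j x)) \<partial>lebesgue)"
      by (simp add: SUP_mult_left_ennreal)
    also have "\<dots> = (SUP j. \<integral>\<^sup>+x. ennreal ((zero_ext \<Omega> u x)\<^sup>2) * ennreal (W j x) \<partial>lebesgue)"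
    proof (rule nn_integral_monotone_convergence_SUP)
      show "incseq (\<lambda>j x. ennreal ((zero_ext \<Omega> u x)\<^sup>2) * ennreal (W j x))"
        using mono by (auto simp: incseq_def le_fun_def intro!: mult_left_mono ennreal_leI)
      show "(\<lambda>x. ennreal ((zero_ext \<Omega> u x)\<^sup>2) * ennreal (W j x)) \<in> borel_measurable lebesgue" for j
        using um W(1)[of j] by (auto simp: bounded_potential_def)
    qed
    finally show ?thesis using True unfolding Qj Q'e e by (simp add: ennreal_SUP_add_right)
  qed (simp add: Qj Q'e)
  show ?thesis
    unfolding gamma_converges_def Q_def[symmetric] Q'_def[symmetric]
  proof (intro conjI allI impI)
    fix us :: "nat \<Rightarrow> 'a \<Rightarrow> real" and u assume l: "L2_lim_on \<Omega> us u"
    then have u: "L2_on \<Omega> u" by (simp add: L2_lim_on_def)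
    show "Q' u \<le> liminf (\<lambda>n. Q n (us n))"
      unfolding Qsup[OF u]
    proof (rule SUP_least)
      fix j
      have "gamma_converges \<Omega> (\<lambda>n. potential_measure \<Omega> (\<lambda>x. ennreal (W j x))) (potential_measure \<Omega> (\<lambda>x. ennreal (W j x)))"
        by (rule gamma_converges_weak[OF O W(1) W(1) b]) simp
      then have "Q j u \<le> liminf (\<lambda>n. Q j (us n))"
        using l unfolding gamma_converges_def Q_def by blast
      also have "\<dots> \<le> liminf (\<lambda>n. Q n (us n))"
        by (rule Liminf_mono) (auto simp: eventually_sequentially intro!: exI[of _ j] Qmono)
      finally show "Q j u \<le> liminf (\<lambda>n. Q n (us n))" .
    qed
  next
    fix u :: "'a \<Rightarrow> real" assume u: "L2_on \<Omega> u"
    show "\<exists>us. L2_lim_on \<Omega> us u \<and> (\<lambda>n. Q n (us n)) \<longlonglongrightarrow> Q' u"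
    proof (intro exI[of _ "\<lambda>n. u"] conjI)
      show "L2_lim_on \<Omega> (\<lambda>n. u) u" using u by (simp add: L2_lim_on_def)
      show "(\<lambda>n. Q n u) \<longlonglongrightarrow> Q' u"
        unfolding Qsup[OF u] by (rule LIMSEQ_SUP) (auto simp: incseq_def intro: Qmono)
    qed
  qed
qed

section \<open>Strictly decreasing functions with convex inverse\<close>

lemma half_ennreal_eq: "(1 / 2 :: ennreal) = ennreal (1 / 2)"
  by (metis divide_ennreal ennreal_1 ennreal_numeral zero_le_one zero_le_numeral zero_less_numeral)

lemma half_ennreal: "1 - 1 / 2 = (1 / 2 :: ennreal)" "(1 / 2 :: ennreal) + 1 / 2 = 1" "(1 / 2 :: ennreal) \<le> 1"
proof -
  note h = half_ennreal_eq
  show "1 - 1 / 2 = (1 / 2 :: ennreal)"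
  proof -
    have "ennreal 1 - ennreal (1/2) = ennreal (1 - 1/2)" by (rule ennreal_minus) simp
    also have "(1 - 1/2 :: real) = 1/2" by simp
    finally show ?thesis unfolding h ennreal_1 .
  qed
  show "(1 / 2 :: ennreal) + 1 / 2 = 1"
  proof -
    have "ennreal (1/2 + 1/2) = ennreal (1/2) + ennreal (1/2)" by (rule ennreal_plus) auto
    moreover have "(1/2 + 1/2 :: real) = 1" by simp
    ultimately show ?thesis unfolding h by (metis ennreal_1)
  qed
  show "(1 / 2 :: ennreal) \<le> 1"
    unfolding h using ennreal_leI[of "1/2" 1] by simp
qed

locale decreasing_convex_inverse =
  fixes \<Psi> :: "ennreal \<Rightarrow> ennreal"
  assumes decreasing: "\<And>s t. s < t \<Longrightarrow> \<Psi> t < \<Psi> s"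
    and convex_inverse: "ennreal_convex_on (range \<Psi>) (inv \<Psi>)"
begin

lemma antitone: "s \<le> t \<Longrightarrow> \<Psi> t \<le> \<Psi> s"
  by (metis decreasing order_le_less)

lemma less_imp_greater: "\<Psi> t < \<Psi> s \<Longrightarrow> s < t"
  using antitone[of t s] by (meson leD not_le_imp_less)

lemma inj_Psi: "inj \<Psi>"
  by (rule injI) (metis decreasing less_irrefl linorder_neqE)

text \<open>The domain of a convex function is an interval; applied to the inverse, this says that \<open>\<Psi>\<close> omits
  no intermediate value.\<close>

lemma between_in_range: "\<Psi> t \<le> c \<Longrightarrow> c \<le> \<Psi> s \<Longrightarrow> c \<in> range \<Psi>"
  using convex_inverse unfolding ennreal_convex_on_def by (meson atLeastAtMost_iff rangeI subsetD)

text \<open>The average \<open>m\<close> of \<open>\<Psi> s\<close> and \<open>\<Psi> t\<close> is a value of \<open>\<Psi>\<close>. Convexity of the inverse says that the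
  preimage of \<open>m\<close> is at most the average of \<open>s\<close> and \<open>t\<close>; apply the decreasing function \<open>\<Psi>\<close>.\<close>

lemma midpoint_convex: "\<Psi> ((1/2) * s + (1/2) * t) \<le> (1/2) * \<Psi> s + (1/2) * \<Psi> t"
proof -
  define m where "m = (1/2) * \<Psi> s + (1/2) * \<Psi> t"
  have half: "(1/2) * x + (1/2) * x = x" for x :: ennreal
    by (simp add: distrib_right[symmetric] half_ennreal)
  have mr: "m \<in> range \<Psi>"
  proof (cases "\<Psi> s \<le> \<Psi> t")
    case True
    have "(1/2) * \<Psi> s + (1/2) * \<Psi> s \<le> m" "m \<le> (1/2) * \<Psi> t + (1/2) * \<Psi> t"
      unfolding m_def using True by (intro add_mono mult_left_mono order_refl; simp)+
    then show ?thesis unfolding half by (rule between_in_range)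
  next
    case False
    then have "\<Psi> t \<le> \<Psi> s" by simp
    then have "(1/2) * \<Psi> t + (1/2) * \<Psi> t \<le> m" "m \<le> (1/2) * \<Psi> s + (1/2) * \<Psi> s"
      unfolding m_def by (intro add_mono mult_left_mono order_refl; simp)+
    then show ?thesis unfolding half by (rule between_in_range)
  qed
  have "\<forall>a\<in>range \<Psi>. \<forall>b\<in>range \<Psi>. \<forall>c\<in>{0..1}. inv \<Psi> (c * a + (1 - c) * b) \<le> c * inv \<Psi> a + (1 - c) * inv \<Psi> b"
    using convex_inverse unfolding ennreal_convex_on_def by blast
  then have "inv \<Psi> ((1/2) * \<Psi> s + (1 - 1/2) * \<Psi> t) \<le> (1/2) * inv \<Psi> (\<Psi> s) + (1 - 1/2) * inv \<Psi> (\<Psi> t)"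
    using half_ennreal(3) by (auto simp del: divide_le_eq_1)
  then have "inv \<Psi> m \<le> (1/2) * s + (1/2) * t"
    unfolding half_ennreal(1) inv_f_f[OF inj_Psi] m_def .
  then have "\<Psi> ((1/2) * s + (1/2) * t) \<le> \<Psi> (inv \<Psi> m)" by (rule antitone)
  also have "\<Psi> (inv \<Psi> m) = m" by (rule f_inv_into_f[OF mr])
  finally show ?thesis unfolding m_def .
qed

lemma value_between:
  assumes "\<Psi> t \<le> y" "y < \<Psi> s" obtains c where "y < \<Psi> c" "\<Psi> c < \<Psi> s" "s < c"
proof -
  obtain d where d: "y < d" "d < \<Psi> s" using dense[OF assms(2)] by blast
  then have "d \<in> range \<Psi>" using assms(1) by (intro between_in_range[of t d s]) auto
  then obtain c where "d = \<Psi> c" by auto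
  with d less_imp_greater that show thesis by blast
qed

text \<open>A value strictly between \<open>y\<close> and \<open>\<Psi> x\<close> is taken at a point to the right of \<open>x\<close>, and the sequence
  is eventually to the left of that point.\<close>

lemma lower_semicontinuous:
  assumes "X \<longlonglongrightarrow> x" shows "\<Psi> x \<le> liminf (\<lambda>n. \<Psi> (X n))"
  unfolding le_Liminf_iff
proof (intro allI impI)
  fix y assume y: "y < \<Psi> x"
  show "\<forall>\<^sub>F n in sequentially. y < \<Psi> (X n)"
  proof (cases "y < \<Psi> top")
    case True
    then show ?thesis using antitone[of _ top] by (intro always_eventually) (auto intro: less_le_trans)
  next
    case False
    then obtain c where c: "y < \<Psi> c" "x < c" using value_between[of top y x] y by (auto simp: not_less)
    have "\<forall>\<^sub>F n in sequentially. X n < c" by (rule order_tendstoD(2)[OF assms c(2)])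
    then show ?thesis by eventually_elim (meson antitone c(1) less_imp_le less_le_trans)
  qed
qed

lemma Psi_measurable: "\<Psi> \<in> borel_measurable borel"
proof (rule borel_measurableI_greater)
  fix y
  have "open {x. y < \<Psi> x}"
  proof (cases "y < \<Psi> top")
    case True
    then have "y < \<Psi> x" for x using antitone[of x top] by (meson less_le_trans top_greatest)
    then show ?thesis by simp
  next
    case False
    show ?thesis
      unfolding open_subopen[of "{x. y < \<Psi> x}"]
    proof
      fix x assume "x \<in> {x. y < \<Psi> x}"
      then obtain c where c: "y < \<Psi> c" "x < c" using value_between[of top y x] False by (auto simp: not_less)
      then show "\<exists>T. open T \<and> x \<in> T \<and> T \<subseteq> {x. y < \<Psi> x}"
        by (intro exI[of _ "{..<c}"]) (auto intro: less_trans decreasing)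
    qed
  qed
  then show "{x \<in> space borel. y < \<Psi> x} \<in> sets borel" by simp
qed

lemma limit_at_top: "(\<lambda>n. \<Psi> (ennreal (real n))) \<longlonglongrightarrow> \<Psi> top"
proof (rule order_tendstoI)
  fix a assume "a < \<Psi> top"
  then show "\<forall>\<^sub>F n in sequentially. a < \<Psi> (ennreal (real n))"
    using antitone[of _ top] by (intro always_eventually) (auto intro: less_le_trans)
next
  fix a assume a: "\<Psi> top < a"
  have "\<Psi> top < \<Psi> 0" by (rule decreasing) simp
  with a obtain d where d: "\<Psi> top < d" "d < min a (\<Psi> 0)" using dense[of "\<Psi> top" "min a (\<Psi> 0)"] by auto
  then have "d \<in> range \<Psi>" by (intro between_in_range[of top d 0]) auto
  then obtain c where c: "d = \<Psi> c" by auto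
  then have "c < top" using d(1) less_imp_greater by blast
  then have "\<forall>\<^sub>F n in sequentially. c < of_nat n"
    by (rule order_tendstoD(1)[OF of_nat_tendsto_top_ennreal])
  then show "\<forall>\<^sub>F n in sequentially. \<Psi> (ennreal (real n)) < a"
  proof eventually_elim
    case (elim n)
    then have "\<Psi> (ennreal (real n)) < \<Psi> c" by (intro decreasing) (simp add: ennreal_of_nat_eq_real_of_nat)
    then show ?case using c d(2) by auto
  qed
qed

text \<open>The bound is additive because \<open>\<Psi>\<close> is never below \<open>\<Psi> top\<close>.\<close>

lemma truncation_le: "\<Psi> (min t k) \<le> \<Psi> t + (\<Psi> k - \<Psi> top)"
proof (cases "t \<le> k")
  case False
  have "\<Psi> k = \<Psi> top + (\<Psi> k - \<Psi> top)" using antitone[of k top] by (simp add: add_diff_inverse_ennreal)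
  also have "\<dots> \<le> \<Psi> t + (\<Psi> k - \<Psi> top)" by (intro add_right_mono antitone) simp
  finally show ?thesis using False by (simp add: min_def)
qed (simp add: min_def)

end

section \<open>Weak compactness of bounded potentials\<close>

lemma bounded_potential_L2:
  fixes W :: "'a::euclidean_space \<Rightarrow> real"
  assumes W: "bounded_potential k W" "\<And>x. x \<notin> S \<Longrightarrow> W x = 0" and S: "S \<subseteq> cball 0 R"
  shows "L2 W" "sqnorm W \<le> k\<^sup>2 * sqnorm (indicator (cball 0 R) :: 'a \<Rightarrow> real)"
proof -
  have b: "AE x in lebesgue. (norm (W x))\<^sup>2 \<le> k\<^sup>2 * (norm (indicator (cball 0 R) x :: real))\<^sup>2"
  proof (rule AE_I2)
    fix x show "(norm (W x))\<^sup>2 \<le> k\<^sup>2 * (norm (indicator (cball 0 R) x :: real))\<^sup>2"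
    proof (cases "x \<in> cball 0 R")
      case True
      have "\<bar>W x\<bar>\<^sup>2 \<le> k\<^sup>2" using W(1) by (intro power_mono) (auto simp: bounded_potential_def)
      with True show ?thesis by simp
    next
      case False
      then have "W x = 0" using S by (intro W(2)) auto
      then show ?thesis by simp
    qed
  qed
  have m: "W \<in> borel_measurable lebesgue" using W(1) by (simp add: bounded_potential_def)
  have i: "integrable lebesgue (\<lambda>x::'a. k\<^sup>2 * (norm (indicator (cball 0 R) x :: real))\<^sup>2)"
    by (intro integrable_mult_right L2_integrable L2_indicator_cball)
  show "L2 W" by (rule L2_bound(1)[OF m i b])
  show "sqnorm W \<le> k\<^sup>2 * sqnorm (indicator (cball 0 R) :: 'a \<Rightarrow> real)"
    using L2_bound(2)[OF m i b] unfolding sqnorm_def by simp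
qed

text \<open>The functions for which the integrals converge form a subspace that contains the indicators of the
  boxes, hence is dense in \<open>L\<^sup>2\<close>; uniform bounds extend the convergence to \<open>L\<^sup>2\<close>, and cutting off large
  values extends it to integrable functions.\<close>

lemma weak_convergence_from_boxes:
  fixes W :: "nat \<Rightarrow> 'a::euclidean_space \<Rightarrow> real"
  assumes W: "\<And>n. bounded_potential k (W n)" "bounded_potential k U" "\<And>n x. x \<notin> S \<Longrightarrow> W n x = 0" "\<And>x. x \<notin> S \<Longrightarrow> U x = 0"
    and S: "bounded S"
    and boxes: "\<And>B. B \<in> rational_boxes \<Longrightarrow> (\<lambda>n. pairing (indicator B) (W n)) \<longlonglongrightarrow> pairing (indicator B) U"
    and f: "integrable lebesgue f"
  shows "(\<lambda>n. pairing f (W n)) \<longlonglongrightarrow> pairing f U"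
proof -
  obtain R where R: "S \<subseteq> cball 0 R" using S unfolding bounded_pos by (auto simp: subset_eq)
  have k: "0 \<le> k" using W(2) by (auto simp: bounded_potential_def intro: order_trans)
  define M where "M = k\<^sup>2 * sqnorm (indicator (cball 0 R) :: 'a \<Rightarrow> real)"
  have LW: "L2 (W n)" "sqnorm (W n) \<le> M" for n
    unfolding M_def by (rule bounded_potential_L2[OF W(1) W(3) R], assumption)+
  have LU: "L2 U" "sqnorm U \<le> M"
    unfolding M_def by (rule bounded_potential_L2[OF W(2) W(4) R], assumption)+
  have M0: "0 \<le> M" using LU(2) sqnorm_nonneg[of U] by linarith
  \<comment> \<open>An approximation argument common to the two extensions below.\<close>
  have approx: "(\<lambda>n. pairing f (W n)) \<longlonglongrightarrow> pairing f U"
    if "\<And>e. e > 0 \<Longrightarrow> \<exists>p. (\<lambda>n. pairing p (W n)) \<longlonglongrightarrow> pairing p U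
       \<and> (\<forall>n. \<bar>pairing f (W n) - pairing p (W n)\<bar> \<le> e)
       \<and> \<bar>pairing f U - pairing p U\<bar> \<le> e" for f
  proof (rule LIMSEQ_I)
    fix r :: real assume r: "r > 0"
    then have "r / 4 > 0" by simp
    from that[OF this] obtain p where p: "(\<lambda>n. pairing p (W n)) \<longlonglongrightarrow> pairing p U"
       "\<And>n. \<bar>pairing f (W n) - pairing p (W n)\<bar> \<le> r / 4"
       "\<bar>pairing f U - pairing p U\<bar> \<le> r / 4" by blast
    obtain N where N: "\<And>n. n \<ge> N \<Longrightarrow> norm (pairing p (W n) - pairing p U) < r / 4"
      using LIMSEQ_D[OF p(1) \<open>r / 4 > 0\<close>] by blast
    have tri: "\<bar>a - d\<bar> < r" if "\<bar>a - b\<bar> \<le> r / 4" "\<bar>b - c\<bar> < r / 4" "\<bar>d - c\<bar> \<le> r / 4" for a b c d :: real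
      using that r by linarith
    have "norm (pairing f (W n) - pairing f U) < r" if "n \<ge> N" for n
      using tri[OF p(2)[of n] N[OF that, unfolded real_norm_def] p(3)] by simp
    then show "\<exists>N. \<forall>n\<ge>N. norm (pairing f (W n) - pairing f U) < r" by blast
  qed
  have L2conv: "(\<lambda>n. pairing f (W n)) \<longlonglongrightarrow> pairing f U" if f: "L2 f" for f
  proof -
    define P where "P = {p. L2 p \<and> (\<lambda>n. pairing p (W n)) \<longlonglongrightarrow> pairing p U}"
    have PL: "p \<in> P \<Longrightarrow> L2 p" for p by (simp add: P_def)
    obtain p where p: "\<And>n. p n \<in> P" "L2_tendsto p f"
    proof (rule L2_dense_if_total[of P f, OF _ _ _ _ _ f])
      show "L2 p" if "p \<in> P" for p by (rule PL[OF that])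
      have B: "indicator B \<in> P" if "B \<in> rational_boxes" for B
        unfolding P_def using boxes[OF that] rational_boxes_box[OF that] L2_indicator_box by auto
      have "rational_boxes \<noteq> ({} :: 'a set set)" using Union_rational_boxes[of "UNIV :: 'a set"] by auto
      then show "P \<noteq> {}" using B by blast
      show "(\<lambda>x. p x + q x) \<in> P" if pq: "p \<in> P" "q \<in> P" for p q
        unfolding P_def
      proof (intro CollectI conjI L2_add PL pq)
        show "(\<lambda>n. \<integral>x. (p x + q x) * W n x \<partial>lebesgue) \<longlonglongrightarrow> (\<integral>x. (p x + q x) * U x \<partial>lebesgue)"
          using pq L2_mult_integrable[OF PL[OF pq(1)] LW(1)] L2_mult_integrable[OF PL[OF pq(2)] LW(1)]
            L2_mult_integrable[OF PL[OF pq(1)] LU(1)] L2_mult_integrable[OF PL[OF pq(2)] LU(1)]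
          by (simp add: distrib_right P_def tendsto_add)
      qed
      show "(\<lambda>x. c * p x) \<in> P" if "p \<in> P" for p c
        using that unfolding P_def by (auto intro: L2_cmult tendsto_mult_left simp: mult.assoc)
      show "AE x in lebesgue. w x = 0" if w: "L2 w" "\<And>p. p \<in> P \<Longrightarrow> (pairing w p) = 0" for w
        by (rule L2_zero_if_zero_on_boxes[OF w(1)]) (rule w(2)[OF B])
    qed (rule that; assumption)
    show ?thesis
    proof (rule approx)
      fix e :: real assume e: "e > 0"
      have "(\<lambda>n. sqrt (sqnorm (\<lambda>x. p n x - f x)) * sqrt M) \<longlonglongrightarrow> sqrt 0 * sqrt M"
        by (intro tendsto_intros p)
      then have "\<forall>\<^sub>F n in sequentially. sqrt (sqnorm (\<lambda>x. p n x - f x)) * sqrt M < e"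
        using e by (intro order_tendstoD(2)) auto
      then obtain j where j: "sqrt (sqnorm (\<lambda>x. p j x - f x)) * sqrt M < e"
        using eventually_happens trivial_limit_sequentially by blast
      have est: "\<bar>pairing f V - pairing (p j) V\<bar> \<le> e" if V: "L2 V" "sqnorm V \<le> M" for V
      proof -
        have "pairing f V - pairing (p j) V = - (\<integral>x. (p j x - f x) * V x \<partial>lebesgue)"
          using L2_mult_integrable[OF f V(1)] L2_mult_integrable[OF PL[OF p(1)] V(1), of j] by (simp add: left_diff_distrib)
        then have "\<bar>pairing f V - pairing (p j) V\<bar> \<le> sqrt (sqnorm (\<lambda>x. p j x - f x)) * sqrt (sqnorm V)"
          using L2_Cauchy_Schwarz[OF L2_diff[OF PL[OF p(1)] f] V(1), of j] by simp
        also have "\<dots> \<le> sqrt (sqnorm (\<lambda>x. p j x - f x)) * sqrt M" using V(2) by (intro mult_left_mono) auto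
        finally show ?thesis using j by simp
      qed
      show "\<exists>p. (\<lambda>n. pairing p (W n)) \<longlonglongrightarrow> pairing p U
       \<and> (\<forall>n. \<bar>pairing f (W n) - pairing p (W n)\<bar> \<le> e)
       \<and> \<bar>pairing f U - pairing p U\<bar> \<le> e"
        using p(1)[of j] est LW LU by (intro exI[of _ "p j"]) (simp add: P_def)
    qed
  qed
  show ?thesis
  proof (rule approx)
    fix e :: real assume e: "e > 0"
    define g where "g j x = (if \<bar>f x\<bar> \<le> real j then f x else 0)" for j :: nat and x
    have fm[measurable]: "f \<in> borel_measurable lebesgue" using f by (rule borel_measurable_integrable)
    have gm: "g j \<in> borel_measurable lebesgue" for j unfolding g_def by measurable
    have gi: "integrable lebesgue (g j)" for j
      by (rule Bochner_Integration.integrable_bound[OF f gm]) (simp add: g_def)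
    have gL: "L2 (g j)" for j
    proof (rule L2_bound(1)[OF gm, of "\<lambda>x. real j * \<bar>f x\<bar>"])
      show "AE x in lebesgue. (norm (g j x))\<^sup>2 \<le> real j * \<bar>f x\<bar>"
      proof (rule AE_I2)
        fix x show "(norm (g j x))\<^sup>2 \<le> real j * \<bar>f x\<bar>"
        proof (cases "\<bar>f x\<bar> \<le> real j")
          case True
          then have "\<bar>f x\<bar> * \<bar>f x\<bar> \<le> real j * \<bar>f x\<bar>" by (intro mult_right_mono) auto
          with True show ?thesis unfolding g_def real_norm_def power2_eq_square by simp
        qed (simp add: g_def)
      qed
    qed (use f in auto)
    have "(\<lambda>j. \<integral>x. \<bar>f x - g j x\<bar> \<partial>lebesgue) \<longlonglongrightarrow> (\<integral>x. 0 \<partial>(lebesgue :: 'a measure))"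
    proof (rule integral_dominated_convergence[where w = "\<lambda>x. \<bar>f x\<bar>"])
      show "AE x in lebesgue. (\<lambda>j. \<bar>f x - g j x\<bar>) \<longlonglongrightarrow> 0"
      proof (rule AE_I2, rule tendsto_eventually)
        fix x
        obtain N :: nat where "\<bar>f x\<bar> \<le> real N" using real_arch_simple by blast
        then show "\<forall>\<^sub>F j in sequentially. \<bar>f x - g j x\<bar> = 0"
          by (intro eventually_sequentiallyI[of N]) (auto simp: g_def)
      qed
      show "AE x in lebesgue. norm \<bar>f x - g j x\<bar> \<le> \<bar>f x\<bar>" for j by (auto simp: g_def)
    qed (use f gm in auto)
    then have "(\<lambda>j. k * (\<integral>x. \<bar>f x - g j x\<bar> \<partial>lebesgue)) \<longlonglongrightarrow> k * 0" by (intro tendsto_mult_left) simp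
    then have "\<forall>\<^sub>F j in sequentially. k * (\<integral>x. \<bar>f x - g j x\<bar> \<partial>lebesgue) < e"
      using e by (intro order_tendstoD(2)) auto
    then obtain j where j: "k * (\<integral>x. \<bar>f x - g j x\<bar> \<partial>lebesgue) < e"
      using eventually_happens trivial_limit_sequentially by blast
    have est: "\<bar>pairing f V - pairing (g j) V\<bar> \<le> e" if V: "bounded_potential k V" for V
    proof -
      have "pairing f V - pairing (g j) V = (\<integral>x. (f x - g j x) * V x \<partial>lebesgue)"
        using bounded_potential_integrable(1)[OF V f] bounded_potential_integrable(1)[OF V gi[of j]]
        by (simp add: left_diff_distrib)
      then show ?thesis
        using bounded_potential_integrable(2)[OF V Bochner_Integration.integrable_diff[OF f gi[of j]]] j by simp
    qed
    show "\<exists>p. (\<lambda>n. pairing p (W n)) \<longlonglongrightarrow> pairing p U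
       \<and> (\<forall>n. \<bar>pairing f (W n) - pairing p (W n)\<bar> \<le> e)
       \<and> \<bar>pairing f U - pairing p U\<bar> \<le> e"
      using L2conv[OF gL[of j]] est W(1,2) by (intro exI[of _ "g j"]) simp
  qed
qed

text \<open>A countable product of compact intervals is compact and metrizable, hence sequentially compact.\<close>

lemma coordinatewise_convergent_subsequence:
  fixes f :: "nat \<Rightarrow> 'i::countable \<Rightarrow> real"
  assumes "\<And>n i. f n i \<in> {a i..b i}"
  obtains r where "strict_mono (r :: nat \<Rightarrow> nat)" "\<And>i. convergent (\<lambda>n. f (r n) i)"
proof -
  have "compact (PiE UNIV (\<lambda>i. {a i..b i}))"
    using compactin_PiE[of "\<lambda>_. euclidean" UNIV "\<lambda>i. {a i..b i}"] by (simp add: euclidean_product_topology)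
  then have "seq_compact (PiE UNIV (\<lambda>i. {a i..b i}))" by (simp add: compact_eq_seq_compact_metric)
  moreover have "\<forall>n. f n \<in> PiE UNIV (\<lambda>i. {a i..b i})" using assms by auto
  ultimately obtain l r where r: "strict_mono (r :: nat \<Rightarrow> nat)" "(f \<circ> r) \<longlonglongrightarrow> l" by (rule seq_compactE)
  have "(\<lambda>n. f (r n) i) \<longlonglongrightarrow> l i" for i
    using continuous_on_tendsto_compose[OF continuous_on_product_coordinates[of i] r(2)] by simp
  then show thesis using that[OF r(1)] by (auto simp: convergent_def)
qed

context decreasing_convex_inverse
begin

text \<open>The set \<open>C n\<close> imposes the pointwise bounds, the bound on the integral of \<open>\<Psi>\<close>, and that the integral
  over every rational box misses its limit by no more than the worst of the \<open>W j\<close> with \<open>j \<ge> n\<close>. The first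
  two conditions pass to the strong limit, the second by Fatou's lemma, and the third forces the right
  integral over every box.\<close>

lemma weak_limit_of_potentials:
  fixes W :: "nat \<Rightarrow> 'a::euclidean_space \<Rightarrow> real"
  assumes O: "open \<Omega>" "bounded \<Omega>"
    and W: "\<And>n. bounded_potential k (W n)" "\<And>n x. x \<notin> \<Omega> \<Longrightarrow> W n x = 0"
    and bound: "\<And>n. (\<integral>\<^sup>+x\<in>\<Omega>. \<Psi> (ennreal (W n x)) \<partial>lebesgue) \<le> \<beta>"
    and boxes: "\<And>B. B \<in> rational_boxes \<Longrightarrow> convergent (\<lambda>n. pairing (indicator B) (W n))"
  obtains U where "bounded_potential k U" "\<And>x. x \<notin> \<Omega> \<Longrightarrow> U x = 0" "(\<integral>\<^sup>+x\<in>\<Omega>. \<Psi> (ennreal (U x)) \<partial>lebesgue) \<le> \<beta>"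
    "\<And>f. integrable lebesgue f \<Longrightarrow> (\<lambda>n. pairing f (W n)) \<longlonglongrightarrow> pairing f U"
proof -
  obtain R where R: "\<Omega> \<subseteq> cball 0 R" using O(2) unfolding bounded_pos by (auto simp: subset_eq)
  have k: "0 \<le> k" using W(1)[of 0] by (auto simp: bounded_potential_def intro: order_trans)
  have Om: "\<Omega> \<in> sets lebesgue" using O(1) by (intro borel_imp_lebesgue) simp
  define M where "M = k\<^sup>2 * sqnorm (indicator (cball 0 R) :: 'a \<Rightarrow> real)"
  define l where "l B = lim (\<lambda>n. pairing (indicator B) (W n))" for B
  have l: "(\<lambda>n. pairing (indicator B) (W n)) \<longlonglongrightarrow> l B" if "B \<in> rational_boxes" for B
    unfolding l_def using boxes[OF that] by (simp add: convergent_LIMSEQ_iff)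
  define G where "G = {w. bounded_potential k w \<and> (\<forall>x. x \<notin> \<Omega> \<longrightarrow> w x = 0) \<and> (\<integral>\<^sup>+x\<in>\<Omega>. \<Psi> (ennreal (w x)) \<partial>lebesgue) \<le> \<beta>}"
  define C where "C n = {w \<in> G. \<forall>B\<in>rational_boxes. \<forall>c. (\<forall>j\<ge>n. \<bar>pairing (indicator B) (W j) - l B\<bar> \<le> c)
      \<longrightarrow> \<bar>pairing (indicator B) w - l B\<bar> \<le> c}" for n
  have WC: "W n \<in> C n" for n using W bound unfolding C_def G_def by auto
  have GD: "bounded_potential k w" "x \<notin> \<Omega> \<Longrightarrow> w x = 0" "(\<integral>\<^sup>+x\<in>\<Omega>. \<Psi> (ennreal (w x)) \<partial>lebesgue) \<le> \<beta>" if "w \<in> G" for w x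
    using that by (auto simp: G_def)
  have GL: "L2 w" "sqnorm w \<le> M" if "w \<in> G" for w
    unfolding M_def using bounded_potential_L2[OF GD(1)[OF that] GD(2)[OF that] R] by blast+
  have CG: "w \<in> G" if "w \<in> C n" for w n using that by (simp add: C_def)
  have Psim: "(\<lambda>x. \<Psi> (ennreal (w x)) * indicator \<Omega> x) \<in> borel_measurable lebesgue" if "w \<in> borel_measurable lebesgue" for w
    using that Om by (intro borel_measurable_times_ennreal measurable_compose[OF _ Psi_measurable] borel_measurable_indicator) auto
  have midG: "(\<lambda>x. (1/2) *\<^sub>R (a x + b x)) \<in> G" if ab: "a \<in> G" "b \<in> G" for a b
  proof -
    note A = GD[OF ab(1)] and B = GD[OF ab(2)]
    have am: "a \<in> borel_measurable lebesgue" "b \<in> borel_measurable lebesgue" using A(1) B(1) by (auto simp: bounded_potential_def)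
    have n: "0 \<le> a x" "0 \<le> b x" "a x \<le> k" "b x \<le> k" for x using A(1) B(1) by (auto simp: bounded_potential_def)
    have half: "ennreal ((1/2) *\<^sub>R (a x + b x)) = (1/2) * ennreal (a x) + (1/2) * ennreal (b x)" for x
    proof -
      have "(1/2) *\<^sub>R (a x + b x) = (1/2) * a x + (1/2) * b x" by (simp add: distrib_left)
      then have "ennreal ((1/2) *\<^sub>R (a x + b x)) = ennreal ((1/2) * a x + (1/2) * b x)" by (rule arg_cong)
      also have "\<dots> = ennreal ((1/2) * a x) + ennreal ((1/2) * b x)" by (rule ennreal_plus) (use n in auto)
      also have "\<dots> = ennreal (1/2) * ennreal (a x) + ennreal (1/2) * ennreal (b x)"
        by (intro arg_cong2[where f = "(+)"] ennreal_mult) (use n in auto)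
      finally show ?thesis unfolding half_ennreal_eq .
    qed
    have "(\<integral>\<^sup>+x\<in>\<Omega>. \<Psi> (ennreal ((1/2) *\<^sub>R (a x + b x))) \<partial>lebesgue)
      \<le> (\<integral>\<^sup>+x. (1/2) * (\<Psi> (ennreal (a x)) * indicator \<Omega> x) + (1/2) * (\<Psi> (ennreal (b x)) * indicator \<Omega> x) \<partial>lebesgue)"
      unfolding half using midpoint_convex by (intro nn_integral_mono) (auto split: split_indicator)
    also have "\<dots> = (1/2) * (\<integral>\<^sup>+x\<in>\<Omega>. \<Psi> (ennreal (a x)) \<partial>lebesgue) + (1/2) * (\<integral>\<^sup>+x\<in>\<Omega>. \<Psi> (ennreal (b x)) \<partial>lebesgue)"
      using Psim[OF am(1)] Psim[OF am(2)] by (simp add: nn_integral_add nn_integral_cmult)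
    also have "\<dots> \<le> (1/2) * \<beta> + (1/2) * \<beta>" using A(3) B(3) by (intro add_mono mult_left_mono) auto
    also have "\<dots> = \<beta>" by (simp add: distrib_right[symmetric] half_ennreal)
    finally have "(\<integral>\<^sup>+x\<in>\<Omega>. \<Psi> (ennreal ((1/2) *\<^sub>R (a x + b x))) \<partial>lebesgue) \<le> \<beta>" .
    moreover have "bounded_potential k (\<lambda>x. (1/2) *\<^sub>R (a x + b x))"
      unfolding bounded_potential_def
    proof (intro conjI allI)
      show "(\<lambda>x. (1/2) *\<^sub>R (a x + b x)) \<in> borel_measurable lebesgue" using am by auto
      show "0 \<le> (1/2) *\<^sub>R (a x + b x)" "(1/2) *\<^sub>R (a x + b x) \<le> k" for x
        using n(1)[of x] n(2)[of x] n(3)[of x] n(4)[of x] by auto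
    qed
    ultimately show ?thesis using A(2) B(2) by (simp add: G_def)
  qed
  obtain w where w: "\<And>n. w n \<in> C n" "\<And>e. e > 0 \<Longrightarrow> \<exists>N. \<forall>m\<ge>N. \<forall>n\<ge>N. sqnorm (\<lambda>x. w m x - w n x) / 4 < e"
  proof (rule midpoint_minimization[where C = C and q = sqnorm and M = M
        and mid = "\<lambda>a b x. (1/2) *\<^sub>R (a x + b x)" and D = "\<lambda>a b. sqnorm (\<lambda>x. a x - b x) / 4"])
    show "C (Suc n) \<subseteq> C n" for n unfolding C_def by (auto dest: Suc_leD)
    show "C n \<noteq> {}" for n using WC by auto
    show "\<exists>a\<in>C n. sqnorm a \<le> M" for n using WC GL(2)[OF CG[OF WC]] by blast
    show "sqnorm (\<lambda>x. (1/2) *\<^sub>R (a x + b x)) + sqnorm (\<lambda>x. a x - b x) / 4 \<le> (sqnorm a + sqnorm b) / 2"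
      if "a \<in> C 0" "b \<in> C 0" for a b
      using sqnorm_parallelogram[OF GL(1)[OF CG[OF that(1)]] GL(1)[OF CG[OF that(2)]]] by simp
    show "0 \<le> sqnorm a" for a :: "'a \<Rightarrow> real" by simp
    show "(\<lambda>x. (1/2) *\<^sub>R (v x + w x)) \<in> C n" if vw: "v \<in> C n" "w \<in> C n" for n v w
      unfolding C_def
    proof (intro CollectI conjI ballI allI impI)
      show "(\<lambda>x. (1/2) *\<^sub>R (v x + w x)) \<in> G" by (intro midG CG[OF vw(1)] CG[OF vw(2)])
      fix B :: "'a set" and c assume B: "B \<in> rational_boxes" and c: "\<forall>j\<ge>n. \<bar>pairing (indicator B) (W j) - l B\<bar> \<le> c"
      have LB: "L2 (indicator B :: 'a \<Rightarrow> real)" using rational_boxes_box[OF B] L2_indicator_box by auto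
      have 1: "\<bar>pairing (indicator B) v - l B\<bar> \<le> c" "\<bar>pairing (indicator B) w - l B\<bar> \<le> c"
        using vw B c unfolding C_def by blast+
      have "(\<integral>x. indicator B x * ((1/2) *\<^sub>R (v x + w x)) \<partial>lebesgue)
          = (\<integral>x. (1/2) * (indicator B x * v x + indicator B x * w x) \<partial>lebesgue)"
        by (intro Bochner_Integration.integral_cong refl) (simp add: field_simps)
      also have "\<dots> = (1/2) * (pairing (indicator B) v + pairing (indicator B) w)"
        using L2_mult_integrable[OF LB GL(1)[OF CG[OF vw(1)]]] L2_mult_integrable[OF LB GL(1)[OF CG[OF vw(2)]]]
        by simp
      finally have "(\<integral>x. indicator B x * ((1/2) *\<^sub>R (v x + w x)) \<partial>lebesgue)
          = (1/2) * (pairing (indicator B) v + pairing (indicator B) w)" .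
      moreover have "\<bar>Z - z\<bar> \<le> c" if "\<bar>X - z\<bar> \<le> c" "\<bar>Y - z\<bar> \<le> c" "Z = (1/2) * (X + Y)" for X Y Z z :: real
        using that by (auto simp: abs_le_iff)
      ultimately show "\<bar>(\<integral>x. indicator B x * ((1/2) *\<^sub>R (v x + w x)) \<partial>lebesgue) - l B\<bar> \<le> c" using 1 by blast
    qed
  qed (rule that; assumption)
  have wG: "w n \<in> G" for n using w(1) CG by blast
  have Cau: "\<exists>N. \<forall>m\<ge>N. \<forall>n\<ge>N. sqnorm (\<lambda>x. w m x - w n x) < e" if "e > 0" for e
    using w(2)[of "e/4"] that by simp
  obtain s where s: "strict_mono s" "\<And>n m. n \<le> m \<Longrightarrow> sqnorm (\<lambda>x. w (s m) x - w (s n) x) \<le> (1/4)^n"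
    by (rule fast_subseq[of "\<lambda>m n. sqnorm (\<lambda>x. w m x - w n x)" "\<lambda>n. (1/4)^n", OF Cau]) auto
  obtain u where u: "L2 u" "\<And>n. sqnorm (\<lambda>x. w (s n) x - u x) \<le> (1/4) ^ n"
    using L2_complete_fast[of "\<lambda>n. w (s n)", OF GL(1)[OF wG] s(2)] by blast
  have wu: "AE x in lebesgue. (\<lambda>n. w (s n) x) \<longlonglongrightarrow> u x"
    by (rule fast_L2_limit_AE[of _ _ 1, OF GL(1)[OF wG] u(1)]) (use u(2) in simp)
  define U where "U x = (if x \<in> \<Omega> then max 0 (min k (u x)) else 0)" for x
  have Um: "U \<in> borel_measurable lebesgue"
    unfolding U_def using L2_measurable[OF u(1)] Om by (intro measurable_If_set) auto
  have Ub: "bounded_potential k U" unfolding bounded_potential_def using Um k by (auto simp: U_def)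
  have wU: "AE x in lebesgue. (\<lambda>n. w (s n) x) \<longlonglongrightarrow> U x"
    using wu
  proof eventually_elim
    case (elim x)
    have "0 \<le> w n x" "w n x \<le> k" for n using GD(1)[OF wG] by (auto simp: bounded_potential_def)
    then have "0 \<le> u x" "u x \<le> k" using LIMSEQ_le_const[OF elim] LIMSEQ_le_const2[OF elim] by blast+
    moreover have "u x = 0" if "x \<notin> \<Omega>"
    proof -
      have "w n x = 0" for n by (rule GD(2)[OF wG that])
      then show ?thesis using elim by (simp add: LIMSEQ_const_iff)
    qed
    ultimately have "U x = u x" by (auto simp: U_def)
    then show ?case using elim by simp
  qed
  have Uu: "AE x in lebesgue. u x = U x" using wu wU by eventually_elim (rule LIMSEQ_unique)
  have UPsi: "(\<integral>\<^sup>+x\<in>\<Omega>. \<Psi> (ennreal (U x)) \<partial>lebesgue) \<le> \<beta>"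
  proof -
    have "(\<integral>\<^sup>+x\<in>\<Omega>. \<Psi> (ennreal (U x)) \<partial>lebesgue) \<le> (\<integral>\<^sup>+x. liminf (\<lambda>n. \<Psi> (ennreal (w (s n) x)) * indicator \<Omega> x) \<partial>lebesgue)"
    proof (rule nn_integral_mono_AE)
      show "AE x in lebesgue. \<Psi> (ennreal (U x)) * indicator \<Omega> x \<le> liminf (\<lambda>n. \<Psi> (ennreal (w (s n) x)) * indicator \<Omega> x)"
        using wU
      proof eventually_elim
        case (elim x)
        have "\<Psi> (ennreal (U x)) \<le> liminf (\<lambda>n. \<Psi> (ennreal (w (s n) x)))"
          by (rule lower_semicontinuous[OF tendsto_ennrealI[OF elim]])
        then show ?case by (auto split: split_indicator)
      qed
    qed
    also have "\<dots> \<le> liminf (\<lambda>n. \<integral>\<^sup>+x\<in>\<Omega>. \<Psi> (ennreal (w (s n) x)) \<partial>lebesgue)"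
      by (rule nn_integral_liminf) (intro Psim L2_measurable[OF GL(1)[OF wG]])
    also have "\<dots> \<le> \<beta>"
      using GD(3)[OF wG] by (intro Liminf_le always_eventually) auto
    finally show ?thesis .
  qed
  have U0: "U x = 0" if "x \<notin> \<Omega>" for x using that by (simp add: U_def)
  show thesis
  proof (rule that[OF Ub U0 UPsi])
    show "(\<lambda>n. pairing f (W n)) \<longlonglongrightarrow> pairing f U" if "integrable lebesgue f" for f
    proof (rule weak_convergence_from_boxes[OF W(1) Ub W(2) U0 O(2) _ that])
      fix B :: "'a set" assume B: "B \<in> rational_boxes"
      have LB: "L2 (indicator B :: 'a \<Rightarrow> real)" using rational_boxes_box[OF B] L2_indicator_box by auto
      have "(\<lambda>n. pairing (indicator B) (w n)) \<longlonglongrightarrow> l B"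
      proof (rule LIMSEQ_I)
        fix r :: real assume r: "r > 0"
        then have "r / 2 > 0" by simp
        from LIMSEQ_D[OF l[OF B] this] obtain N where N: "\<And>j. j \<ge> N \<Longrightarrow> norm (pairing (indicator B) (W j) - l B) < r / 2"
          by blast
        have "norm (pairing (indicator B) (w n) - l B) < r" if "n \<ge> N" for n
        proof -
          have "\<forall>j\<ge>n. \<bar>pairing (indicator B) (W j) - l B\<bar> \<le> r / 2"
            using N that unfolding real_norm_def by (meson less_imp_le order_trans)
          then have "\<bar>pairing (indicator B) (w n) - l B\<bar> \<le> r / 2"
            using w(1)[of n] B unfolding C_def by blast
          then show ?thesis using r by simp
        qed
        then show "\<exists>N. \<forall>n\<ge>N. norm (pairing (indicator B) (w n) - l B) < r" by blast
      qed
      from LIMSEQ_subseq_LIMSEQ[OF this s(1)]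
      have 1: "(\<lambda>n. pairing (w (s n)) (indicator B)) \<longlonglongrightarrow> l B" by (simp add: comp_def mult.commute)
      have "(\<lambda>n. (1/4::real)^n) \<longlonglongrightarrow> 0" by (rule LIMSEQ_power_zero) simp
      then have "(\<lambda>n. sqnorm (\<lambda>x. w (s n) x - u x)) \<longlonglongrightarrow> 0"
        by (rule Lim_null_comparison[rotated]) (use u(2) in auto)
      from L2_limit_mult[OF GL(1)[OF wG] u(1) LB this] 1
      have "pairing u (indicator B) = l B" using LIMSEQ_unique by blast
      moreover have "pairing u (indicator B) = pairing (indicator B) U"
        using Uu L2_measurable[OF u(1)] Um L2_measurable[OF LB] by (intro integral_cong_AE) auto
      ultimately show "(\<lambda>n. pairing (indicator B) (W n)) \<longlonglongrightarrow> pairing (indicator B) U"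
        using l[OF B] by simp
    qed
  qed
qed

end

section \<open>Existence of an optimal potential\<close>

text \<open>The extension by zero has bounded support, which places truncated potentials in \<open>L\<^sup>2\<close> of the
  whole space.\<close>

definition truncation :: "'a::euclidean_space set \<Rightarrow> nat \<Rightarrow> ('a \<Rightarrow> ennreal) \<Rightarrow> 'a \<Rightarrow> real" where
  "truncation \<Omega> k V x = (if x \<in> \<Omega> then enn2real (min (V x) (ennreal (real k))) else 0)"

lemma ennreal_truncation: "x \<in> \<Omega> \<Longrightarrow> ennreal (truncation \<Omega> k V x) = min (V x) (ennreal (real k))"
  by (simp add: truncation_def ennreal_enn2real_if min_def top_unique)

lemma bounded_potential_truncation:
  fixes V :: "'a::euclidean_space \<Rightarrow> ennreal"
  assumes O: "open \<Omega>" and V: "V \<in> borel_measurable (lebesgue_on \<Omega>)"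
  shows "bounded_potential (real k) (truncation \<Omega> k V)"
  unfolding bounded_potential_def
proof (intro conjI allI)
  have "(\<lambda>x. enn2real (min (V x) (ennreal (real k)))) \<in> borel_measurable (lebesgue_on \<Omega>)"
    using V by measurable
  then show "truncation \<Omega> k V \<in> borel_measurable lebesgue"
    unfolding truncation_def by (rule borel_measurable_if_I) (use O in \<open>auto intro: borel_imp_lebesgue\<close>)
  show "0 \<le> truncation \<Omega> k V x" for x by (simp add: truncation_def)
  show "truncation \<Omega> k V x \<le> real k" for x
    unfolding truncation_def by (auto intro!: enn2real_leI)
qed

lemma truncation_mono: "truncation \<Omega> k V x \<le> truncation \<Omega> (Suc k) V x"
proof (cases "x \<in> \<Omega>")
  case True
  have "ennreal (truncation \<Omega> k V x) \<le> ennreal (truncation \<Omega> (Suc k) V x)"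
    unfolding ennreal_truncation[OF True] by (intro min.mono ennreal_leI) auto
  then show ?thesis by (subst (asm) ennreal_le_iff) (simp_all add: truncation_def)
qed (simp add: truncation_def)

text \<open>Test the two limits with the positive part of \<open>U - V\<close>.\<close>

lemma weak_limit_mono:
  fixes U V :: "'a::euclidean_space \<Rightarrow> real"
  assumes b: "bounded_potential k U" "bounded_potential m V" "\<And>x. x \<notin> S \<Longrightarrow> U x = 0" "\<And>x. x \<notin> S \<Longrightarrow> V x = 0" "bounded S"
    and W: "\<And>n. bounded_potential k (W n)" "\<And>n. bounded_potential m (Z n)" "\<And>n x. W n x \<le> Z n x"
    and lim: "\<And>f. integrable lebesgue f \<Longrightarrow> (\<lambda>n. pairing f (W n)) \<longlonglongrightarrow> pairing f U"
      "\<And>f. integrable lebesgue f \<Longrightarrow> (\<lambda>n. pairing f (Z n)) \<longlonglongrightarrow> pairing f V"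
  shows "AE x in lebesgue. U x \<le> V x"
proof -
  obtain R where R: "S \<subseteq> cball 0 R" using b(5) unfolding bounded_pos by (auto simp: subset_eq)
  define f where "f x = max 0 (U x - V x)" for x
  have LU: "L2 U" and LV: "L2 V"
    using bounded_potential_L2(1)[OF b(1,3) R] bounded_potential_L2(1)[OF b(2,4) R] by blast+
  have fm: "f \<in> borel_measurable lebesgue"
    unfolding f_def using L2_measurable[OF LU] L2_measurable[OF LV] by auto
  have fb: "\<bar>f x\<bar> \<le> \<bar>U x - V x\<bar>" for x by (auto simp: f_def)
  have Lf: "L2 f"
  proof (rule L2_bound(1)[OF fm L2_integrable[OF L2_diff[OF LU LV]]])
    show "AE x in lebesgue. (norm (f x))\<^sup>2 \<le> (norm (U x - V x))\<^sup>2"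
      using fb by (intro AE_I2 power_mono) auto
  qed
  have "integrable lebesgue (\<lambda>x. f x * indicator (cball 0 R) x)"
    by (rule L2_mult_integrable[OF Lf L2_indicator_cball])
  moreover have "f x * indicator (cball 0 R) x = f x" for x
  proof (cases "x \<in> cball 0 R")
    case False
    then have "x \<notin> S" using R by blast
    then show ?thesis using b(3)[of x] b(4)[of x] by (simp add: f_def)
  qed simp
  ultimately have fi: "integrable lebesgue f" by simp
  have le: "pairing f U \<le> pairing f V"
  proof (rule LIMSEQ_le[OF lim(1)[OF fi] lim(2)[OF fi]])
    have "pairing f (W n) \<le> pairing f (Z n)" for n
      using W(3) by (intro integral_mono bounded_potential_integrable(1)[OF W(1) fi] bounded_potential_integrable(1)[OF W(2) fi] mult_left_mono)
        (auto simp: f_def)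
    then show "\<exists>N. \<forall>n\<ge>N. (pairing f (W n)) \<le> pairing f (Z n)" by blast
  qed
  have "sqnorm f = (\<integral>x. f x * U x - f x * V x \<partial>lebesgue)"
    unfolding sqnorm_real by (intro Bochner_Integration.integral_cong refl)
      (auto simp: f_def power2_eq_square max_def algebra_simps)
  also have "\<dots> = pairing f U - pairing f V"
    by (intro Bochner_Integration.integral_diff bounded_potential_integrable(1)[OF b(1) fi] bounded_potential_integrable(1)[OF b(2) fi])
  finally have "sqnorm f \<le> 0" using le by simp
  then have "AE x in lebesgue. f x = 0" by (rule sqnorm_zero_AE[OF Lf])
  then show ?thesis by eventually_elim (auto simp: f_def max_def split: if_splits)
qed

text \<open>The weak limits are ordered only almost everywhere; their running maxima are ordered everywhere and
  coincide with them almost everywhere.\<close>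

primrec running_max :: "(nat \<Rightarrow> 'a \<Rightarrow> real) \<Rightarrow> nat \<Rightarrow> 'a \<Rightarrow> real" where
  "running_max U 0 = U 0"
| "running_max U (Suc k) = (\<lambda>x. max (running_max U k x) (U (Suc k) x))"

lemma bounded_potential_running_max:
  assumes "\<And>k. bounded_potential (real k) (U k)"
  shows "bounded_potential (real k) (running_max U k)"
proof (induction k)
  case 0 then show ?case using assms[of 0] by simp
next
  case (Suc k)
  have "running_max U k x \<le> real (Suc k)" for x
    using Suc by (auto simp: bounded_potential_def intro: order_trans)
  then show ?case using Suc assms[of "Suc k"] by (auto simp: bounded_potential_def le_max_iff_disj)
qed

lemma running_max_AE_eq:
  fixes U :: "nat \<Rightarrow> 'a::euclidean_space \<Rightarrow> real"
  assumes "\<And>k. AE x in lebesgue. U k x \<le> U (Suc k) x"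
  shows "AE x in lebesgue. running_max U k x = U k x"
proof (induction k)
  case (Suc k)
  show ?case using Suc assms[of k] by eventually_elim simp
qed simp

theorem theorem4p1:
  fixes \<Omega> :: "'a::euclidean_space set"
    and \<Psi> :: "ennreal \<Rightarrow> ennreal"
    and F :: "'a measure \<Rightarrow> real"
  assumes "open \<Omega>" and "bounded \<Omega>"
    and "\<And>s t. s < t \<Longrightarrow> \<Psi> t < \<Psi> s"
    and "ennreal_convex_on (range \<Psi>) (inv \<Psi>)"
    and "admissible \<Omega> \<Psi> \<noteq> {}"
    and "increasing_on_Mcap \<Omega> F"
    and "gamma_lsc \<Omega> F"
  shows "\<exists>V\<in>admissible \<Omega> \<Psi>. \<forall>W\<in>admissible \<Omega> \<Psi>.
           F (potential_measure \<Omega> V) \<le> F (potential_measure \<Omega> W)"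
proof -
  interpret decreasing_convex_inverse \<Psi> by unfold_locales (rule assms(3), assumption, rule assms(4))
  note O = assms(1,2)
  have Om: "\<Omega> \<in> sets lebesgue" using O(1) by (intro borel_imp_lebesgue) simp
  define G where "G V = ereal (F (potential_measure \<Omega> V))" for V
  define m where "m = (INF V\<in>admissible \<Omega> \<Psi>. G V)"
  obtain g where g: "\<And>n. g n \<in> G ` admissible \<Omega> \<Psi>" "g \<longlonglongrightarrow> m"
    using Inf_as_limit[of "G ` admissible \<Omega> \<Psi>"] assms(5) unfolding m_def by auto
  then have "\<forall>n. \<exists>V. V \<in> admissible \<Omega> \<Psi> \<and> g n = G V" by blast
  then obtain V where V: "\<And>n. V n \<in> admissible \<Omega> \<Psi>" "\<And>n. g n = G (V n)" by metis
  have Vm: "V n \<in> borel_measurable (lebesgue_on \<Omega>)" and V1: "(\<integral>\<^sup>+x\<in>\<Omega>. \<Psi> (V n x) \<partial>lebesgue) \<le> 1" for n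
    using V(1) by (auto simp: admissible_def)
  define W where "W k n = truncation \<Omega> k (V n)" for k n
  have Wb: "bounded_potential (real k) (W k n)" for k n
    unfolding W_def by (rule bounded_potential_truncation[OF O(1) Vm])
  have W0: "W k n x = 0" if "x \<notin> \<Omega>" for k n x using that by (simp add: W_def truncation_def)
  \<comment> \<open>The second summand is the price of truncation at height \<open>k\<close>.\<close>
  define \<beta> where "\<beta> k = 1 + (\<Psi> (ennreal (real k)) - \<Psi> top) * emeasure lebesgue \<Omega>" for k :: nat
  have Wbound: "(\<integral>\<^sup>+x\<in>\<Omega>. \<Psi> (ennreal (W k n x)) \<partial>lebesgue) \<le> \<beta> k" for k n
  proof -
    have "(\<integral>\<^sup>+x\<in>\<Omega>. \<Psi> (ennreal (W k n x)) \<partial>lebesgue)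
      \<le> (\<integral>\<^sup>+x. \<Psi> (V n x) * indicator \<Omega> x + (\<Psi> (ennreal (real k)) - \<Psi> top) * indicator \<Omega> x \<partial>lebesgue)"
      unfolding W_def
    proof (rule nn_integral_mono)
      fix x show "\<Psi> (ennreal (truncation \<Omega> k (V n) x)) * indicator \<Omega> x
        \<le> \<Psi> (V n x) * indicator \<Omega> x + (\<Psi> (ennreal (real k)) - \<Psi> top) * indicator \<Omega> x"
        using truncation_le[of "V n x" "ennreal (real k)"] by (cases "x \<in> \<Omega>") (simp_all add: ennreal_truncation)
    qed
    also have "\<dots> = (\<integral>\<^sup>+x\<in>\<Omega>. \<Psi> (V n x) \<partial>lebesgue) + (\<Psi> (ennreal (real k)) - \<Psi> top) * emeasure lebesgue \<Omega>"
    proof -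
      have "(\<lambda>x. \<Psi> (V n x) * indicator \<Omega> x) \<in> borel_measurable lebesgue"
        using measurable_compose[OF Vm Psi_measurable] Om borel_measurable_restrict_space_iff_ennreal[of \<Omega> lebesgue] by simp
      then show ?thesis using Om by (subst nn_integral_add) (auto simp: nn_integral_cmult_indicator)
    qed
    also have "\<dots> \<le> \<beta> k" unfolding \<beta>_def by (intro add_right_mono V1)
    finally show ?thesis .
  qed
  obtain R where R: "\<Omega> \<subseteq> cball 0 R" using O(2) unfolding bounded_pos by (auto simp: subset_eq)
  \<comment> \<open>A single subsequence serves all truncation levels and all rational boxes.\<close>
  define b where "b i = from_nat_into (rational_boxes :: 'a set set) i" for i
  have rb: "rational_boxes \<noteq> ({} :: 'a set set)" using Union_rational_boxes[of "UNIV :: 'a set"] by auto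
  have bi: "b i \<in> rational_boxes" for i unfolding b_def by (rule from_nat_into[OF rb])
  define M where "M k = real k * (\<integral>x. \<bar>indicator (cball 0 R) x :: real\<bar> \<partial>(lebesgue :: 'a measure))" for k
  have Lb: "L2 (indicator (b i) :: 'a \<Rightarrow> real)" for i using rational_boxes_box[OF bi[of i]] L2_indicator_box by auto
  have Ji: "integrable lebesgue (indicator (cball 0 R) :: 'a \<Rightarrow> real)"
    using L2_mult_integrable[OF L2_indicator_cball[of R] L2_indicator_cball[of R]]
    by (simp add: indicator_inter_arith[symmetric])
  have range: "(pairing (indicator (b i)) (W k n)) \<in> {- M k..M k}" for k n i
  proof -
    have i: "integrable lebesgue (\<lambda>x. indicator (b i) x * indicator (cball 0 R) x :: real)"
      by (rule L2_mult_integrable[OF Lb L2_indicator_cball])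
    have eqW: "indicator (b i) x * W k n x = (indicator (b i) x * indicator (cball 0 R) x) * W k n x" for x
    proof (cases "x \<in> cball 0 R")
      case False
      then have "x \<notin> \<Omega>" using R by blast
      then show ?thesis by (simp add: W0)
    qed simp
    have "\<bar>pairing (indicator (b i)) (W k n)\<bar> \<le> real k * (\<integral>x. \<bar>indicator (b i) x * indicator (cball 0 R) x :: real\<bar> \<partial>lebesgue)"
      unfolding eqW by (rule bounded_potential_integrable(2)[OF Wb i])
    also have "\<dots> \<le> M k"
      unfolding M_def by (intro mult_left_mono integral_mono integrable_abs i Ji) (auto split: split_indicator)
    finally show ?thesis by auto
  qed
  obtain r where r: "strict_mono (r :: nat \<Rightarrow> nat)" "\<And>p :: nat \<times> nat. convergent (\<lambda>n. \<integral>x. indicator (b (snd p)) x * W (fst p) (r n) x \<partial>lebesgue)"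
    using coordinatewise_convergent_subsequence[of "\<lambda>n p. \<integral>x. indicator (b (snd p)) x * W (fst p) n x \<partial>lebesgue"
        "\<lambda>p. - M (fst p)" "\<lambda>p. M (fst p)", OF range] by blast
  have conv: "convergent (\<lambda>n. pairing (indicator B) (W k (r n)))" if B: "B \<in> rational_boxes" for B k
  proof -
    obtain i where "B = b i" unfolding b_def using from_nat_into_surj[OF countable_rational_boxes B] by blast
    then show ?thesis using r(2)[of "(k, i)"] by simp
  qed
  have "\<forall>k. \<exists>U. bounded_potential (real k) U \<and> (\<forall>x. x \<notin> \<Omega> \<longrightarrow> U x = 0) \<and> (\<integral>\<^sup>+x\<in>\<Omega>. \<Psi> (ennreal (U x)) \<partial>lebesgue) \<le> \<beta> k
    \<and> (\<forall>f. integrable lebesgue f \<longrightarrow> (\<lambda>n. pairing f (W k (r n))) \<longlonglongrightarrow> pairing f U)"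
  proof
    fix k
    obtain U where "bounded_potential (real k) U" "\<And>x. x \<notin> \<Omega> \<Longrightarrow> U x = 0" "(\<integral>\<^sup>+x\<in>\<Omega>. \<Psi> (ennreal (U x)) \<partial>lebesgue) \<le> \<beta> k"
      "\<And>f. integrable lebesgue f \<Longrightarrow> (\<lambda>n. pairing f (W k (r n))) \<longlonglongrightarrow> pairing f U"
      using weak_limit_of_potentials[of \<Omega> "real k" "\<lambda>n. W k (r n)" "\<beta> k", OF O Wb W0 Wbound conv] by blast
    then show "\<exists>U. bounded_potential (real k) U \<and> (\<forall>x. x \<notin> \<Omega> \<longrightarrow> U x = 0) \<and> (\<integral>\<^sup>+x\<in>\<Omega>. \<Psi> (ennreal (U x)) \<partial>lebesgue) \<le> \<beta> k
      \<and> (\<forall>f. integrable lebesgue f \<longrightarrow> (\<lambda>n. pairing f (W k (r n))) \<longlonglongrightarrow> pairing f U)" by blast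
  qed
  from choice[OF this] obtain U where U: "\<And>k. bounded_potential (real k) (U k)" "\<And>k x. x \<notin> \<Omega> \<Longrightarrow> U k x = 0"
    "\<And>k. (\<integral>\<^sup>+x\<in>\<Omega>. \<Psi> (ennreal (U k x)) \<partial>lebesgue) \<le> \<beta> k"
    "\<And>k f. integrable lebesgue f \<Longrightarrow> (\<lambda>n. pairing f (W k (r n))) \<longlonglongrightarrow> pairing f (U k)" by blast
  have Umono: "AE x in lebesgue. U k x \<le> U (Suc k) x" for k
    by (rule weak_limit_mono[OF U(1) U(1) U(2) U(2) O(2) Wb Wb _ U(4) U(4)]) (auto simp: W_def truncation_mono)
  define X where "X = running_max U"
  have Xb: "bounded_potential (real k) (X k)" for k
    unfolding X_def by (rule bounded_potential_running_max[OF U(1)])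
  have XU: "AE x in lebesgue. X k x = U k x" for k
    unfolding X_def by (rule running_max_AE_eq) (rule Umono)
  have Xmono: "X k x \<le> X (Suc k) x" for k x by (simp add: X_def)
  \<comment> \<open>Here monotonicity of \<open>F\<close> enters: truncation lowers the measure.\<close>
  have Gle: "G (\<lambda>x. ennreal (W k (r n) x)) \<le> g (r n)" for k n
    unfolding V(2) G_def ereal_less_eq
  proof (rule assms(6)[unfolded increasing_on_Mcap_def, rule_format])
    note mW = bounded_potential_measurable[OF Wb]
    show "potential_measure \<Omega> (\<lambda>x. ennreal (W k (r n) x)) \<in> Mcap \<Omega>" "potential_measure \<Omega> (V (r n)) \<in> Mcap \<Omega>"
      by (intro potential_measure_in_Mcap O mW Vm)+
    fix E :: "'a set" assume E: "E \<in> sets borel"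
    show "emeasure (potential_measure \<Omega> (\<lambda>x. ennreal (W k (r n) x))) E \<le> emeasure (potential_measure \<Omega> (V (r n))) E"
      by (rule potential_measure_mono[OF O(1) mW Vm _ E]) (simp add: W_def ennreal_truncation)
  qed
  have GX: "G (\<lambda>x. ennreal (X k x)) \<le> m" for k
  proof -
    have weak: "(\<lambda>n. pairing f (W k (r n))) \<longlonglongrightarrow> pairing f (X k)" if f: "integrable lebesgue f" for f
    proof -
      have "pairing f (X k) = pairing f (U k)"
        using XU[of k] borel_measurable_integrable[OF f] Xb[of k] U(1)[of k]
        by (intro integral_cong_AE) (auto simp: bounded_potential_def)
      then show ?thesis using U(4)[OF f, of k] by simp
    qed
    have "gamma_converges \<Omega> (\<lambda>n. potential_measure \<Omega> (\<lambda>x. ennreal (W k (r n) x))) (potential_measure \<Omega> (\<lambda>x. ennreal (X k x)))"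
      by (rule gamma_converges_weak[OF O(1) Wb Xb _ weak]) simp_all
    then have "G (\<lambda>x. ennreal (X k x)) \<le> liminf (\<lambda>n. G (\<lambda>x. ennreal (W k (r n) x)))"
      unfolding G_def using assms(7)[unfolded gamma_lsc_def, rule_format,
        of "\<lambda>n. potential_measure \<Omega> (\<lambda>x. ennreal (W k (r n) x))" "potential_measure \<Omega> (\<lambda>x. ennreal (X k x))"]
        potential_measure_in_Mcap[OF O(1) bounded_potential_measurable[OF Wb]]
        potential_measure_in_Mcap[OF O(1) bounded_potential_measurable[OF Xb]] by blast
    also have "\<dots> \<le> liminf (\<lambda>n. g (r n))" by (intro Liminf_mono always_eventually allI Gle)
    also have "\<dots> = m"
      using LIMSEQ_subseq_LIMSEQ[OF g(2) r(1)] by (intro lim_imp_Liminf) (auto simp: comp_def)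
    finally show ?thesis .
  qed
  define Y where "Y x = (SUP k. ennreal (X k x))" for x
  have Ym: "Y \<in> borel_measurable (lebesgue_on \<Omega>)"
    unfolding Y_def by (intro borel_measurable_SUP bounded_potential_measurable[OF Xb]) auto
  have "gamma_converges \<Omega> (\<lambda>k. potential_measure \<Omega> (\<lambda>x. ennreal (X k x))) (potential_measure \<Omega> Y)"
    unfolding Y_def[abs_def] by (rule gamma_converges_increasing[OF O(1)]) (rule Xb, rule Xmono)
  then have "G Y \<le> liminf (\<lambda>k. G (\<lambda>x. ennreal (X k x)))"
    unfolding G_def using assms(7)[unfolded gamma_lsc_def, rule_format,
      of "\<lambda>k. potential_measure \<Omega> (\<lambda>x. ennreal (X k x))" "potential_measure \<Omega> Y"]
      potential_measure_in_Mcap[OF O(1) bounded_potential_measurable[OF Xb]]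
      potential_measure_in_Mcap[OF O(1) Ym] by blast
  also have "\<dots> \<le> m" by (intro Liminf_le always_eventually allI GX) simp
  finally have GY: "G Y \<le> m" .
  have Ybound: "(\<integral>\<^sup>+x\<in>\<Omega>. \<Psi> (Y x) \<partial>lebesgue) \<le> \<beta> k" for k
  proof -
    have "(\<integral>\<^sup>+x\<in>\<Omega>. \<Psi> (Y x) \<partial>lebesgue) \<le> (\<integral>\<^sup>+x\<in>\<Omega>. \<Psi> (ennreal (U k x)) \<partial>lebesgue)"
    proof (rule nn_integral_mono_AE)
      show "AE x in lebesgue. \<Psi> (Y x) * indicator \<Omega> x \<le> \<Psi> (ennreal (U k x)) * indicator \<Omega> x"
        using XU[of k]
      proof eventually_elim
        case (elim x)
        have "ennreal (U k x) \<le> Y x" unfolding elim[symmetric] Y_def by (rule SUP_upper) simp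
        then show ?case by (intro mult_right_mono antitone) auto
      qed
    qed
    also have "\<dots> \<le> \<beta> k" by (rule U(3))
    finally show ?thesis .
  qed
  have fin: "\<Psi> top \<noteq> top" using decreasing[of 0 top] by (auto simp: less_top[symmetric])
  \<comment> \<open>Since \<open>\<Psi> top < \<Psi> 0\<close>, the value \<open>\<Psi> top\<close> is finite and the difference tends to \<open>0\<close>.\<close>
  have "\<beta> \<longlonglongrightarrow> 1 + (\<Psi> top - \<Psi> top) * emeasure lebesgue \<Omega>"
    unfolding \<beta>_def
  proof (intro tendsto_add tendsto_const)
    have "emeasure lebesgue \<Omega> \<le> emeasure lborel (cball (0::'a) R)"
      using emeasure_mono[OF R, of lebesgue] by simp
    also have "\<dots> < top" using emeasure_compact_finite[of "cball (0::'a) R"] by simp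
    finally have fO: "emeasure lebesgue \<Omega> < top" .
    have "(\<lambda>k. \<Psi> (ennreal (real k)) - \<Psi> top) \<longlonglongrightarrow> \<Psi> top - \<Psi> top"
      by (rule tendsto_diff_ennreal_general[OF limit_at_top tendsto_const]) (use fin in simp)
    from ennreal_tendsto_cmult[OF fO this]
    show "(\<lambda>k. (\<Psi> (ennreal (real k)) - \<Psi> top) * emeasure lebesgue \<Omega>) \<longlonglongrightarrow> (\<Psi> top - \<Psi> top) * emeasure lebesgue \<Omega>"
      by (simp add: mult.commute)
  qed
  moreover have "\<Psi> top - \<Psi> top = 0" by (simp add: fin)
  ultimately have "\<beta> \<longlonglongrightarrow> 1" by simp
  then have "(\<integral>\<^sup>+x\<in>\<Omega>. \<Psi> (Y x) \<partial>lebesgue) \<le> 1"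
    by (rule tendsto_lowerbound) (use Ybound in auto)
  then have "Y \<in> admissible \<Omega> \<Psi>" using Ym by (simp add: admissible_def)
  moreover have "F (potential_measure \<Omega> Y) \<le> F (potential_measure \<Omega> Z)" if "Z \<in> admissible \<Omega> \<Psi>" for Z
  proof -
    have "m \<le> G Z" unfolding m_def by (rule INF_lower[OF that])
    with GY have "G Y \<le> G Z" by (rule order_trans)
    then show ?thesis by (simp add: G_def)
  qed
  ultimately show ?thesis by blast
qed

end
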